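(* Let $1\le k<n-1$. Any horospherical convex hypersurface $\Sigma$ in the hyperbolic space $\mathbb H^n$ satisfies $$\int_\Sigma Vp_{k+1}\,d\mu\ \ge\ \int_\Sigma\Big(Vp_{k-1}+\frac{p_{k+1}}{V}\Big)d\mu .$$
   Context: $V=\cosh r$, $r$ the hyperbolic distance to a fixed point $x_0\in\mathbb H^n$. Hypersurfaces are smooth, closed and embedded. Horospherical convex means all principal curvatures (positive for geodesic spheres) are $\ge1$. $p_j=\sigma_j/\binom{n-1}{j}$ is the normalized $j$-th mean curvature, $\sigma_j$ being the $j$-th elementary symmetric function of the principal curvatures ($\sigma_0=1$); $d\mu$ is the induced area element. *)

theory Defs
  imports "HOL-Analysis.Analysis"
begin

text \<open>
  Hyperbolic space is the upper sheet of the hyperboloid in Minkowski space \<open>\<real>\<^sup>n \<times> \<real>\<close>.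
  For hypersurfaces, \<open>\<real>\<^sup>n\<close> is taken as \<open>\<real>\<^sup>m \<times> \<real>\<close> with \<open>m = CARD('m)\<close>, so that \<open>n = CARD('m) + 1\<close>
  and local parametrizations of hypersurfaces have domains in \<open>real^'m\<close>, which has dimension \<open>n - 1\<close>.
\<close>

type_synonym 'm minkowski = "((real^'m) \<times> real) \<times> real"

definition lorentz :: "'a::euclidean_space \<times> real \<Rightarrow> 'a \<times> real \<Rightarrow> real" where
  "lorentz X Y = fst X \<bullet> fst Y - snd X * snd Y"

definition hyperbolic_space :: "('a::euclidean_space \<times> real) set" where
  "hyperbolic_space = {X. lorentz X X = - 1 \<and> snd X > 0}"

definition hyp_dist :: "'a::euclidean_space \<times> real \<Rightarrow> 'a \<times> real \<Rightarrow> real" where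
  "hyp_dist X Y = arcosh (- lorentz X Y)"

definition weight :: "'a::euclidean_space \<times> real \<Rightarrow> 'a \<times> real \<Rightarrow> real" where
  "weight x0 x = cosh (hyp_dist x0 x)"


subsection \<open>Closed embedded hypersurfaces\<close>

primrec Ck_on :: "nat \<Rightarrow> 'a::real_normed_vector set \<Rightarrow> ('a \<Rightarrow> 'b::real_normed_vector) \<Rightarrow> bool" where
  "Ck_on 0 S f \<longleftrightarrow> continuous_on S f"
| "Ck_on (Suc k) S f \<longleftrightarrow>
     (\<forall>x\<in>S. f differentiable (at x)) \<and> (\<forall>v. Ck_on k S (\<lambda>x. frechet_derivative f (at x) v))"

text \<open>Only used for open \<open>S\<close>, since the derivatives are unrestricted ones.\<close>

definition smooth_on :: "'a::real_normed_vector set \<Rightarrow> ('a \<Rightarrow> 'b::real_normed_vector) \<Rightarrow> bool" where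
  "smooth_on S f \<longleftrightarrow> (\<forall>k. Ck_on k S f)"

definition local_param ::
  "'m::finite minkowski set \<Rightarrow> (real^'m) set \<Rightarrow> (real^'m \<Rightarrow> 'm minkowski) \<Rightarrow> bool" where
  "local_param \<Sigma> U \<phi> \<longleftrightarrow>
     open U \<and> smooth_on U \<phi> \<and> (\<forall>u\<in>U. inj (frechet_derivative \<phi> (at u))) \<and>
     openin (top_of_set \<Sigma>) (\<phi> ` U) \<and> (\<exists>\<psi>. homeomorphism U (\<phi> ` U) \<phi> \<psi>)"

text \<open>\<open>Closed\<close> means compact without boundary; connectedness is not required.\<close>

definition closed_hypersurface :: "'m::finite minkowski set \<Rightarrow> bool" where
  "closed_hypersurface \<Sigma> \<longleftrightarrow>
     \<Sigma> \<subseteq> hyperbolic_space \<and> compact \<Sigma> \<and> (\<forall>x\<in>\<Sigma>. \<exists>U \<phi>. local_param \<Sigma> U \<phi> \<and> x \<in> \<phi> ` U)"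

definition tangent_space :: "'m::finite minkowski set \<Rightarrow> 'm minkowski \<Rightarrow> 'm minkowski set" where
  "tangent_space \<Sigma> x =
     {frechet_derivative \<phi> (at u) w | U \<phi> u w. local_param \<Sigma> U \<phi> \<and> u \<in> U \<and> \<phi> u = x}"


subsection \<open>Outward unit normal, shape operator and principal curvatures\<close>

definition unit_normal_field ::
  "'m::finite minkowski set \<Rightarrow> ('m minkowski \<Rightarrow> 'm minkowski) \<Rightarrow> bool" where
  "unit_normal_field \<Sigma> \<nu> \<longleftrightarrow> continuous_on \<Sigma> \<nu> \<and>
     (\<forall>x\<in>\<Sigma>. lorentz (\<nu> x) x = 0 \<and> lorentz (\<nu> x) (\<nu> x) = 1 \<and>
        (\<forall>v\<in>tangent_space \<Sigma> x. lorentz (\<nu> x) v = 0))"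

definition hyp_exterior :: "('a::euclidean_space \<times> real) set \<Rightarrow> ('a \<times> real) set" where
  "hyp_exterior C =
     {y \<in> hyperbolic_space - C. \<not> bounded (connected_component_set (hyperbolic_space - C) y)}"

text \<open>
  The curve \<open>t \<mapsto> cosh t x + sinh t (\<nu> x)\<close> is the unit speed geodesic of hyperbolic space issuing
  from \<open>x\<close> in the direction \<open>\<nu> x\<close>.  It has to enter the exterior of the connected component
  of \<open>\<Sigma>\<close> through \<open>x\<close> (which is \<open>\<Sigma>\<close> itself if \<open>\<Sigma>\<close> is connected).
\<close>

definition outward_unit_normal ::
  "'m::finite minkowski set \<Rightarrow> ('m minkowski \<Rightarrow> 'm minkowski) \<Rightarrow> bool" where
  "outward_unit_normal \<Sigma> \<nu> \<longleftrightarrow> unit_normal_field \<Sigma> \<nu> \<and>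
     (\<forall>x\<in>\<Sigma>. \<forall>\<^sub>F t in at_right 0.
        cosh t *\<^sub>R x + sinh t *\<^sub>R \<nu> x \<in> hyp_exterior (connected_component_set \<Sigma> x))"

text \<open>
  The shape operator is \<open>v \<mapsto> \<nabla>\<^sub>v \<nu>\<close> for the Levi-Civita connection of hyperbolic space, that is, the
  projection of the flat derivative \<open>D\<^sub>v \<nu>\<close> to the tangent space of the hyperboloid.  No projection
  is needed, because \<open>lorentz (D\<^sub>v \<nu>) x = - lorentz (\<nu> x) v = 0\<close>.  With \<open>\<nu>\<close> outward, a geodesic sphere
  of radius \<open>r\<close> has shape operator \<open>coth r\<close> times the identity.
\<close>

definition shape_operator ::
  "'m::finite minkowski set \<Rightarrow> ('m minkowski \<Rightarrow> 'm minkowski) \<Rightarrow> 'm minkowski \<Rightarrow> 'm minkowski \<Rightarrow> 'm minkowski"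
  where
  "shape_operator \<Sigma> \<nu> x v =
     (THE s. \<exists>U \<phi> u w. local_param \<Sigma> U \<phi> \<and> u \<in> U \<and> \<phi> u = x \<and>
        frechet_derivative \<phi> (at u) w = v \<and> frechet_derivative (\<nu> \<circ> \<phi>) (at u) w = s)"

text \<open>
  The eigenvalues of the (self-adjoint) shape operator with multiplicity, in increasing order,
  read off from an orthonormal basis \<open>es\<close> of principal directions.
\<close>

definition principal_curvatures ::
  "'m::finite minkowski set \<Rightarrow> ('m minkowski \<Rightarrow> 'm minkowski) \<Rightarrow> 'm minkowski \<Rightarrow> real list" where
  "principal_curvatures \<Sigma> \<nu> x =
     (SOME ks. sorted ks \<and>
        (\<exists>es. length es = length ks \<and> span (set es) = tangent_space \<Sigma> x \<and>
          (\<forall>i<length es. \<forall>j<length es. lorentz (es ! i) (es ! j) = (if i = j then 1 else 0)) \<and>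
          (\<forall>i<length es. shape_operator \<Sigma> \<nu> x (es ! i) = (ks ! i) *\<^sub>R (es ! i))))"

definition horospherically_convex ::
  "'m::finite minkowski set \<Rightarrow> ('m minkowski \<Rightarrow> 'm minkowski) \<Rightarrow> bool" where
  "horospherically_convex \<Sigma> \<nu> \<longleftrightarrow> (\<forall>x\<in>\<Sigma>. \<forall>\<kappa>\<in>set (principal_curvatures \<Sigma> \<nu> x). 1 \<le> \<kappa>)"

definition elem_sym :: "nat \<Rightarrow> real list \<Rightarrow> real" where
  "elem_sym j ks = (\<Sum>I | I \<subseteq> {..<length ks} \<and> card I = j. \<Prod>i\<in>I. ks ! i)"

definition mean_curv ::
  "'m::finite minkowski set \<Rightarrow> ('m minkowski \<Rightarrow> 'm minkowski) \<Rightarrow> nat \<Rightarrow> 'm minkowski \<Rightarrow> real" where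
  "mean_curv \<Sigma> \<nu> j x = elem_sym j (principal_curvatures \<Sigma> \<nu> x) / real (CARD('m) choose j)"


subsection \<open>Induced area measure\<close>

definition area_density :: "(real^'m \<Rightarrow> 'm::finite minkowski) \<Rightarrow> real^'m \<Rightarrow> real" where
  "area_density \<phi> u =
     sqrt (det (\<chi> i j. lorentz (frechet_derivative \<phi> (at u) (axis i 1))
                              (frechet_derivative \<phi> (at u) (axis j 1))))"

text \<open>
  The measure on the Borel sets of \<open>\<Sigma>\<close> that is given in every local parametrization by the
  density \<open>sqrt (det g)\<close> of the induced metric \<open>g\<close>.
\<close>

definition area_measure :: "'m::finite minkowski set \<Rightarrow> 'm minkowski measure" where
  "area_measure \<Sigma> =
     (THE \<mu>. sets \<mu> = sets (restrict_space borel \<Sigma>) \<and>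
        (\<forall>U \<phi> A. local_param \<Sigma> U \<phi> \<longrightarrow> A \<in> sets borel \<longrightarrow> A \<subseteq> U \<longrightarrow>
           emeasure \<mu> (\<phi> ` A) = (\<integral>\<^sup>+u\<in>A. ennreal (area_density \<phi> u) \<partial>lborel)))"

end

theory Submission
  imports Defs
begin

text \<open>
  Write \<open>V = - lorentz x0 x\<close> and \<open>u = - lorentz x0 (\<nu> x)\<close> for the weight and the support function, and let \<open>F\<^sub>k\<close>
  be the tangential field obtained by applying the \<open>k\<close>-th Newton tensor to \<open>\<nabla> V\<close>.  Newton tensors are divergence
  free, so the divergence theorem for \<open>F\<^sub>k\<^sub>-\<^sub>1\<close> gives the Minkowski formula \<open>\<integral> u p\<^sub>k = \<integral> V p\<^sub>k\<^sub>-\<^sub>1\<close>, and for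
  \<open>(u / V) F\<^sub>k\<close> it gives \<open>\<integral> u\<^sup>2 p\<^sub>k\<^sub>+\<^sub>1 / V \<ge> \<integral> u p\<^sub>k\<close>, because \<open>\<nabla> (u / V) = (A - u / V) \<nabla> V / V\<close> and the shape
  operator satisfies \<open>A \<ge> 1 \<ge> u / V\<close>.  Since \<open>V\<^sup>2 - 1 = u\<^sup>2 + |\<nabla> V|\<^sup>2\<close>, the inequality follows.

  All Newton tensors are treated at once through their generating function, the cofactor operator of
  \<open>id + t A\<close>.  In a chart \<open>\<phi>\<close> the components of the resulting field are determinants in Minkowski space with the rows
  \<open>\<nu>\<close>, \<open>\<phi>\<close> and \<open>\<partial>\<^sub>j (\<phi> + t \<nu>)\<close>, one of them replaced by \<open>x0\<close>.  Their divergence contains no second derivatives,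
  by the symmetry of these and the antisymmetry of the determinant; this replaces the Codazzi equation.
\<close>

subsection \<open>Determinants\<close>

text \<open>Two choice operators shape the proof. \<open>area_measure\<close> is a
  \<open>THE\<close> over all charts, so existence and uniqueness of that measure are needed before
  any integral can be moved into a chart. The principal curvatures come from a \<open>SOME\<close>
  at each point separately, so nothing is known about how a principal frame depends on the point.
  Such frames serve for pointwise algebra only; all continuity and differentiability is read off
  from determinants of chart data.

  The parameter \<open>t\<close> is what makes these determinants available: their rows are partial
  derivatives of the single map \<open>\<phi> + t \<nu>\<close>, while one Newton tensor is only a
  coefficient in \<open>t\<close>. The coefficients are recovered by interpolation at
  \<open>t = 0, ..., m\<close>, a finite linear combination that commutes with integrals.

  The term with \<open>1 / V\<close> in the statement comes from the \<open>1\<close> in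
  \<open>u^2 + 1 \<le> V^2\<close>, multiplied by the (k+1)-st mean curvature and divided by
  \<open>V\<close>. The same bound gives \<open>u / V \<le> 1\<close>, which is where the threshold
  1 for the curvatures enters.\<close>

lemma det_reindex:
  fixes A :: "real^'a^'a::finite" and f :: "'b::finite \<Rightarrow> 'a"
  assumes inj: "inj f"
    and unit: "\<And>i j. i \<notin> range f \<Longrightarrow> A $ i $ j = (if i = j then 1 else 0)"
  shows "det A = det (\<chi> i j. A $ f i $ f j)"
proof -
  let ?t = "\<lambda>p. of_int (sign p) * (\<Prod>i\<in>UNIV. A $ i $ p i)"
  have bij: "bij_betw f UNIV (range f)" using inj by (simp add: bij_betw_def)
  \<comment> \<open>A permutation that moves an index outside \<open>range f\<close> picks an
    off-diagonal zero in that row, so only permutations of \<open>range f\<close> contribute to the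
    Leibniz sum.\<close>
  have z: "?t p = 0" if p: "p permutes UNIV" and np: "\<not> p permutes range f" for p
  proof -
    have "\<exists>i. i \<notin> range f \<and> p i \<noteq> i"
      using np permutes_superset[OF p] by blast
    then obtain i where "i \<notin> range f" "p i \<noteq> i" by blast
    then have "A $ i $ p i = 0" using unit by auto
    then show ?thesis by (simp add: prod_zero_iff) blast
  qed
  have "det A = sum ?t {p. p permutes UNIV}" by (simp add: det_def)
  also have "\<dots> = sum ?t {p. p permutes range f}"
    using z by (intro sum.mono_neutral_right) (auto intro: permutes_subset)
  also have "\<dots> = (\<Sum>p | p permutes UNIV. ?t (map_permutation UNIV f p))"
  \<comment> \<open>Transport along \<open>f\<close> turns permutations of the small index type into
    permutations of \<open>range f\<close> and keeps the sign.\<close>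
  proof (rule sum.reindex_bij_betw[symmetric])
    show "bij_betw (map_permutation UNIV f) {p. p permutes UNIV} {p. p permutes range f}"
    proof (rule bij_betwI[where g = "map_permutation (range f) (inv_into UNIV f)"])
      show "map_permutation UNIV f \<in> {p. p permutes UNIV} \<rightarrow> {p. p permutes range f}"
        using map_permutation_permutes[OF bij] by blast
      show "map_permutation (range f) (inv_into UNIV f) \<in> {p. p permutes range f} \<rightarrow> {p. p permutes UNIV}"
        using map_permutation_permutes[OF bij_betw_inv_into[OF bij]] by blast
    qed (use map_permutation_compose_inv[OF bij] map_permutation_compose_inv[OF bij_betw_inv_into[OF bij]] inj
      in \<open>auto simp: f_inv_into_f\<close>)
  qed
  also have "\<dots> = (\<Sum>p | p permutes UNIV. of_int (sign p) * (\<Prod>i\<in>UNIV. A $ f i $ f (p i)))"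
  proof (rule sum.cong, simp)
    fix p assume "p \<in> {p. p permutes (UNIV::'b set)}"
    then have p: "p permutes UNIV" by simp
    let ?q = "map_permutation UNIV f p"
    have q: "?q permutes range f" using map_permutation_permutes[OF bij p] .
    have "(\<Prod>i\<in>UNIV. A $ i $ ?q i) = (\<Prod>i\<in>range f. A $ i $ ?q i)"
      using q unit by (intro prod.mono_neutral_right) (auto simp: permutes_def)
    also have "\<dots> = (\<Prod>i\<in>UNIV. A $ f i $ f (p i))"
      using inj by (simp add: prod.reindex map_permutation_apply)
    finally show "?t ?q = of_int (sign p) * (\<Prod>i\<in>UNIV. A $ f i $ f (p i))"
      using inj p by (simp add: sign_map_permutation)
  qed
  finally show ?thesis by (simp add: det_def)
qed

subsection \<open>The Lorentz form\<close>

lemma bounded_bilinear_lorentz: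
  "bounded_bilinear (lorentz :: 'a::euclidean_space \<times> real \<Rightarrow> 'a \<times> real \<Rightarrow> real)"
proof -
  have 1: "bounded_bilinear (\<lambda>(X :: 'a \<times> real) (Y :: 'a \<times> real). fst X \<bullet> fst Y)"
    by (rule bounded_bilinear.comp[OF bounded_bilinear_inner bounded_linear_fst bounded_linear_fst])
  have 2: "bounded_bilinear (\<lambda>(X :: 'a \<times> real) (Y :: 'a \<times> real). snd X * snd Y)"
    by (rule bounded_bilinear.comp[OF bounded_bilinear_mult bounded_linear_snd bounded_linear_snd])
  interpret a: bounded_bilinear "\<lambda>(X :: 'a \<times> real) (Y :: 'a \<times> real). fst X \<bullet> fst Y" by (rule 1)
  interpret b: bounded_bilinear "\<lambda>(X :: 'a \<times> real) (Y :: 'a \<times> real). snd X * snd Y" by (rule 2)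
  obtain K where K: "\<And>(X :: 'a \<times> real) (Y :: 'a \<times> real). norm (fst X \<bullet> fst Y) \<le> norm X * norm Y * K" using a.bounded by blast
  obtain L where L: "\<And>(X :: 'a \<times> real) (Y :: 'a \<times> real). norm (snd X * snd Y) \<le> norm X * norm Y * L" using b.bounded by blast
  have "norm (lorentz X Y) \<le> norm X * norm Y * (K + L)" for X Y :: "'a \<times> real"
  proof -
    have "norm (lorentz X Y) \<le> norm (fst X \<bullet> fst Y) + norm (snd X * snd Y)"
      unfolding lorentz_def by (rule norm_triangle_ineq4)
    then show ?thesis using K[of X Y] L[of X Y] by (simp add: algebra_simps)
  qed
  then have "\<exists>K. \<forall>(X :: 'a \<times> real) (Y :: 'a \<times> real). norm (lorentz X Y) \<le> norm X * norm Y * K" by blast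
  then show ?thesis
    by unfold_locales
       (simp_all add: lorentz_def algebra_simps inner_add_left inner_add_right)
qed

interpretation lorentz: bounded_bilinear "lorentz :: 'a::euclidean_space \<times> real \<Rightarrow> 'a \<times> real \<Rightarrow> real"
  by (rule bounded_bilinear_lorentz)

lemma lorentz_commute: "lorentz X Y = lorentz Y X"
  by (simp add: lorentz_def inner_commute mult.commute)

text \<open>A vector orthogonal to a unit timelike vector is spacelike: orthogonality replaces
  \<open>fst x \<bullet> fst v\<close> by \<open>snd x * snd v\<close>, and Cauchy-Schwarz for the
  spatial parts does the rest. The factor in front of the form avoids a division.\<close>

lemma lorentz_tangent_bound:
  fixes x v :: "'a::euclidean_space \<times> real"
  assumes "lorentz x x = -1" "lorentz x v = 0"
  shows "(snd x)\<^sup>2 * lorentz v v \<ge> (norm (fst v))\<^sup>2"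
proof -
  have q: "(snd x)\<^sup>2 = 1 + (norm (fst x))\<^sup>2"
    using assms(1) by (simp add: lorentz_def power2_eq_square dot_square_norm)
  have "(fst x \<bullet> fst v)\<^sup>2 \<le> (norm (fst x))\<^sup>2 * (norm (fst v))\<^sup>2"
    using Cauchy_Schwarz_ineq[of "fst x" "fst v"] by (simp add: dot_square_norm)
  moreover have "fst x \<bullet> fst v = snd x * snd v" using assms(2) by (simp add: lorentz_def)
  ultimately have "(snd x)\<^sup>2 * (snd v)\<^sup>2 \<le> ((snd x)\<^sup>2 - 1) * (norm (fst v))\<^sup>2"
    using q by (simp add: power_mult_distrib)
  moreover have "lorentz v v = (norm (fst v))\<^sup>2 - (snd v)\<^sup>2"
    by (simp add: lorentz_def power2_eq_square dot_square_norm)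
  moreover have "(snd x)\<^sup>2 * lorentz v v = (snd x)\<^sup>2 * (norm (fst v))\<^sup>2 - (snd x)\<^sup>2 * (snd v)\<^sup>2"
    using calculation by (simp only: right_diff_distrib)
  ultimately show ?thesis by (simp add: algebra_simps)
qed

lemma lorentz_tangent_pos:
  fixes x v :: "'a::euclidean_space \<times> real"
  assumes "lorentz x x = -1" "lorentz x v = 0"
  shows "lorentz v v \<ge> 0" and "lorentz v v = 0 \<Longrightarrow> v = 0"
proof -
  have q: "(snd x)\<^sup>2 > 0"
    using assms(1) inner_ge_zero[of "fst x"] unfolding lorentz_def power2_eq_square by linarith
  have b: "(snd x)\<^sup>2 * lorentz v v \<ge> (norm (fst v))\<^sup>2" using lorentz_tangent_bound[OF assms] .
  then have "(snd x)\<^sup>2 * lorentz v v \<ge> 0" by (meson order.trans zero_le_power2)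
  then show "lorentz v v \<ge> 0" using q by (simp add: zero_le_mult_iff)
  assume 0: "lorentz v v = 0"
  then have "fst v = 0" using b by simp
  moreover have "snd v = 0" using 0 \<open>fst v = 0\<close> by (simp add: lorentz_def)
  ultimately show "v = 0" by (simp add: prod_eq_iff)
qed

text \<open>Reversed Cauchy-Schwarz inequality on one sheet of the hyperboloid. It reduces to
  \<open>(1 + a b)^2 \<le> (1 + a^2) (1 + b^2)\<close> for the norms \<open>a\<close>,
  \<open>b\<close> of the spatial parts.\<close>

lemma lorentz_hyperbolic_le:
  assumes "x \<in> hyperbolic_space" "y \<in> hyperbolic_space"
  shows "lorentz x y \<le> -1"
proof -
  have x: "(snd x)\<^sup>2 = 1 + (norm (fst x))\<^sup>2" "snd x > 0"
    using assms(1) by (auto simp: hyperbolic_space_def lorentz_def power2_eq_square dot_square_norm)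
  have y: "(snd y)\<^sup>2 = 1 + (norm (fst y))\<^sup>2" "snd y > 0"
    using assms(2) by (auto simp: hyperbolic_space_def lorentz_def power2_eq_square dot_square_norm)
  have "(1 + norm (fst x) * norm (fst y))\<^sup>2 \<le> (snd x * snd y)\<^sup>2"
    unfolding power_mult_distrib x y
    using sum_squares_bound[of "norm (fst x)" "norm (fst y)"]
    by (simp add: power2_eq_square algebra_simps)
  then have "1 + norm (fst x) * norm (fst y) \<le> snd x * snd y"
    using x(2) y(2) power2_le_imp_le by simp
  then show ?thesis
    using norm_cauchy_schwarz[of "fst x" "fst y"] by (simp add: lorentz_def)
qed

text \<open>\<open>cosh\<close> undoes \<open>arcosh\<close> because the argument is at least 1. The
  weight is thereby the restriction of a linear function of the ambient space.\<close>

lemma weight_eq: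
  assumes "x0 \<in> hyperbolic_space" "x \<in> hyperbolic_space"
  shows "weight x0 x = - lorentz x0 x"
  using lorentz_hyperbolic_le[OF assms] by (simp add: weight_def hyp_dist_def cosh_arcosh_real)

subsection \<open>The volume form of Minkowski space\<close>

text \<open>The index type has \<open>CARD('m) + 2\<close> elements, one for each vector of a frame
  made of the normal, the position and \<open>CARD('m)\<close> tangent vectors. Such a frame is then
  a square matrix with rows labelled by the same type as its columns.\<close>

definition coords :: "'m::finite minkowski \<Rightarrow> real^('m option option)" where
  "coords X = (\<chi> i. case i of None \<Rightarrow> snd X | Some None \<Rightarrow> snd (fst X) | Some (Some j) \<Rightarrow> fst (fst X) $ j)"

definition vdet :: "('m option option \<Rightarrow> 'm::finite minkowski) \<Rightarrow> real" where
  "vdet f = det (\<chi> i. coords (f i))"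

definition frame :: "'a \<Rightarrow> 'a \<Rightarrow> ('m \<Rightarrow> 'a) \<Rightarrow> 'm option option \<Rightarrow> 'a" where
  "frame n x w i = (case i of None \<Rightarrow> n | Some None \<Rightarrow> x | Some (Some j) \<Rightarrow> w j)"

lemma frame_simps [simp]:
  "frame n x w None = n" "frame n x w (Some None) = x" "frame n x w (Some (Some j)) = w j"
  by (simp_all add: frame_def)

lemma sum_option: "(\<Sum>i\<in>UNIV. f i) = f None + (\<Sum>j\<in>UNIV. f (Some (j::'a::finite)))"
  by (simp add: UNIV_option_conv sum.reindex)

lemma prod_option: "(\<Prod>i\<in>UNIV. f i) = f None * (\<Prod>j\<in>UNIV. f (Some (j::'a::finite)))"
  by (simp add: UNIV_option_conv prod.reindex)

lemma linear_coords: "linear coords"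
  by (rule linearI) (auto simp: coords_def vec_eq_iff split: option.splits)

lemma bounded_linear_coords: "bounded_linear coords"
  using linear_coords linear_conv_bounded_linear by blast

lemma coords_add: "coords (a + b) = coords a + coords b"
  and coords_scaleR: "coords (c *\<^sub>R a) = c *\<^sub>R coords a"
  by (simp_all add: linear_add[OF linear_coords] linear_scale[OF linear_coords])

lemma lorentz_coords:
  "lorentz X Y = (\<Sum>i\<in>UNIV. (if i = None then -1 else 1) * (coords X $ i * coords Y $ i))"
  by (simp add: sum_option coords_def lorentz_def inner_vec_def inner_prod_def)

lemma vdet_upd_alt:
  "vdet (f(k := a)) = det (\<chi> i. if i = k then coords a else coords (f i))"
  unfolding vdet_def by (rule arg_cong[of _ _ det]) (auto simp: vec_eq_iff)

lemma linear_vdet_upd: "linear (\<lambda>a. vdet (f(k := a)))"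
proof (rule linearI)
  fix a b :: "'a minkowski" and c :: real
  show "vdet (f(k := a + b)) = vdet (f(k := a)) + vdet (f(k := b))"
    unfolding vdet_upd_alt coords_add by (rule det_row_add)
  show "vdet (f(k := c *\<^sub>R a)) = c *\<^sub>R vdet (f(k := a))"
    unfolding vdet_upd_alt coords_scaleR scalar_mult_eq_scaleR[symmetric] real_scaleR_def by (rule det_row_mul)
qed

lemmas vdet_upd_add = linear_add[OF linear_vdet_upd]
  and vdet_upd_scaleR = linear_scale[OF linear_vdet_upd, unfolded real_scaleR_def]
  and vdet_upd_sum = linear_sum[OF linear_vdet_upd]

lemma vdet_equal_rows:
  assumes "i \<noteq> j" "f i = f j"
  shows "vdet f = 0"
  unfolding vdet_def by (rule det_identical_rows[OF assms(1)]) (simp add: row_def assms(2))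

text \<open>Polarization: expand the vanishing determinant with \<open>a + b\<close> in both
  rows.\<close>

lemma vdet_swap:
  assumes "i \<noteq> j"
  shows "vdet (f(i := a, j := b)) = - vdet (f(i := b, j := a))"
proof -
  have z: "vdet (f(i := c, j := c)) = 0" for c
    by (rule vdet_equal_rows[OF assms]) (use assms in auto)
  have "0 = vdet (f(i := a + b, j := a + b))" using z by simp
  also have "\<dots> = vdet (f(i := a + b, j := a)) + vdet (f(i := a + b, j := b))"
    by (rule vdet_upd_add)
  also have "\<dots> = vdet (f(i := a, j := a)) + vdet (f(i := b, j := a))
       + (vdet (f(i := a, j := b)) + vdet (f(i := b, j := b)))"
    unfolding fun_upd_twist[OF assms] vdet_upd_add ..
  finally show ?thesis using z by simp
qed

lemma vdet_expand:
  fixes C :: "'m::finite option option \<Rightarrow> 'm option option \<Rightarrow> real"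
  shows "vdet (\<lambda>i. \<Sum>j\<in>UNIV. C i j *\<^sub>R g j) = det (\<chi> i j. C i j) * vdet g"
proof -
  have "(\<chi> i. coords (\<Sum>j\<in>UNIV. C i j *\<^sub>R g j)) = (\<chi> i j. C i j) ** (\<chi> i. coords (g i))"
    by (simp add: vec_eq_iff linear_sum[OF linear_coords] coords_scaleR matrix_matrix_mult_def)
  then show ?thesis by (simp add: vdet_def det_mul)
qed

lemma vdet_frame_expand:
  fixes e :: "'m::finite \<Rightarrow> 'm minkowski"
  shows "vdet (frame n x (\<lambda>i. \<Sum>j\<in>UNIV. C i j *\<^sub>R e j)) = det (\<chi> i j. C i j) * vdet (frame n x e)"
proof -
  \<comment> \<open>The matrix \<open>C\<close> bordered by an identity block for the rows of the
    normal and the position; \<open>det_reindex\<close> removes the border.\<close>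
  define B where "B = (\<lambda>i j :: 'm option option. case i of Some (Some k) \<Rightarrow>
     (case j of Some (Some l) \<Rightarrow> C k l | _ \<Rightarrow> 0) | _ \<Rightarrow> if i = j then 1 else (0::real))"
  have "frame n x (\<lambda>i. \<Sum>j\<in>UNIV. C i j *\<^sub>R e j) = (\<lambda>i. \<Sum>j\<in>UNIV. B i j *\<^sub>R frame n x e j)"
    by (rule ext) (auto simp: frame_def B_def sum_option split: option.split)
  then have "vdet (frame n x (\<lambda>i. \<Sum>j\<in>UNIV. C i j *\<^sub>R e j)) = det (\<chi> i j. B i j) * vdet (frame n x e)"
    by (simp only: vdet_expand)
  also have "det (\<chi> i j. B i j) = det (\<chi> i j. C i j)"
    by (subst det_reindex[where f = "\<lambda>i. Some (Some i)"])
       (auto simp: inj_def B_def image_iff split: option.splits)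
  finally show ?thesis .
qed

text \<open>The Gram matrix is \<open>M J M^T\<close> with \<open>J\<close> the diagonal matrix of
  the Lorentz form; the sign is \<open>det J = -1\<close>, due to the single time coordinate
  \<open>None\<close>.\<close>

lemma gram_vdet: "det (\<chi> i j. lorentz (f i) (f j)) = - (vdet f)\<^sup>2"
proof -
  let ?M = "\<chi> i. coords (f i)"
  let ?J = "(\<chi> i j. if i = j then (if i = None then -1 else 1) else 0) :: real^('a option option)^('a option option)"
  have J: "(?J ** transpose ?M) $ i $ j = (if i = None then -1 else 1) * coords (f j) $ i" for i j
  proof -
    have "(?J ** transpose ?M) $ i $ j =
        (\<Sum>k\<in>UNIV. if k = i then (if i = None then -1 else 1) * coords (f j) $ k else 0)"
      unfolding matrix_matrix_mult_def transpose_def vec_lambda_beta by (rule sum.cong) auto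
    then show ?thesis by simp
  qed
  have "(\<chi> i j. lorentz (f i) (f j)) = ?M ** (?J ** transpose ?M)"
    unfolding matrix_matrix_mult_def[of ?M] vec_eq_iff vec_lambda_beta J lorentz_coords
    by (auto simp: mult.left_commute intro: sum.cong)
  moreover have "det ?J = -1"
    by (subst det_diagonal) (auto simp: prod_option)
  ultimately show ?thesis by (simp add: det_mul vdet_def power2_eq_square)
qed

lemma gram_vdet_frame:
  fixes w :: "'m::finite \<Rightarrow> 'm minkowski"
  assumes "lorentz n n = 1" "lorentz x x = -1" "lorentz n x = 0"
    and "\<And>i. lorentz n (w i) = 0" "\<And>i. lorentz x (w i) = 0"
  shows "det (\<chi> i j. lorentz (w i) (w j)) = (vdet (frame n x w))\<^sup>2"
proof -
  let ?G = "\<chi> i j. lorentz (frame n x w i) (frame n x w j)"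
  \<comment> \<open>The full Gram matrix is block diagonal with entries 1 for \<open>n\<close> and
    -1 for \<open>x\<close>. Negating the row of \<open>x\<close> turns this block into the
    identity, as \<open>det_reindex\<close> requires, and cancels the sign in
    \<open>gram_vdet\<close>.\<close>
  let ?H = "\<chi> i. if i = Some None then (-1) *s ?G $ i else ?G $ i"
  have o: "lorentz x n = 0" "\<And>i. lorentz (w i) n = 0" "\<And>i. lorentz (w i) x = 0"
    using assms by (simp_all add: lorentz_commute)
  have "det ?H = (-1) * det (\<chi> i. if i = Some None then ?G $ i else ?G $ i)"
    by (rule det_row_mul)
  also have "\<dots> = - det ?G" by simp
  also have "\<dots> = (vdet (frame n x w))\<^sup>2" by (simp add: gram_vdet)
  finally have "(vdet (frame n x w))\<^sup>2 = det ?H" ..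
  also have "\<dots> = det (\<chi> i j. lorentz (w i) (w j))"
    using assms o by (subst det_reindex[where f = "\<lambda>i. Some (Some i)"])
       (auto simp: inj_def frame_def image_iff split: option.splits)
  finally show ?thesis ..
qed

text \<open>The conclusion is nonvanishing. A zero determinant would give the Gram matrix of the
  \<open>w i\<close> a kernel vector. The corresponding combination is orthogonal to all
  \<open>w i\<close>, hence to itself, and it vanishes because the form is definite on the
  complement of \<open>x\<close>.\<close>

lemma vdet_eq_0_tangent:
  fixes w :: "'m::finite \<Rightarrow> 'm minkowski"
  assumes "\<And>c. (\<Sum>i\<in>UNIV. c i *\<^sub>R w i) = 0 \<Longrightarrow> c = (\<lambda>_. 0)"
    and "lorentz n n = 1" "lorentz x x = -1" "lorentz n x = 0"
    and "\<And>i. lorentz n (w i) = 0" "\<And>i. lorentz x (w i) = 0"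
  shows "vdet (frame n x w) \<noteq> 0"
proof
  assume "vdet (frame n x w) = 0"
  then have "det (\<chi> i j. lorentz (w i) (w j)) = 0"
    using gram_vdet_frame[OF assms(2-6)] by simp
  then have "rank (\<chi> i j. lorentz (w i) (w j)) \<noteq> CARD('m)"
    unfolding det_eq_0_rank by simp
  then obtain c :: "real^'m" where c: "c \<noteq> 0" "(\<chi> i j. lorentz (w i) (w j)) *v c = 0"
    unfolding matrix_nonfull_linear_equations_eq[symmetric] by blast
  define v where "v = (\<Sum>j\<in>UNIV. (c $ j) *\<^sub>R w j)"
  have "lorentz (w i) v = 0" for i
    using c(2) by (simp add: vec_eq_iff matrix_vector_mult_def v_def lorentz.sum_right lorentz.scaleR_right mult.commute)
  then have "lorentz v v = 0"
    by (subst v_def) (simp add: lorentz.sum_left lorentz.scaleR_left)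
  moreover have "lorentz x v = 0"
    by (simp add: v_def lorentz.sum_right lorentz.scaleR_right assms)
  ultimately have "v = 0" using lorentz_tangent_pos(2)[OF assms(3)] by blast
  then have "(\<lambda>i. c $ i) = (\<lambda>_. 0)" using assms(1)[of "\<lambda>i. c $ i"] v_def by simp
  then have "c = 0" by (simp add: vec_eq_iff fun_eq_iff)
  then show False using c(1) by simp
qed

text \<open>Product rule for a multilinear map: each monomial of the Leibniz formula is
  differentiated, and the terms in which row \<open>k\<close> is differentiated recombine to one
  determinant.\<close>

lemma has_derivative_vdet:
  assumes "\<And>i. (f i has_derivative f' i) (at x within S)"
  shows "((\<lambda>x. vdet (\<lambda>i. f i x)) has_derivative
     (\<lambda>h. \<Sum>k\<in>UNIV. vdet ((\<lambda>j. f j x)(k := f' k h)))) (at x within S)"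
proof -
  have c: "((\<lambda>x. coords (f i x) $ j) has_derivative (\<lambda>h. coords (f' i h) $ j)) (at x within S)" for i j
    by (intro bounded_linear.has_derivative[OF bounded_linear_vec_nth]
        bounded_linear.has_derivative[OF bounded_linear_coords] assms)
  let ?P = "{p. p permutes (UNIV :: 'a option option set)}"
  have "((\<lambda>x. \<Sum>p\<in>?P. of_int (sign p) * (\<Prod>i\<in>UNIV. coords (f i x) $ p i)) has_derivative
      (\<lambda>h. \<Sum>p\<in>?P. of_int (sign p) *
         (\<Sum>k\<in>UNIV. coords (f' k h) $ p k * (\<Prod>i\<in>UNIV - {k}. coords (f i x) $ p i)))) (at x within S)"
    by (intro has_derivative_sum has_derivative_mult_right has_derivative_prod c)
  also have "(\<lambda>h. \<Sum>p\<in>?P. of_int (sign p) *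
         (\<Sum>k\<in>UNIV. coords (f' k h) $ p k * (\<Prod>i\<in>UNIV - {k}. coords (f i x) $ p i)))
     = (\<lambda>h. \<Sum>k\<in>UNIV. vdet ((\<lambda>j. f j x)(k := f' k h)))"
  proof
    fix h
    have "vdet ((\<lambda>j. f j x)(k := f' k h)) = (\<Sum>p\<in>?P. of_int (sign p) *
         (coords (f' k h) $ p k * (\<Prod>i\<in>UNIV - {k}. coords (f i x) $ p i)))" for k
      unfolding vdet_def det_def
      by (intro sum.cong refl arg_cong2[of _ _ _ _ "(*)"])
         (subst prod.remove[of _ k], auto intro!: prod.cong)
    then show "(\<Sum>p\<in>?P. of_int (sign p) *
         (\<Sum>k\<in>UNIV. coords (f' k h) $ p k * (\<Prod>i\<in>UNIV - {k}. coords (f i x) $ p i)))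
       = (\<Sum>k\<in>UNIV. vdet ((\<lambda>j. f j x)(k := f' k h)))"
      by (simp add: sum_distrib_left) (subst sum.swap, simp)
  qed
  finally show ?thesis by (simp add: vdet_def det_def)
qed

lemma continuous_on_vdet:
  assumes "\<And>i. continuous_on S (f i)"
  shows "continuous_on S (\<lambda>x. vdet (\<lambda>i. f i x))"
proof -
  have "continuous_on S (\<lambda>x. coords (f i x) $ j)" for i j
    by (intro continuous_on_component bounded_linear.continuous_on[OF bounded_linear_coords] assms)
  then show ?thesis unfolding vdet_def det_def
    by (intro continuous_on_sum continuous_on_mult continuous_on_const continuous_on_prod) simp
qed

subsection \<open>Functions of class \<open>C\<^sup>k\<close>\<close>

lemma Ck_on_subset: "Ck_on k S f \<Longrightarrow> T \<subseteq> S \<Longrightarrow> Ck_on k T f"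
  by (induction k arbitrary: f) (auto intro: continuous_on_subset)

lemma Ck_on_continuous: "Ck_on k S f \<Longrightarrow> continuous_on S f"
  by (cases k) (auto intro!: continuous_at_imp_continuous_on differentiable_imp_continuous_within)

lemma Ck_on_Suc_imp: "Ck_on (Suc k) S f \<Longrightarrow> Ck_on k S f"
proof (induction k arbitrary: f)
  case 0
  then show ?case using Ck_on_continuous[of "Suc 0" S f] by simp
next
  case (Suc k)
  then show ?case by (metis Ck_on.simps(2))
qed

lemma Ck_on_deriv: "Ck_on (Suc k) S f \<Longrightarrow> Ck_on k S (\<lambda>x. frechet_derivative f (at x) v)"
  by simp

lemma Ck_on_has_derivative:
  "Ck_on (Suc k) S f \<Longrightarrow> x \<in> S \<Longrightarrow> (f has_derivative frechet_derivative f (at x)) (at x)"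
  using frechet_derivative_works by auto

lemma frechet_derivative_open_cong:
  assumes "open S" "x \<in> S" "\<And>y. y \<in> S \<Longrightarrow> f y = g y"
  shows "frechet_derivative f (at x) = frechet_derivative g (at x)"
    and "f differentiable (at x) \<longleftrightarrow> g differentiable (at x)"
proof -
  have "(f has_derivative D) (at x) \<longleftrightarrow> (g has_derivative D) (at x)" for D
    using has_derivative_transform_within_open[OF _ assms(1,2), of f D UNIV g]
      has_derivative_transform_within_open[OF _ assms(1,2), of g D UNIV f] assms(3) by metis
  then show "frechet_derivative f (at x) = frechet_derivative g (at x)"
    and "f differentiable (at x) \<longleftrightarrow> g differentiable (at x)"
    by (auto simp: frechet_derivative_def differentiable_def)
qed

lemma Ck_on_cong:
  assumes "open S" "\<And>x. x \<in> S \<Longrightarrow> f x = g x" "Ck_on k S f"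
  shows "Ck_on k S g"
  using assms(2,3)
proof (induction k arbitrary: f g)
  case 0
  then show ?case using continuous_on_cong[of S S f g] by simp
next
  case (Suc k)
  note eq = frechet_derivative_open_cong[OF assms(1) _ Suc.prems(1)]
  show ?case
    using Suc.prems(2) eq Suc.IH[of "\<lambda>x. frechet_derivative f (at x) _" "\<lambda>x. frechet_derivative g (at x) _"]
    by simp
qed

text \<open>Lets the inductions below work with explicit derivative formulas instead of
  \<open>frechet_derivative\<close>.\<close>

lemma Ck_on_has_derivativeI:
  assumes "open S" "\<And>x. x \<in> S \<Longrightarrow> (f has_derivative f' x) (at x)"
    and "\<And>v. Ck_on k S (\<lambda>x. f' x v)"
  shows "Ck_on (Suc k) S f"
proof -
  have "frechet_derivative f (at x) = f' x" if "x \<in> S" for x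
    using assms(2)[OF that] frechet_derivative_at by metis
  then show ?thesis
    using Ck_on_cong[OF assms(1) _ assms(3)] assms(2) by (auto intro!: differentiableI[OF assms(2)])
qed

lemma Ck_on_const: "Ck_on k S (\<lambda>_. c)"
proof (induction k arbitrary: c)
  case (Suc k)
  then show ?case by simp
qed simp

lemma Ck_on_add:
  assumes "open S" "Ck_on k S f" "Ck_on k S g"
  shows "Ck_on k S (\<lambda>x. f x + g x)"
  using assms(2,3)
proof (induction k arbitrary: f g)
  case 0
  then show ?case by (simp add: continuous_on_add)
next
  case (Suc k)
  show ?case
    by (rule Ck_on_has_derivativeI[OF assms(1) has_derivative_add
          [OF Ck_on_has_derivative[OF Suc.prems(1)] Ck_on_has_derivative[OF Suc.prems(2)]]])
       (use Suc in auto)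
qed

lemma Ck_on_bilinear:
  assumes "bounded_bilinear b" "open S" "Ck_on k S f" "Ck_on k S g"
  shows "Ck_on k S (\<lambda>x. b (f x) (g x) :: 'c::real_normed_vector)"
  using assms(3,4)
proof (induction k arbitrary: f g)
  case 0
  then show ?case using bounded_bilinear.continuous_on[OF assms(1)] by simp
next
  case (Suc k)
  note L = Ck_on_Suc_imp[OF Suc.prems(1)] Ck_on_Suc_imp[OF Suc.prems(2)]
  show ?case
  proof (rule Ck_on_has_derivativeI[OF assms(2) bounded_bilinear.FDERIV[OF assms(1)
            Ck_on_has_derivative[OF Suc.prems(1)] Ck_on_has_derivative[OF Suc.prems(2)]]])
    show "Ck_on k S (\<lambda>x. b (f x) (frechet_derivative g (at x) v) + b (frechet_derivative f (at x) v) (g x))" for v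
      by (intro Ck_on_add assms(2) Suc.IH L Ck_on_deriv Suc.prems)
  qed
qed

lemma Ck_on_sum:
  assumes "open S" "\<And>i. i \<in> I \<Longrightarrow> Ck_on k S (f i)"
  shows "Ck_on k S (\<lambda>x. \<Sum>i\<in>I. f i x)"
  using assms(2) by (induction I rule: infinite_finite_induct) (auto intro: Ck_on_const Ck_on_add assms(1))

lemma Ck_on_bounded_linear:
  assumes "bounded_linear h" "open S" "Ck_on k S f"
  shows "Ck_on k S (\<lambda>x. h (f x))"
  using assms(3)
proof (induction k arbitrary: f)
  case 0
  then show ?case using bounded_linear.continuous_on[OF assms(1)] by simp
next
  case (Suc k)
  show ?case
    by (rule Ck_on_has_derivativeI[OF assms(2) bounded_linear.has_derivative[OF assms(1)
          Ck_on_has_derivative[OF Suc.prems]]]) (use Suc in auto)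
qed

lemma Ck_on_vdet:
  assumes "open S" "\<And>i. Ck_on k S (f i)"
  shows "Ck_on k S (\<lambda>x. vdet (\<lambda>i. f i x))"
  using assms(2)
proof (induction k arbitrary: f)
  case 0
  then show ?case using continuous_on_vdet[of S f] by simp
next
  case (Suc k)
  show ?case
  proof (rule Ck_on_has_derivativeI[OF assms(1) has_derivative_vdet[OF Ck_on_has_derivative[OF Suc.prems]]])
    fix v
    have "Ck_on k S (\<lambda>x. vdet (\<lambda>j. (if j = i then \<lambda>x. frechet_derivative (f i) (at x) v else f j) x))" for i
      using Suc Ck_on_Suc_imp[OF Suc.prems] by (intro Suc.IH) auto
    moreover have "(\<lambda>j. (if j = i then \<lambda>x. frechet_derivative (f i) (at x) v else f j) x)
        = (\<lambda>j. f j x)(i := frechet_derivative (f i) (at x) v)" for i x by auto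
    ultimately show "Ck_on k S (\<lambda>x. \<Sum>i\<in>UNIV. vdet ((\<lambda>j. f j x)(i := frechet_derivative (f i) (at x) v)))"
      using assms(1) by (intro Ck_on_sum) auto
  qed
qed

text \<open>A bootstrap: \<open>c\<close> is plus or minus \<open>1 / sqrt q\<close>, and its
  derivative \<open>- (1/2) q' c^3\<close> contains only \<open>c\<close> and a derivative of
  \<open>q\<close>, so each order of regularity of \<open>q\<close> passes on to \<open>c\<close>.
  The intended \<open>c\<close> is the reciprocal of the signed area density, which is at first
  known to be continuous only.\<close>

lemma Ck_on_inverse_sqrt:
  fixes c q :: "'a::real_normed_vector \<Rightarrow> real"
  assumes "open S" "continuous_on S c" "\<And>x. x \<in> S \<Longrightarrow> (c x)\<^sup>2 * q x = 1" "Ck_on k S q"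
  shows "Ck_on k S c"
  using assms(4)
proof (induction k)
  case 0
  then show ?case using assms(2) by simp
next
  case (Suc k)
  have der: "(c has_derivative (\<lambda>v. - (1/2) * (frechet_derivative q (at x) v * (c x * (c x * c x))))) (at x)"
    if x: "x \<in> S" for x
  proof -
    have qp: "q y > 0" "\<bar>c y\<bar> = 1 / sqrt (q y)" if "y \<in> S" for y
    proof -
      have 1: "(c y)\<^sup>2 * q y = 1" using assms(3)[OF that] .
      then show q: "q y > 0" using zero_le_power2[of "c y"] by (smt (verit) mult_nonneg_nonpos)
      have "(\<bar>c y\<bar> * sqrt (q y))\<^sup>2 = 1\<^sup>2" using 1 q by (simp add: power_mult_distrib)
      then have "\<bar>c y\<bar> * sqrt (q y) = 1" by (rule power2_eq_imp_eq) (use q in auto)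
      then show "\<bar>c y\<bar> = 1 / sqrt (q y)" using q by (simp add: field_simps)
    qed
    have cx: "c x \<noteq> 0" using qp[OF x] by auto
    \<comment> \<open>Continuity of \<open>c\<close> makes this sign constant near \<open>x\<close>,
      so that \<open>c\<close> equals \<open>s / sqrt q\<close> there and can be
      differentiated.\<close>
    define s where "s = sgn (c x)"
    have "eventually (\<lambda>y. s * c y > 0) (at x)"
    proof -
      have "isCont c x" using assms(1,2) x by (simp add: continuous_on_eq_continuous_at)
      then have "((\<lambda>y. s * c y) \<longlongrightarrow> s * c x) (at x)" by (intro tendsto_intros) (simp add: isCont_def)
      moreover have "s * c x > 0" using cx by (simp add: s_def sgn_if)
      ultimately show ?thesis by (rule order_tendstoD)
    qed
    moreover have "eventually (\<lambda>y. y \<in> S) (at x)"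
      using assms(1) x by (simp add: eventually_at_in_open')
    ultimately have ev: "eventually (\<lambda>y. s * inverse (sqrt (q y)) = c y) (at x)"
    proof eventually_elim
      case (elim y)
      then have "c y = s * \<bar>c y\<bar>"
        using cx by (auto simp: s_def sgn_if zero_less_mult_iff split: if_splits)
      then show ?case using qp[OF elim(2)] by (simp add: divide_inverse)
    qed
    define r where "r = inverse (sqrt (q x))"
    have "((\<lambda>z. s * inverse (sqrt z)) has_real_derivative s * - (r * (r / 2) * r)) (at (q x))"
      using qp(1)[OF x] by (auto intro!: derivative_eq_intros simp: r_def field_simps)
    then have "((\<lambda>y. s * inverse (sqrt (q y))) has_derivative
       (\<lambda>v. s * - (r * (r / 2) * r) * frechet_derivative q (at x) v)) (at x)"
      unfolding has_field_derivative_def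
      by (rule has_derivative_compose[OF Ck_on_has_derivative[OF Suc.prems x]])
    moreover have sr: "s * r = c x"
    proof -
      have "c x = s * \<bar>c x\<bar>" by (simp add: s_def sgn_mult_abs)
      then show ?thesis using qp[OF x] by (simp add: divide_inverse r_def)
    qed
    moreover have "s * (r * (r / 2) * r) = c x * (c x * c x) / 2"
    proof -
      have "s * s = 1" using cx by (simp add: s_def sgn_if)
      then have "c x * (c x * c x) = s * (r * r * r)"
        unfolding sr[symmetric] by (metis mult.assoc mult.left_commute mult_1)
      then show ?thesis by simp
    qed
    ultimately have "((\<lambda>y. s * inverse (sqrt (q y))) has_derivative
       (\<lambda>v. - (1/2) * (frechet_derivative q (at x) v * (c x * (c x * c x))))) (at x)"
      by (elim has_derivative_eq_rhs) (auto simp: fun_eq_iff algebra_simps)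
    from has_derivative_transform_eventually[OF this ev] show ?thesis
      using sr by (simp add: r_def)
  qed
  have "Ck_on k S c" using Suc Ck_on_Suc_imp by blast
  then have "Ck_on k S (\<lambda>x. - (1/2) * (frechet_derivative q (at x) v * (c x * (c x * c x))))" for v
    by (intro Ck_on_bilinear[OF bounded_bilinear_mult assms(1)] Ck_on_const Ck_on_deriv Suc.prems)
  with der show ?case by (rule Ck_on_has_derivativeI[OF assms(1)])
qed

section \<open>Symmetry of second derivatives\<close>

lemma has_real_derivative_line:
  fixes f :: "'a::real_normed_vector \<Rightarrow> real"
  assumes "(f has_derivative f') (at (p + s *\<^sub>R v))"
  shows "((\<lambda>s. f (p + s *\<^sub>R v)) has_real_derivative f' v) (at s)"
proof -
  have l: "linear f'" using assms by (rule has_derivative_linear)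
  have "((\<lambda>s. p + s *\<^sub>R v) has_derivative (\<lambda>h. h *\<^sub>R v)) (at s)"
    by (auto intro!: derivative_eq_intros)
  from has_derivative_compose[OF this, of f f'] assms
  have "((\<lambda>s. f (p + s *\<^sub>R v)) has_derivative (\<lambda>h. f' (h *\<^sub>R v))) (at s)" by simp
  then show ?thesis
    unfolding has_field_derivative_def
    by (rule has_derivative_eq_rhs) (auto simp: linear_scale[OF l] mult.commute)
qed

text \<open>The second difference of \<open>f\<close> over the parallelogram spanned by
  \<open>t v\<close> and \<open>t w\<close> does not depend on the order of the two directions. If
  the mixed derivatives at \<open>x\<close> differed, continuity would keep them apart on a small
  ball, although both orders express the same second difference.\<close>

lemma symmetric_second_derivative_real:
  fixes f :: "'a::real_normed_vector \<Rightarrow> real"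
  assumes S: "open S" "x \<in> S" and C2: "Ck_on 2 S f"
  shows "frechet_derivative (\<lambda>y. frechet_derivative f (at y) v) (at x) w
       = frechet_derivative (\<lambda>y. frechet_derivative f (at y) w) (at x) v"
proof (rule ccontr)
  let ?F = "\<lambda>v y. frechet_derivative f (at y) v"
  let ?D = "\<lambda>v w y. frechet_derivative (?F v) (at y) w"
  assume "\<not> ?thesis"
  then have e: "dist (?D v w x) (?D w v x) > 0" (is "?e > 0") by simp
  have C: "Ck_on (Suc (Suc 0)) S f" using C2 by (simp add: numeral_2_eq_2)
  have d1: "(f has_derivative (\<lambda>v. ?F v y)) (at y)" if "y \<in> S" for y
    using Ck_on_has_derivative[OF C that] by simp
  have d2: "(?F v has_derivative (\<lambda>w. ?D v w y)) (at y)" if "y \<in> S" for y v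
    using Ck_on_has_derivative[OF Ck_on_deriv[OF C] that] by simp
  have cont: "continuous_on S (?D v w)" for v w using C by simp
  \<comment> \<open>Two applications of the mean value theorem: along \<open>v\<close> to the
    difference \<open>\<phi>\<close>, then along \<open>w\<close> to the derivative of
    \<open>f\<close> in the direction \<open>v\<close>.\<close>
  have mvt: "\<exists>p\<in>ball x r. f (x + t *\<^sub>R v + t *\<^sub>R w) - f (x + t *\<^sub>R v) - f (x + t *\<^sub>R w) + f x = t * t * ?D v w p"
    if t: "t > 0" "t * (norm v + norm w) < r" "ball x r \<subseteq> S" for t v w r
  proof -
    have inb: "x + a *\<^sub>R v + b *\<^sub>R w \<in> ball x r" if "0 \<le> a" "a \<le> t" "0 \<le> b" "b \<le> t" for a b
    proof -
      have "norm (a *\<^sub>R v + b *\<^sub>R w) \<le> a * norm v + b * norm w"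
        using that by (intro norm_triangle_le) auto
      also have "\<dots> \<le> t * norm v + t * norm w" using that by (intro add_mono mult_right_mono) auto
      finally have "norm (a *\<^sub>R v + b *\<^sub>R w) < r" using t by (simp add: distrib_left)
      moreover have "dist x (x + a *\<^sub>R v + b *\<^sub>R w) = norm (a *\<^sub>R v + b *\<^sub>R w)"
        unfolding dist_commute[of x] add.assoc by (simp add: dist_norm)
      ultimately show ?thesis by simp
    qed
    define \<phi> where "\<phi> s = f (x + s *\<^sub>R v + t *\<^sub>R w) - f (x + s *\<^sub>R v)" for s
    have "(\<phi> has_real_derivative ?F v (x + s *\<^sub>R v + t *\<^sub>R w) - ?F v (x + s *\<^sub>R v)) (at s)"
      if "0 \<le> s" "s \<le> t" for s
    proof -
      have a: "x + s *\<^sub>R v + t *\<^sub>R w \<in> S" "x + s *\<^sub>R v \<in> S"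
        using inb[of s t] inb[of s 0] that t by auto
      have sw: "x + s *\<^sub>R v + t *\<^sub>R w = (x + t *\<^sub>R w) + s *\<^sub>R v" for s by simp
      have "((\<lambda>s. f (x + s *\<^sub>R v + t *\<^sub>R w)) has_real_derivative ?F v (x + s *\<^sub>R v + t *\<^sub>R w)) (at s)"
        using has_real_derivative_line[of f _ "x + t *\<^sub>R w" s v] d1[OF a(1)] unfolding sw by blast
      moreover have "((\<lambda>s. f (x + s *\<^sub>R v)) has_real_derivative ?F v (x + s *\<^sub>R v)) (at s)"
        using has_real_derivative_line[OF d1[OF a(2)]] .
      ultimately show ?thesis unfolding \<phi>_def by (rule DERIV_diff)
    qed
    then obtain \<xi> where xi: "0 < \<xi>" "\<xi> < t"
      "\<phi> t - \<phi> 0 = t * (?F v (x + \<xi> *\<^sub>R v + t *\<^sub>R w) - ?F v (x + \<xi> *\<^sub>R v))"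
      using MVT2[OF t(1), of \<phi> "\<lambda>s. ?F v (x + s *\<^sub>R v + t *\<^sub>R w) - ?F v (x + s *\<^sub>R v)"] by auto
    have "((\<lambda>s. ?F v (x + \<xi> *\<^sub>R v + s *\<^sub>R w)) has_real_derivative ?D v w (x + \<xi> *\<^sub>R v + s *\<^sub>R w)) (at s)"
      if "0 \<le> s" "s \<le> t" for s
    proof -
      have a: "x + \<xi> *\<^sub>R v + s *\<^sub>R w \<in> S"
        using inb[of \<xi> s] that t xi by auto
      show ?thesis using has_real_derivative_line[OF d2[OF a]] .
    qed
    then obtain \<eta> where eta: "0 < \<eta>" "\<eta> < t"
      "?F v (x + \<xi> *\<^sub>R v + t *\<^sub>R w) - ?F v (x + \<xi> *\<^sub>R v + 0 *\<^sub>R w) = t * ?D v w (x + \<xi> *\<^sub>R v + \<eta> *\<^sub>R w)"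
      using MVT2[OF t(1), of "\<lambda>s. ?F v (x + \<xi> *\<^sub>R v + s *\<^sub>R w)" "\<lambda>s. ?D v w (x + \<xi> *\<^sub>R v + s *\<^sub>R w)"] by auto
    have "x + \<xi> *\<^sub>R v + \<eta> *\<^sub>R w \<in> ball x r" using inb[of \<xi> \<eta>] xi eta by auto
    moreover have "f (x + t *\<^sub>R v + t *\<^sub>R w) - f (x + t *\<^sub>R v) - f (x + t *\<^sub>R w) + f x
        = t * t * ?D v w (x + \<xi> *\<^sub>R v + \<eta> *\<^sub>R w)"
      using xi(3) eta(3) by (simp add: \<phi>_def)
    ultimately show ?thesis by blast
  qed
  have "isCont (?D v w) x" "isCont (?D w v) x"
    using cont S by (auto simp: continuous_on_eq_continuous_at)
  then obtain r1 r2 where r: "r1 > 0" "\<And>y. y \<in> ball x r1 \<Longrightarrow> dist (?D v w y) (?D v w x) < ?e / 2"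
    "r2 > 0" "\<And>y. y \<in> ball x r2 \<Longrightarrow> dist (?D w v y) (?D w v x) < ?e / 2"
    using e unfolding continuous_at_eps_delta by (metis half_gt_zero mem_ball dist_commute)
  obtain r3 where r3: "r3 > 0" "ball x r3 \<subseteq> S" using S open_contains_ball by blast
  define r where "r = min r1 (min r2 r3)"
  have rp: "r > 0" "ball x r \<subseteq> S" using r r3 by (auto simp: r_def)
  \<comment> \<open>The summand 1 keeps the denominator positive when both directions
    vanish.\<close>
  define t where "t = r / (2 * (norm v + norm w + 1))"
  have n: "norm v + norm w + 1 > 0" by (smt (verit) norm_ge_zero)
  have t: "t > 0" using rp n by (simp add: t_def)
  have "t * (norm v + norm w + 1) = r / 2" using n by (simp add: t_def field_simps)
  then have tr: "t * (norm v + norm w) < r" using t rp by (simp add: algebra_simps)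
  obtain p where p: "p \<in> ball x r" "f (x + t *\<^sub>R v + t *\<^sub>R w) - f (x + t *\<^sub>R v) - f (x + t *\<^sub>R w) + f x = t * t * ?D v w p"
    using mvt[OF t tr rp(2)] by blast
  obtain q where q: "q \<in> ball x r" "f (x + t *\<^sub>R w + t *\<^sub>R v) - f (x + t *\<^sub>R w) - f (x + t *\<^sub>R v) + f x = t * t * ?D w v q"
    using mvt[OF t _ rp(2), of w v] tr by (auto simp: add.commute)
  have sw: "x + t *\<^sub>R w + t *\<^sub>R v = x + t *\<^sub>R v + t *\<^sub>R w" by simp
  have "t * t * ?D v w p = t * t * ?D w v q" using p(2) q(2)[unfolded sw] by linarith
  then have pq: "?D v w p = ?D w v q" using t by simp
  have "dist (?D v w p) (?D v w x) < ?e / 2" "dist (?D w v q) (?D w v x) < ?e / 2"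
    using p(1) q(1) r by (auto simp: r_def)
  then show False using pq dist_triangle_half_r[of "?D v w p" "?D v w x" ?e "?D w v x"] by auto
qed

lemma symmetric_second_derivative:
  fixes f :: "'a::real_normed_vector \<Rightarrow> 'b::euclidean_space"
  assumes S: "open S" "x \<in> S" and C2: "Ck_on 2 S f"
  shows "frechet_derivative (\<lambda>y. frechet_derivative f (at y) v) (at x) w
       = frechet_derivative (\<lambda>y. frechet_derivative f (at y) w) (at x) v"
proof (rule euclidean_eqI)
  fix b :: 'b
  have C: "Ck_on (Suc (Suc 0)) S f" using C2 by (simp add: numeral_2_eq_2)
  have b: "bounded_linear (\<lambda>y. y \<bullet> b)" by (rule bounded_linear_inner_left)
  have 1: "frechet_derivative (\<lambda>y. f y \<bullet> b) (at y) v = frechet_derivative f (at y) v \<bullet> b" if "y \<in> S" for y v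
    using frechet_derivative_at[OF bounded_linear.has_derivative[OF b Ck_on_has_derivative[OF C that]]] by metis
  have 2: "frechet_derivative (\<lambda>y. frechet_derivative f (at y) v \<bullet> b) (at x) w
      = frechet_derivative (\<lambda>y. frechet_derivative f (at y) v) (at x) w \<bullet> b" for v w
    using frechet_derivative_at[OF bounded_linear.has_derivative[OF b Ck_on_has_derivative[OF Ck_on_deriv[OF C] S(2)]]] by metis
  have 3: "frechet_derivative (\<lambda>y. frechet_derivative (\<lambda>y. f y \<bullet> b) (at y) v) (at x) w
      = frechet_derivative (\<lambda>y. frechet_derivative f (at y) v) (at x) w \<bullet> b" for v w
    unfolding 2[symmetric]
    by (rule fun_cong[OF frechet_derivative_open_cong(1)[OF S]]) (rule 1)
  show "frechet_derivative (\<lambda>y. frechet_derivative f (at y) v) (at x) w \<bullet> b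
       = frechet_derivative (\<lambda>y. frechet_derivative f (at y) w) (at x) v \<bullet> b"
    unfolding 3[symmetric]
    by (rule symmetric_second_derivative_real[OF S Ck_on_bounded_linear[OF b S(1) C2]])
qed

subsection \<open>Integrals of derivatives of compactly supported functions\<close>

lemma integrable_compact_support:
  fixes f :: "'a::euclidean_space \<Rightarrow> real"
  assumes cont: "continuous_on UNIV f" and K: "compact K" and supp: "\<And>x. x \<notin> K \<Longrightarrow> f x = 0"
  shows "integrable lborel f"
proof -
  have "compact (f ` K)" using K cont continuous_on_subset compact_continuous_image by blast
  then obtain C where C: "\<forall>y\<in>f ` K. norm y \<le> C" using compact_imp_bounded bounded_iff by blast
  show ?thesis
  proof (rule Bochner_Integration.integrable_bound)
    show "integrable lborel (\<lambda>x. C * indicator K x :: real)"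
      using K emeasure_bounded_finite[OF compact_imp_bounded[OF K]]
      by (auto intro!: integrable_mult_right integrable_real_indicator simp: borel_compact)
    show "f \<in> borel_measurable lborel" using borel_measurable_continuous_onI[OF cont] by simp
    show "AE x in lborel. norm (f x) \<le> norm (C * indicator K x :: real)"
      using C supp by (intro AE_I2) (auto simp: indicator_def intro: order.trans[OF _ abs_ge_self])
  qed
qed

text \<open>Lebesgue measure is translation invariant, so every difference quotient of
  \<open>g\<close> in the direction \<open>v\<close> has integral zero. Dominated convergence
  carries this over to the derivative, in any dimension and without iterated integrals.\<close>

lemma integral_derivative_eq_0:
  fixes g :: "'a::euclidean_space \<Rightarrow> real"
  assumes der: "\<And>x. (g has_derivative g' x) (at x)"
    and cont: "continuous_on UNIV (\<lambda>x. g' x v)"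
    and K: "compact K" and supp: "\<And>x. x \<notin> K \<Longrightarrow> g x = 0"
  shows "integrable lborel (\<lambda>x. g' x v)" and "(\<integral>x. g' x v \<partial>lborel) = 0"
proof -
  have g0: "g' x = (\<lambda>_. 0)" if "x \<notin> K" for x
  proof -
    have "(g has_derivative (\<lambda>_. 0)) (at x)"
      by (rule has_derivative_transform_within_open[of "\<lambda>_. 0" _ _ _ "- K"])
         (use that K supp in \<open>auto simp: compact_imp_closed open_Compl\<close>)
    then show ?thesis using der[of x] has_derivative_unique by blast
  qed
  show "integrable lborel (\<lambda>x. g' x v)"
    by (rule integrable_compact_support[OF cont K]) (simp add: g0)
  obtain B where B: "\<And>x. \<bar>g' x v\<bar> \<le> B"
  proof -
    have "compact ((\<lambda>x. g' x v) ` K)" using K cont continuous_on_subset compact_continuous_image by blast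
    then obtain B where B: "\<And>x. x \<in> K \<Longrightarrow> \<bar>g' x v\<bar> \<le> B"
      unfolding compact_eq_bounded_closed bounded_iff by (auto simp: image_iff)
    have "\<bar>g' x v\<bar> \<le> max B 0" for x using B[of x] g0[of x] by (cases "x \<in> K") auto
    then show ?thesis using that by blast
  qed
  have lip: "\<bar>g (x + t *\<^sub>R v) - g x\<bar> \<le> t * B" if t: "t > 0" for x t
  proof -
    have "((\<lambda>s. g (x + s *\<^sub>R v)) has_real_derivative g' (x + s *\<^sub>R v) v) (at s)" for s
      by (rule has_real_derivative_line[OF der])
    then obtain z where "g (x + t *\<^sub>R v) - g (x + 0 *\<^sub>R v) = (t - 0) * g' (x + z *\<^sub>R v) v"
      using MVT2[OF t, of "\<lambda>s. g (x + s *\<^sub>R v)" "\<lambda>s. g' (x + s *\<^sub>R v) v"] by auto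
    then show ?thesis using B[of "x + z *\<^sub>R v"] t by (simp add: abs_mult)
  qed
  have gc: "continuous_on UNIV g"
    using der by (meson has_derivative_continuous continuous_at_imp_continuous_on)
  have gm: "g \<in> borel_measurable borel" using gc by (rule borel_measurable_continuous_onI)
  obtain R where R: "K \<subseteq> ball 0 R" using K compact_imp_bounded bounded_subset_ballD by blast
  have gi: "integrable lborel g" by (rule integrable_compact_support[OF gc K supp])
  define h where "h n = 1 / real (Suc n)" for n
  have h: "h n > 0" "h n \<le> 1" for n by (auto simp: h_def)
  define d where "d n x = (g (x + h n *\<^sub>R v) - g x) / h n" for n x
  have gti: "integrable lborel (\<lambda>x. g (x + c))" "(\<integral>x. g (x + c) \<partial>lborel) = (\<integral>x. g x \<partial>lborel)" for c
  proof -
    have "integrable (distr lborel borel ((+) c)) g" "(\<integral>x. g x \<partial>distr lborel borel ((+) c)) = (\<integral>x. g x \<partial>lborel)"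
      using gi by (simp_all add: lborel_distr_plus)
    then show "integrable lborel (\<lambda>x. g (x + c))" "(\<integral>x. g (x + c) \<partial>lborel) = (\<integral>x. g x \<partial>lborel)"
      using gm by (simp_all add: integrable_distr_eq integral_distr add.commute)
  qed
  have d0: "(\<integral>x. d n x \<partial>lborel) = 0" for n
    unfolding d_def using gti gi by simp
  have "(\<lambda>n. \<integral>x. d n x \<partial>lborel) \<longlonglongrightarrow> (\<integral>x. g' x v \<partial>lborel)"
  proof (rule integral_dominated_convergence)
    \<comment> \<open>The steps \<open>h n\<close> are at most 1, so all quotients vanish outside
      the ball of radius \<open>R + norm v\<close>; the mean value theorem bounds them by
      \<open>B\<close>.\<close>
    let ?w = "\<lambda>x. B * indicator (cball 0 (R + norm v)) x :: real"
    show "(\<lambda>x. g' x v) \<in> borel_measurable lborel"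
      using borel_measurable_continuous_onI[OF cont] by simp
    show "d n \<in> borel_measurable lborel" for n
      unfolding d_def using gti gm by (auto intro!: borel_measurable_divide borel_measurable_diff borel_measurable_integrable)
    show "integrable lborel ?w"
      using emeasure_bounded_finite[OF bounded_cball] by (auto intro!: integrable_mult_right integrable_real_indicator)
    show "AE x in lborel. (\<lambda>n. d n x) \<longlonglongrightarrow> g' x v"
    proof (intro AE_I2)
      fix x
      have "((\<lambda>s. g (x + s *\<^sub>R v)) has_real_derivative g' (x + 0 *\<^sub>R v) v) (at 0)"
        by (rule has_real_derivative_line[OF der])
      then have "((\<lambda>s. (g (x + s *\<^sub>R v) - g x) / s) \<longlongrightarrow> g' x v) (at 0)"
        by (simp add: DERIV_def)
      moreover have "filterlim h (at 0) sequentially"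
        unfolding filterlim_at h_def using LIMSEQ_Suc[OF lim_1_over_n] by auto
      ultimately show "(\<lambda>n. d n x) \<longlonglongrightarrow> g' x v" unfolding d_def by (rule filterlim_compose)
    qed
    show "AE x in lborel. norm (d n x) \<le> ?w x" for n
    proof (intro AE_I2)
      fix x
      have "x \<in> cball 0 (R + norm v)" if "d n x \<noteq> 0"
      proof (rule ccontr)
        assume "x \<notin> cball 0 (R + norm v)"
        then have x: "norm x > R + norm v" by simp
        have "norm x \<le> norm (x + h n *\<^sub>R v) + norm (h n *\<^sub>R v)"
          by (metis add_diff_cancel_right' norm_triangle_ineq4)
        moreover have "norm (h n *\<^sub>R v) \<le> norm v" using h[of n] by (simp add: mult_left_le_one_le)
        ultimately have "norm (x + h n *\<^sub>R v) > R" "norm x > R" using x norm_ge_zero[of v] by linarith+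
        then have "x + h n *\<^sub>R v \<notin> K" "x \<notin> K" using R by auto
        then show False using that supp by (simp add: d_def)
      qed
      moreover have "\<bar>d n x\<bar> \<le> B" using lip[OF h(1), of x n] h[of n] by (simp add: d_def field_simps)
      ultimately show "norm (d n x) \<le> ?w x" by (auto simp: indicator_def)
    qed
  qed
  then show "(\<integral>x. g' x v \<partial>lborel) = 0" using d0 by (simp add: LIMSEQ_const_iff)
qed

text \<open>Outside \<open>K\<close> the function is zero on an open set, so its derivative there is
  zero and glues with \<open>g'\<close> on \<open>U\<close> to a continuous function on the whole
  space.\<close>

lemma integral_derivative_on_eq_0:
  fixes g :: "'a::euclidean_space \<Rightarrow> real"
  assumes U: "open U" and der: "\<And>x. x \<in> U \<Longrightarrow> (g has_derivative g' x) (at x)"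
    and cont: "continuous_on U (\<lambda>x. g' x v)"
    and K: "compact K" "K \<subseteq> U" and supp: "\<And>x. x \<notin> K \<Longrightarrow> g x = 0"
  shows "integrable lborel (\<lambda>x. if x \<in> U then g' x v else 0)"
    and "(\<integral>x. (if x \<in> U then g' x v else 0) \<partial>lborel) = 0"
proof -
  define G where "G x = (if x \<in> U then g' x else (\<lambda>_. 0))" for x
  have z: "(g has_derivative (\<lambda>_. 0)) (at x)" if "x \<notin> K" for x
    by (rule has_derivative_transform_within_open[of "\<lambda>_. 0" _ _ _ "- K"])
       (use that K supp in \<open>auto simp: compact_imp_closed open_Compl\<close>)
  have dG: "(g has_derivative G x) (at x)" for x
    using der z K(2) by (cases "x \<in> U") (auto simp: G_def)
  have zG: "G x = (\<lambda>_. 0)" if "x \<notin> K" for x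
    using has_derivative_unique[OF dG z[OF that]] .
  have "continuous_on (U \<union> - K) (\<lambda>x. G x v)"
  proof (rule continuous_on_open_Un)
    show "continuous_on U (\<lambda>x. G x v)" using cont by (simp add: G_def)
    have "continuous_on (- K) (\<lambda>x. 0 :: real)" by simp
    then show "continuous_on (- K) (\<lambda>x. G x v)" by (rule continuous_on_eq) (simp add: zG)
  qed (use U K in \<open>auto simp: compact_imp_closed open_Compl\<close>)
  moreover have "U \<union> - K = UNIV" using K by auto
  ultimately have "integrable lborel (\<lambda>x. G x v)" "(\<integral>x. G x v \<partial>lborel) = 0"
    using integral_derivative_eq_0[OF dG _ K(1) supp] by simp_all
  moreover have "G x v = (if x \<in> U then g' x v else 0)" for x by (simp add: G_def)
  ultimately show "integrable lborel (\<lambda>x. if x \<in> U then g' x v else 0)"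
    "(\<integral>x. (if x \<in> U then g' x v else 0) \<partial>lborel) = 0" by simp_all
qed

subsection \<open>Change of variables without an order on the index type\<close>

text \<open>
  The change of variables theorem of the library needs a well-ordered index type, so it is
  transported along a bijection with a well-ordered copy of the index type.
\<close>

typedef ('a::finite) idx = "{..<CARD('a)}"
  by (intro exI[of _ 0]) simp

instantiation idx :: (finite) wellorder
begin
definition less_eq_idx :: "'a idx \<Rightarrow> 'a idx \<Rightarrow> bool" where "x \<le> y \<longleftrightarrow> Rep_idx x \<le> Rep_idx y"
definition less_idx :: "'a idx \<Rightarrow> 'a idx \<Rightarrow> bool" where "x < y \<longleftrightarrow> Rep_idx x < Rep_idx y"
instance
proof
  fix x y z :: "'a idx"
  show "x < y \<longleftrightarrow> x \<le> y \<and> \<not> y \<le> x" and "x \<le> x" and "x \<le> y \<or> y \<le> x"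
    and "x \<le> y \<Longrightarrow> y \<le> z \<Longrightarrow> x \<le> z"
    unfolding less_eq_idx_def less_idx_def by linarith+
  assume "x \<le> y" "y \<le> x"
  then show "x = y" unfolding less_eq_idx_def Rep_idx_inject[symmetric] by linarith
next
  fix P :: "'a idx \<Rightarrow> bool" and a
  assume step: "\<And>x. (\<And>y. y < x \<Longrightarrow> P y) \<Longrightarrow> P x"
  show "P a"
  proof (induction "Rep_idx a" arbitrary: a rule: less_induct)
    case less
    show ?case by (rule step) (use less in \<open>simp add: less_idx_def\<close>)
  qed
qed
end

lemma UNIV_idx: "(UNIV :: 'a::finite idx set) = Abs_idx ` {..<CARD('a)}"
  by (metis type_definition.Abs_image type_definition_idx)

instance idx :: (finite) finite
  by standard (simp add: UNIV_idx)

lemma card_idx: "CARD('a::finite idx) = CARD('a)"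
proof -
  have "inj_on (Abs_idx :: nat \<Rightarrow> 'a idx) {..<CARD('a)}"
    by (meson Abs_idx_inject inj_onI)
  then show ?thesis by (simp add: UNIV_idx card_image)
qed

lemma idx_bij: obtains f :: "'a::finite idx \<Rightarrow> 'a" where "bij f"
  using finite_same_card_bij[of "UNIV :: 'a idx set" "UNIV :: 'a set"] card_idx by auto

lemma prod_Basis_vec: "(\<Prod>b\<in>(Basis :: (real^'n) set). z \<bullet> b) = (\<Prod>i\<in>UNIV. z $ i)"
proof -
  have B: "Basis = (\<lambda>i. axis i (1::real)) ` (UNIV :: 'n set)" by (auto simp: Basis_vec_def)
  have i: "inj (\<lambda>i::'n. axis i (1::real))" by (auto simp: inj_def axis_eq_axis)
  show ?thesis unfolding B by (subst prod.reindex[OF i]) (simp add: inner_axis)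
qed

text \<open>Relabelling coordinates maps open boxes to open boxes with the same side lengths, and
  Lebesgue measure is determined by its values on boxes.\<close>

lemma lborel_distr_reindex:
  fixes f :: "'b::finite \<Rightarrow> 'a::finite"
  assumes f: "bij f"
  shows "distr lborel borel (\<lambda>x::real^'a. \<chi> i. x $ f i) = (lborel :: (real^'b) measure)"
proof (rule lborel_eqI[symmetric])
  let ?p = "\<lambda>x::real^'a. \<chi> i. x $ f i" and ?q = "\<lambda>y::real^'b. \<chi> j. y $ inv f j"
  have m: "?p \<in> borel_measurable borel"
    by (intro borel_measurable_continuous_onI continuous_on_vec_lambda continuous_intros)
  fix l u :: "real^'b" assume le: "\<And>b. b \<in> Basis \<Longrightarrow> l \<bullet> b \<le> u \<bullet> b"
  have le': "l $ i \<le> u $ i" for i using le[of "axis i 1"] by (simp add: inner_axis)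
  have sub: "?p -` box l u = box (?q l) (?q u)"
    using f by (auto simp: mem_box_cart bij_is_surj surj_f_inv_f) (metis bij_inv_eq_iff)+
  have "emeasure (distr lborel borel ?p) (box l u) = emeasure lborel (box (?q l) (?q u))"
    using m by (simp add: emeasure_distr sub)
  also have "\<dots> = (\<Prod>b\<in>Basis. (?q u - ?q l) \<bullet> b)"
    by (rule emeasure_lborel_box) (use le' in \<open>auto simp: Basis_vec_def inner_axis\<close>)
  also have "(\<Prod>b\<in>Basis. (?q u - ?q l) \<bullet> b) = (\<Prod>b\<in>Basis. (u - l) \<bullet> b)"
    unfolding prod_Basis_vec
    using prod.reindex_bij_betw[of f UNIV UNIV "\<lambda>i. (?q u - ?q l) $ i"] f by (simp add: bij_is_inj)
  finally show "emeasure (distr lborel borel ?p) (box l u) = (\<Prod>b\<in>Basis. (u - l) \<bullet> b)" .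
qed simp

text \<open>\<open>has_measure_differentiable_image\<close> is an equivalence between finite measure
  of the image and integrability of the Jacobian. One direction gives the equality for finite
  values; the other one shows that both sides are infinite together.\<close>

lemma emeasure_image_wellorder:
  fixes g :: "real^'n::{finite,wellorder} \<Rightarrow> real^'n::_"
  assumes A: "A \<in> sets borel" "g ` A \<in> sets borel"
    and der: "\<And>x. x \<in> A \<Longrightarrow> (g has_derivative g' x) (at x)" and inj: "inj_on g A"
    and h: "h \<in> borel_measurable borel" "\<And>x. x \<in> A \<Longrightarrow> h x = \<bar>det (matrix (g' x))\<bar>"
  shows "emeasure lborel (g ` A) = (\<integral>\<^sup>+x. ennreal (h x) * indicator A x \<partial>lborel)"
proof -
  have AL: "A \<in> sets lebesgue" using A by simp
  have main: "g ` A \<in> lmeasurable \<and> measure lebesgue (g ` A) = m \<longleftrightarrow> (h has_integral m) A" for m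
    using has_measure_differentiable_image[OF AL has_derivative_at_withinI[OF der] inj, of m]
      has_integral_cong[of A h "\<lambda>x. \<bar>det (matrix (g' x))\<bar>" m] h(2) by auto
  have h0: "h x \<ge> 0" if "x \<in> A" for x using h(2)[OF that] by simp
  have ind: "(\<lambda>x. ennreal (indicator A x * h x)) = (\<lambda>x. ennreal (h x) * indicator A x)"
    by (auto simp: indicator_def)
  show ?thesis
  proof (cases "g ` A \<in> lmeasurable")
    case True
    then have "(h has_integral measure lebesgue (g ` A)) A" using main by blast
    from nn_integral_has_integral_lebesgue[OF h0 this]
    have "(\<integral>\<^sup>+x. ennreal (h x) * indicator A x \<partial>lborel) = ennreal (measure lebesgue (g ` A))"
      by (simp add: ind)
    also have "\<dots> = emeasure lebesgue (g ` A)" using True by (simp add: emeasure_eq_measure2)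
    finally show ?thesis using A by simp
  next
    case False
    have "(\<integral>\<^sup>+x. ennreal (h x) * indicator A x \<partial>lborel) = \<infinity>"
    proof (rule ccontr)
      assume "\<not> ?thesis"
      then have fin: "(\<integral>\<^sup>+x. ennreal (indicator A x * h x) \<partial>lborel) < \<infinity>"
        by (simp add: ind less_top)
      define r where "r = enn2real (\<integral>\<^sup>+x. ennreal (indicator A x * h x) \<partial>lborel)"
      have "integral\<^sup>N lebesgue (\<lambda>x. ennreal (indicator A x * h x)) = ennreal r"
        using fin by (simp add: r_def nn_integral_completion)
      moreover have "(\<lambda>x. indicator A x * h x) \<in> borel_measurable lebesgue"
        using A h(1) by (intro borel_measurable_times measurable_completion) auto
      ultimately have "((\<lambda>x. indicator A x * h x) has_integral r) UNIV"
        using h0 by (subst has_integral_iff_nn_integral_lebesgue) (auto simp: indicator_def r_def)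
      moreover have "(\<lambda>x. indicator A x * h x) = (\<lambda>x. if x \<in> A then h x else 0)"
        by (auto simp: indicator_def)
      ultimately have "(h has_integral r) A" by (simp add: has_integral_restrict_UNIV)
      then show False using main False by blast
    qed
    moreover have "\<not> emeasure lborel (g ` A) < \<infinity>"
      using False A by (auto simp: fmeasurable_def)
    then have "emeasure lborel (g ` A) = \<infinity>" by (metis infinity_ennreal_def less_top)
    ultimately show ?thesis by simp
  qed
qed

text \<open>Conjugation by the coordinate bijection \<open>p\<close> gives a map \<open>G\<close> of
  the well-ordered case. The bijection preserves Lebesgue measure, and \<open>det_reindex\<close>
  identifies the two Jacobian determinants.\<close>

lemma emeasure_image:
  fixes g :: "real^'m::finite \<Rightarrow> real^'m"
  assumes A: "A \<in> sets borel" "g ` A \<in> sets borel"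
    and der: "\<And>x. x \<in> A \<Longrightarrow> (g has_derivative g' x) (at x)" and inj: "inj_on g A"
    and h: "h \<in> borel_measurable borel" "\<And>x. x \<in> A \<Longrightarrow> h x = \<bar>det (matrix (g' x))\<bar>"
  shows "emeasure lborel (g ` A) = (\<integral>\<^sup>+x. ennreal (h x) * indicator A x \<partial>lborel)"
proof -
  obtain f :: "'m idx \<Rightarrow> 'm" where f: "bij f" by (rule idx_bij)
  define p where "p = (\<lambda>x::real^'m. \<chi> i. x $ f i)"
  define q where "q = (\<lambda>y::real^'m idx. \<chi> j. y $ inv f j)"
  have pq: "p (q y) = y" "q (p x) = x" for x y
    using f by (simp_all add: p_def q_def vec_eq_iff bij_is_inj bij_is_surj surj_f_inv_f)
  have lp: "bounded_linear p" and lq: "bounded_linear q"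
    unfolding p_def q_def by (auto intro!: linear_conv_bounded_linear[THEN iffD1] linearI simp: vec_eq_iff)
  have pm: "p \<in> borel_measurable borel" and qm: "q \<in> borel_measurable borel"
    using lp lq borel_measurable_continuous_onI linear_continuous_on by blast+
  have img: "p ` X = q -` X" "q ` Y = p -` Y" for X Y using pq by (auto simp: image_iff) metis+
  have em: "emeasure lborel (p ` X) = emeasure lborel X" if "X \<in> sets borel" for X
  proof -
    have "distr lborel borel p = lborel" unfolding p_def by (rule lborel_distr_reindex[OF f])
    moreover have "p ` X \<in> sets borel" unfolding img(1) using measurable_sets[OF qm that] by simp
    moreover have "p -` p ` X = X" using pq by (auto simp: image_iff) metis
    ultimately show ?thesis using emeasure_distr[of p lborel borel "p ` X"] pm by simp
  qed
  define G where "G = p \<circ> g \<circ> q"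
  define G' where "G' y = p \<circ> g' (q y) \<circ> q" for y
  have "G ` (p ` A) = p ` (g ` A)" by (simp add: G_def image_image pq)
  moreover have "emeasure lborel (G ` (p ` A)) = (\<integral>\<^sup>+y. ennreal (h (q y)) * indicator (p ` A) y \<partial>lborel)"
  proof (rule emeasure_image_wellorder)
    show "p ` A \<in> sets borel" using img(1) measurable_sets[OF qm A(1)] by simp
    show "G ` p ` A \<in> sets borel"
      unfolding \<open>G ` (p ` A) = p ` (g ` A)\<close> using img(1) measurable_sets[OF qm A(2)] by simp
    show "inj_on G (p ` A)"
      using inj pq by (auto simp: inj_on_def G_def) metis
    show "(\<lambda>y. h (q y)) \<in> borel_measurable borel" using measurable_compose[OF qm h(1)] .
    fix y assume y: "y \<in> p ` A"
    then have qy: "q y \<in> A" using pq by auto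
    show "(G has_derivative G' y) (at y)"
      unfolding G_def G'_def
      by (intro diff_chain_at[OF bounded_linear_imp_has_derivative[OF lq]]
          diff_chain_at[OF der[OF qy]] bounded_linear_imp_has_derivative[OF lp])
    have q1: "q (axis j 1) = axis (f j) 1" for j
      using f by (auto simp: q_def vec_eq_iff axis_def bij_is_inj bij_is_surj surj_f_inv_f)
    have "det (matrix (g' (q y))) = det (\<chi> i j. matrix (g' (q y)) $ f i $ f j)"
      using f by (intro det_reindex) (auto simp: bij_is_inj bij_is_surj)
    also have "(\<chi> i j. matrix (g' (q y)) $ f i $ f j) = matrix (G' y)"
      by (simp add: matrix_def G'_def q1 vec_eq_iff p_def)
    finally show "h (q y) = \<bar>det (matrix (G' y))\<bar>" using h(2)[OF qy] by simp
  qed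
  moreover have "(\<integral>\<^sup>+y. ennreal (h (q y)) * indicator (p ` A) y \<partial>lborel)
      = (\<integral>\<^sup>+x. ennreal (h x) * indicator A x \<partial>lborel)"
  proof -
    have d: "distr lborel borel p = lborel" unfolding p_def by (rule lborel_distr_reindex[OF f])
    have pA: "p ` A \<in> sets borel" using img(1) measurable_sets[OF qm A(1)] by simp
    have "(\<integral>\<^sup>+y. ennreal (h (q y)) * indicator (p ` A) y \<partial>distr lborel borel p)
      = (\<integral>\<^sup>+x. ennreal (h (q (p x))) * indicator (p ` A) (p x) \<partial>lborel)"
      using pm pA measurable_compose[OF qm h(1)] by (subst nn_integral_distr) auto
    moreover have "indicator (p ` A) (p x) = (indicator A x :: ennreal)" for x
      using pq by (auto simp: indicator_def image_iff) metis
    ultimately show ?thesis by (simp add: d pq)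
  qed
  ultimately show ?thesis using em[OF A(2)] by simp
qed

text \<open>The image under \<open>g\<close> of the measure with density \<open>h\<close> is
  Lebesgue measure restricted to \<open>W2\<close>. This is an equality of measures, checked on sets
  by \<open>emeasure_image\<close>; the formula for integrands follows from it.\<close>

lemma nn_integral_change_of_variables:
  fixes g :: "real^'m::finite \<Rightarrow> real^'m"
  assumes hom: "homeomorphism W W2 g g2" and op: "open W" "open W2"
    and der: "\<And>x. x \<in> W \<Longrightarrow> (g has_derivative g' x) (at x)"
    and h: "continuous_on W h" "\<And>x. x \<in> W \<Longrightarrow> h x = \<bar>det (matrix (g' x))\<bar>"
    and d: "continuous_on W2 d" and A: "A \<in> sets borel" "A \<subseteq> W"
  shows "(\<integral>\<^sup>+y. ennreal (d y) * indicator (g ` A) y \<partial>lborel)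
       = (\<integral>\<^sup>+x. ennreal (h x * d (g x)) * indicator A x \<partial>lborel)"
proof -
  \<comment> \<open>Extension by zero outside the open sets yields Borel functions on the whole
    space, to which the theorems about image measures and densities apply.\<close>
  define G where "G x = (if x \<in> W then g x else 0)" for x
  define H where "H x = (if x \<in> W then h x else 0)" for x
  define D where "D y = (if y \<in> W2 then d y else 0)" for y
  have W: "W \<in> sets borel" "W2 \<in> sets borel" using op by auto
  have Gm: "G \<in> borel_measurable borel" and Hm: "H \<in> borel_measurable borel" and Dm: "D \<in> borel_measurable borel"
    unfolding G_def H_def D_def using hom h(1) d W
    by (auto intro!: borel_measurable_continuous_on_if simp: homeomorphism_def)
  have img: "g ` B \<in> sets borel" if "B \<in> sets borel" "B \<subseteq> W" for B
  proof -
    have m: "(\<lambda>y. if y \<in> W2 then g2 y else 0) \<in> borel_measurable borel"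
      using hom W by (auto intro!: borel_measurable_continuous_on_if simp: homeomorphism_def)
    have "g ` B = W2 \<inter> ((\<lambda>y. if y \<in> W2 then g2 y else 0) -` B)"
      using hom that by (auto simp: homeomorphism_def image_iff) (metis subsetD imageI)+
    then show ?thesis using measurable_sets[OF m that(1)] W by auto
  qed
  have inj: "inj_on g W" using hom by (auto simp: homeomorphism_def inj_on_def) metis
  let ?M = "density lborel (\<lambda>x. ennreal (H x))"
  have eq: "distr ?M borel G = density lborel (indicator W2)"
  proof (rule measure_eqI)
    fix B assume "B \<in> sets (distr ?M borel G)"
    then have B: "B \<in> sets borel" by simp
    have GB: "G -` B \<in> sets borel" using measurable_sets[OF Gm B] by simp
    have S: "W \<inter> G -` B \<in> sets borel" using GB W by auto
    have "emeasure (distr ?M borel G) B = (\<integral>\<^sup>+x. ennreal (H x) * indicator (G -` B) x \<partial>lborel)"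
      using Gm Hm B GB by (subst emeasure_distr) (auto simp: emeasure_density)
    also have "\<dots> = (\<integral>\<^sup>+x. ennreal (H x) * indicator (W \<inter> G -` B) x \<partial>lborel)"
      by (rule nn_integral_cong) (auto simp: H_def indicator_def)
    also have "\<dots> = emeasure lborel (g ` (W \<inter> G -` B))"
    proof (rule emeasure_image[OF S, where g' = g', symmetric])
      show "g ` (W \<inter> G -` B) \<in> sets borel" by (rule img[OF S]) auto
      show "inj_on g (W \<inter> G -` B)" using inj by (rule inj_on_subset) auto
      show "H \<in> borel_measurable borel" by (rule Hm)
      show "(g has_derivative g' x) (at x)" if "x \<in> W \<inter> G -` B" for x using der that by auto
      show "H x = \<bar>det (matrix (g' x))\<bar>" if "x \<in> W \<inter> G -` B" for x using h(2) that by (auto simp: H_def)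
    qed
    also have "g ` (W \<inter> G -` B) = B \<inter> W2"
      using hom by (auto simp: homeomorphism_def G_def image_iff)
    finally show "emeasure (distr ?M borel G) B = emeasure (density lborel (indicator W2)) B"
      using B W by (simp add: emeasure_density indicator_inter_arith[symmetric] Int_commute)
  qed simp
  have gA: "g ` A \<in> sets borel" using img A by blast
  have "(\<integral>\<^sup>+y. ennreal (d y) * indicator (g ` A) y \<partial>lborel)
      = (\<integral>\<^sup>+y. indicator W2 y * (ennreal (D y) * indicator (g ` A) y) \<partial>lborel)"
    using hom A by (intro nn_integral_cong) (auto simp: homeomorphism_def indicator_def D_def)
  also have "\<dots> = (\<integral>\<^sup>+y. ennreal (D y) * indicator (g ` A) y \<partial>distr ?M borel G)"
    unfolding eq using W Dm gA by (intro nn_integral_density[symmetric]) auto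
  also have "\<dots> = (\<integral>\<^sup>+x. ennreal (D (G x)) * indicator (g ` A) (G x) \<partial>?M)"
    using Gm Dm gA by (intro nn_integral_distr) auto
  also have "\<dots> = (\<integral>\<^sup>+x. ennreal (H x) * (ennreal (D (G x)) * indicator (g ` A) (G x)) \<partial>lborel)"
  proof (intro nn_integral_density)
    show "(\<lambda>x. ennreal (D (G x)) * indicator (g ` A) (G x)) \<in> borel_measurable lborel"
      using measurable_compose[OF Gm Dm] measurable_sets[OF Gm gA]
      by (intro borel_measurable_times_ennreal measurable_compose[OF _ measurable_ennreal]
          measurable_compose[OF _ borel_measurable_indicator[OF gA]]) (use Gm in auto)
  qed (use Hm in auto)
  also have "\<dots> = (\<integral>\<^sup>+x. ennreal (h x * d (g x)) * indicator A x \<partial>lborel)"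
  proof (rule nn_integral_cong)
    fix x
    have i: "indicator (g ` A) (g x) = (indicator A x :: ennreal)" if "x \<in> W"
      using inj A(2) that by (auto simp: indicator_def inj_on_def)
    have "ennreal (h x) * (ennreal (d (g x)) * indicator A x) = ennreal (h x * d (g x)) * indicator A x" if "x \<in> W"
      using h(2)[OF that] by (simp add: ennreal_mult'[symmetric] mult.assoc[symmetric])
    moreover have "g x \<in> W2" if "x \<in> W" using hom that by (auto simp: homeomorphism_def)
    ultimately show "ennreal (H x) * (ennreal (D (G x)) * indicator (g ` A) (G x)) = ennreal (h x * d (g x)) * indicator A x"
      using i A(2) by (cases "x \<in> W") (auto simp: H_def D_def G_def indicator_def)
  qed
  finally show ?thesis .
qed

subsection \<open>Transition maps\<close>

text \<open>Differentiability of \<open>\<tau>\<close> is deduced from that of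
  \<open>\<phi> \<circ> \<tau>\<close> and mere continuity of \<open>\<tau>\<close>. A linear left
  inverse \<open>L\<close> of the injective derivative isolates the increment of
  \<open>\<tau>\<close>, and the error term proportional to that increment is absorbed. This
  replaces the inverse function theorem for transition maps.\<close>

lemma has_derivative_through_immersion:
  fixes f :: "'a::real_normed_vector \<Rightarrow> 'c::euclidean_space" and \<phi> :: "'b::euclidean_space \<Rightarrow> 'c"
  assumes f: "(f has_derivative f') (at a)" and \<phi>: "(\<phi> has_derivative \<phi>') (at (\<tau> a))" and inj: "inj \<phi>'"
    and cont: "isCont \<tau> a" and ev: "eventually (\<lambda>y. \<phi> (\<tau> y) = f y) (at a)" "\<phi> (\<tau> a) = f a"
  shows "\<exists>T. (\<tau> has_derivative T) (at a) \<and> (\<forall>v. \<phi>' (T v) = f' v)"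
proof -
  have lin: "linear \<phi>'" "bounded_linear f'"
    using \<phi> f has_derivative_linear has_derivative_bounded_linear by blast+
  obtain L where L: "linear L" "L \<circ> \<phi>' = id" using linear_injective_left_inverse[OF lin(1) inj] by blast
  then have bL: "bounded_linear L" using linear_conv_bounded_linear by blast
  have L1: "L (\<phi>' w) = w" for w using L(2) by (metis comp_apply id_apply)
  obtain KL where KL: "KL > 0" "\<And>x. norm (L x) \<le> norm x * KL" using bounded_linear.pos_bounded[OF bL] by blast
  obtain Kf where Kf: "Kf > 0" "\<And>x. norm (f' x) \<le> norm x * Kf" using bounded_linear.pos_bounded[OF lin(2)] by blast
  let ?T = "L \<circ> f'"
  have bT: "bounded_linear ?T" using bounded_linear_compose[OF bL lin(2)] by (simp add: o_def)
  have R2: "eventually (\<lambda>y. norm (f y - f a - f' (y - a)) \<le> e * norm (y - a)) (at a)" if "e > 0" for e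
    using f that unfolding has_derivative_within_alt2 by blast
  have R1: "eventually (\<lambda>y. norm (\<phi> (\<tau> y) - \<phi> (\<tau> a) - \<phi>' (\<tau> y - \<tau> a)) \<le> e * norm (\<tau> y - \<tau> a)) (at a)" if "e > 0" for e
  proof -
    have "eventually (\<lambda>z. norm (\<phi> z - \<phi> (\<tau> a) - \<phi>' (z - \<tau> a)) \<le> e * norm (z - \<tau> a)) (at (\<tau> a))"
      using \<phi> that unfolding has_derivative_within_alt2 by blast
    then have "eventually (\<lambda>z. norm (\<phi> z - \<phi> (\<tau> a) - \<phi>' (z - \<tau> a)) \<le> e * norm (z - \<tau> a)) (nhds (\<tau> a))"
      using linear_0[OF lin(1)] by (auto simp: eventually_at_filter elim!: eventually_mono)
    moreover have "filterlim \<tau> (nhds (\<tau> a)) (at a)" using cont by (simp add: isCont_def)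
    ultimately show ?thesis by (rule eventually_compose_filterlim)
  qed
  have "(\<tau> has_derivative ?T) (at a)"
    unfolding has_derivative_within_alt2
  proof (intro conjI bT allI impI)
    fix e :: real assume e: "e > 0"
    \<comment> \<open>The first bound allows half of \<open>norm \<Delta>\<close> to be absorbed,
      giving \<open>norm \<Delta> \<le> 2 * KL * (Kf + 1) * norm (y - a)\<close>. The second one
      makes the resulting remainder at most \<open>e * norm (y - a)\<close>.\<close>
    define d where "d = min (1 / (2 * KL)) (e / (KL * (1 + 2 * KL * (Kf + 1))))"
    have den: "KL * (1 + 2 * KL * (Kf + 1)) > 0" using KL Kf by (intro mult_pos_pos add_pos_pos) auto
    have d: "d > 0" "d * KL \<le> 1 / 2" "KL * d * (1 + 2 * KL * (Kf + 1)) \<le> e"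
    proof -
      show "d > 0" using e KL den by (simp add: d_def)
      have "d * KL \<le> 1 / (2 * KL) * KL" using KL by (intro mult_right_mono) (auto simp: d_def)
      then show "d * KL \<le> 1 / 2" using KL by simp
      have "d \<le> e / (KL * (1 + 2 * KL * (Kf + 1)))" by (simp add: d_def)
      then show "KL * d * (1 + 2 * KL * (Kf + 1)) \<le> e" using den by (simp add: pos_le_divide_eq mult_ac)
    qed
    define d2 where "d2 = min d 1"
    have d2: "d2 > 0" "d2 \<le> d" "d2 \<le> 1" using d by (auto simp: d2_def)
    have "eventually (\<lambda>y. \<phi> (\<tau> y) = f y \<and> norm (f y - f a - f' (y - a)) \<le> d2 * norm (y - a) \<and>
       norm (\<phi> (\<tau> y) - \<phi> (\<tau> a) - \<phi>' (\<tau> y - \<tau> a)) \<le> d * norm (\<tau> y - \<tau> a)) (at a)"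
      using ev(1) R1[OF d(1)] R2[OF d2(1)] by eventually_elim auto
    then show "eventually (\<lambda>y. norm (\<tau> y - \<tau> a - ?T (y - a)) \<le> e * norm (y - a)) (at a)"
    proof eventually_elim
      case (elim y)
      define \<Delta> where "\<Delta> = \<tau> y - \<tau> a"
      define r1 where "r1 = \<phi> (\<tau> y) - \<phi> (\<tau> a) - \<phi>' \<Delta>"
      define r2 where "r2 = f y - f a - f' (y - a)"
      have n: "norm r2 \<le> d2 * norm (y - a)" "norm r1 \<le> d * norm \<Delta>" using elim by (auto simp: r1_def r2_def \<Delta>_def)
      \<comment> \<open>Both linearizations describe the same point
        \<open>\<phi> (\<tau> y) = f y\<close>; applying \<open>L\<close> expresses the increment
        through \<open>f'\<close> and the two remainders.\<close>
      have "\<phi>' \<Delta> = f' (y - a) + (r2 - r1)" using elim ev(2) by (simp add: r1_def r2_def)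
      then have D: "\<Delta> = L (f' (y - a)) + L (r2 - r1)"
        using L1[of \<Delta>] linear_add[OF L(1)] by metis
      have nL: "norm (L (r2 - r1)) \<le> KL * (d2 * norm (y - a) + d * norm \<Delta>)"
      proof -
        have "norm (L (r2 - r1)) \<le> norm (r2 - r1) * KL" by (rule KL)
        also have "\<dots> \<le> (norm r2 + norm r1) * KL" using KL by (intro mult_right_mono norm_triangle_ineq4) auto
        also have "\<dots> \<le> (d2 * norm (y - a) + d * norm \<Delta>) * KL" using KL n by (intro mult_right_mono add_mono) auto
        finally show ?thesis by (simp add: mult.commute)
      qed
      have "norm \<Delta> \<le> norm (L (f' (y - a))) + norm (L (r2 - r1))"
        using norm_triangle_ineq[of "L (f' (y - a))" "L (r2 - r1)"] D by simp
      moreover have "norm (L (f' (y - a))) \<le> norm (y - a) * Kf * KL"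
        using KL(2)[of "f' (y - a)"] mult_right_mono[OF Kf(2)[of "y - a"], of KL] KL(1) by linarith
      moreover have "KL * (d2 * norm (y - a)) \<le> KL * norm (y - a)"
        using KL d2 by (intro mult_left_mono) (auto simp: mult_left_le_one_le)
      moreover have "KL * (d * norm \<Delta>) \<le> norm \<Delta> / 2"
        using mult_right_mono[OF d(2), of "norm \<Delta>"] by (simp add: mult_ac)
      ultimately have "norm \<Delta> \<le> 2 * KL * (Kf + 1) * norm (y - a)"
        using nL by (simp add: algebra_simps)
      then have "d * norm \<Delta> \<le> d * (2 * KL * (Kf + 1) * norm (y - a))" using d by (intro mult_left_mono) auto
      moreover have "d2 * norm (y - a) \<le> d * norm (y - a)" using d2 by (intro mult_right_mono) auto
      ultimately have "KL * (d2 * norm (y - a) + d * norm \<Delta>)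
          \<le> KL * (d * norm (y - a) + d * (2 * KL * (Kf + 1) * norm (y - a)))"
        using KL(1) mult_left_mono[OF add_mono[of "d2 * norm (y - a)" "d * norm (y - a)" "d * norm \<Delta>"], of _ KL]
        by simp
      also have "\<dots> = KL * d * (1 + 2 * KL * (Kf + 1)) * norm (y - a)" by (simp add: algebra_simps)
      also have "\<dots> \<le> e * norm (y - a)" using d by (intro mult_right_mono) auto
      finally have "norm (L (r2 - r1)) \<le> e * norm (y - a)" using nL by linarith
      moreover have "\<tau> y - \<tau> a - ?T (y - a) = L (r2 - r1)" using D by (simp add: \<Delta>_def)
      ultimately show ?case by simp
    qed
  qed
  \<comment> \<open>\<open>L\<close> is only a left inverse of \<open>\<phi>'\<close>, so this does
    not follow from the formula for \<open>?T\<close>. It is the chain rule for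
    \<open>\<phi> \<circ> \<tau>\<close> together with uniqueness of the derivative of
    \<open>f\<close>.\<close>
  moreover have "\<phi>' (?T v) = f' v" for v
  proof -
    have "((\<lambda>y. \<phi> (\<tau> y)) has_derivative (\<lambda>v. \<phi>' (?T v))) (at a)"
      by (rule has_derivative_compose[OF calculation \<phi>])
    then have "(f has_derivative (\<lambda>v. \<phi>' (?T v))) (at a)"
      by (rule has_derivative_transform_eventually) (use ev in auto)
    then show ?thesis using has_derivative_unique[OF f] by metis
  qed
  ultimately show ?thesis by blast
qed

subsection \<open>Charts of a closed hypersurface\<close>

locale oriented_hypersurface =
  fixes \<Sigma> :: "'m::finite minkowski set" and \<nu> :: "'m minkowski \<Rightarrow> 'm minkowski"
  assumes closed: "closed_hypersurface \<Sigma>" and normal: "unit_normal_field \<Sigma> \<nu>"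
begin

abbreviation D :: "(real^'m \<Rightarrow> 'm minkowski) \<Rightarrow> real^'m \<Rightarrow> real^'m \<Rightarrow> 'm minkowski" where
  "D \<phi> u \<equiv> frechet_derivative \<phi> (at u)"

abbreviation pd :: "(real^'m \<Rightarrow> 'm minkowski) \<Rightarrow> real^'m \<Rightarrow> 'm \<Rightarrow> 'm minkowski" where
  "pd \<phi> u i \<equiv> D \<phi> u (axis i 1)"

text \<open>The signed area density: its absolute value is \<open>area_density\<close>. Unlike the
  latter it is a determinant in its rows, so it can be compared with the determinants in the
  divergence computation.\<close>

definition jac :: "(real^'m \<Rightarrow> 'm minkowski) \<Rightarrow> real^'m \<Rightarrow> real" where
  "jac \<phi> u = vdet (frame (\<nu> (\<phi> u)) (\<phi> u) (pd \<phi> u))"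

lemma compact_surface: "compact \<Sigma>" and borel_surface: "\<Sigma> \<in> sets borel"
  using closed by (auto simp: closed_hypersurface_def borel_compact)

lemma on_hyperboloid: "x \<in> \<Sigma> \<Longrightarrow> x \<in> hyperbolic_space" "x \<in> \<Sigma> \<Longrightarrow> lorentz x x = -1"
  using closed by (auto simp: closed_hypersurface_def hyperbolic_space_def)

lemma chart_exists: "x \<in> \<Sigma> \<Longrightarrow> \<exists>U \<phi>. local_param \<Sigma> U \<phi> \<and> x \<in> \<phi> ` U"
  using closed by (simp add: closed_hypersurface_def)

lemma chart_open: "local_param \<Sigma> U \<phi> \<Longrightarrow> open U"
  and chart_Ck: "local_param \<Sigma> U \<phi> \<Longrightarrow> Ck_on k U \<phi>"
  and chart_inj: "local_param \<Sigma> U \<phi> \<Longrightarrow> u \<in> U \<Longrightarrow> inj (D \<phi> u)"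
  and chart_openin: "local_param \<Sigma> U \<phi> \<Longrightarrow> openin (top_of_set \<Sigma>) (\<phi> ` U)"
  and chart_homeomorphism: "local_param \<Sigma> U \<phi> \<Longrightarrow> \<exists>\<psi>. homeomorphism U (\<phi> ` U) \<phi> \<psi>"
  by (auto simp: local_param_def smooth_on_def)

lemma chart_deriv: "local_param \<Sigma> U \<phi> \<Longrightarrow> u \<in> U \<Longrightarrow> (\<phi> has_derivative D \<phi> u) (at u)"
  using Ck_on_has_derivative[OF chart_Ck] by blast

lemma chart_linear: "local_param \<Sigma> U \<phi> \<Longrightarrow> u \<in> U \<Longrightarrow> linear (D \<phi> u)"
  using chart_deriv has_derivative_linear by blast

lemma chart_cont: "local_param \<Sigma> U \<phi> \<Longrightarrow> continuous_on U \<phi>"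
  using chart_Ck Ck_on_continuous by blast

lemma chart_inj_on: "local_param \<Sigma> U \<phi> \<Longrightarrow> inj_on \<phi> U"
  using chart_homeomorphism[of U \<phi>] by (auto simp: homeomorphism_def inj_on_def) metis

lemma chart_mem: "local_param \<Sigma> U \<phi> \<Longrightarrow> u \<in> U \<Longrightarrow> \<phi> u \<in> \<Sigma>"
  using chart_openin[of U \<phi>] openin_subset by fastforce

lemma chart_subset:
  assumes "local_param \<Sigma> U \<phi>" "open V" "V \<subseteq> U"
  shows "local_param \<Sigma> V \<phi>"
proof -
  obtain \<psi> where h: "homeomorphism U (\<phi> ` U) \<phi> \<psi>" using chart_homeomorphism[OF assms(1)] by blast
  have "openin (top_of_set (\<phi> ` U)) (\<phi> ` V)"
    by (rule homeomorphism_imp_open_map[OF h]) (use assms in \<open>simp add: openin_open_eq chart_open\<close>)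
  then have "openin (top_of_set \<Sigma>) (\<phi> ` V)" using chart_openin[OF assms(1)] openin_trans by blast
  moreover have "homeomorphism V (\<phi> ` V) \<phi> \<psi>"
    using homeomorphism_of_subsets[OF h assms(3)] by auto
  moreover have "smooth_on V \<phi>"
    using assms(1,3) Ck_on_subset unfolding local_param_def smooth_on_def by blast
  ultimately show ?thesis using assms unfolding local_param_def by blast
qed

lemma tangent_orthogonal:
  assumes "local_param \<Sigma> U \<phi>" "u \<in> U"
  shows "lorentz (\<phi> u) (D \<phi> u v) = 0"
proof -
  have d: "(\<phi> has_derivative D \<phi> u) (at u)" using chart_deriv[OF assms] .
  have "((\<lambda>w. lorentz (\<phi> w) (\<phi> w)) has_derivative
      (\<lambda>v. lorentz (\<phi> u) (D \<phi> u v) + lorentz (D \<phi> u v) (\<phi> u))) (at u)"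
    by (rule lorentz.FDERIV[OF d d])
  moreover have "((\<lambda>w. lorentz (\<phi> w) (\<phi> w)) has_derivative (\<lambda>_. 0)) (at u)"
    by (rule has_derivative_transform_within_open[of "\<lambda>_. -1" _ _ _ U])
       (use assms chart_open chart_mem on_hyperboloid in auto)
  ultimately have "(\<lambda>v. lorentz (\<phi> u) (D \<phi> u v) + lorentz (D \<phi> u v) (\<phi> u)) = (\<lambda>_. 0)"
    by (rule has_derivative_unique)
  from fun_cong[OF this, of v] show ?thesis by (simp add: lorentz_commute)
qed

lemma normal_facts:
  assumes "x \<in> \<Sigma>"
  shows "lorentz (\<nu> x) x = 0" "lorentz (\<nu> x) (\<nu> x) = 1" "v \<in> tangent_space \<Sigma> x \<Longrightarrow> lorentz (\<nu> x) v = 0"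
  using normal assms by (auto simp: unit_normal_field_def)

lemma normal_cont: "continuous_on \<Sigma> \<nu>"
  using normal by (simp add: unit_normal_field_def)

lemma chart_normal_cont: "local_param \<Sigma> U \<phi> \<Longrightarrow> continuous_on U (\<lambda>u. \<nu> (\<phi> u))"
  using continuous_on_compose2[OF normal_cont chart_cont] chart_mem by blast

lemma deriv_tangent: "local_param \<Sigma> U \<phi> \<Longrightarrow> u \<in> U \<Longrightarrow> D \<phi> u v \<in> tangent_space \<Sigma> (\<phi> u)"
  unfolding tangent_space_def by blast

lemma normal_orthogonal: "local_param \<Sigma> U \<phi> \<Longrightarrow> u \<in> U \<Longrightarrow> lorentz (\<nu> (\<phi> u)) (D \<phi> u v) = 0"
  using normal_facts(3) deriv_tangent chart_mem by blast

lemma deriv_expand: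
  assumes "local_param \<Sigma> U \<phi>" "u \<in> U"
  shows "D \<phi> u v = (\<Sum>i\<in>UNIV. (v $ i) *\<^sub>R pd \<phi> u i)"
proof -
  have "v = (\<Sum>i\<in>UNIV. (v $ i) *\<^sub>R axis i 1)"
    by (simp add: vec_eq_iff axis_def if_distrib cong: if_cong)
  then have "D \<phi> u v = D \<phi> u (\<Sum>i\<in>UNIV. (v $ i) *\<^sub>R axis i 1)" by simp
  then show ?thesis
    by (simp add: linear_sum[OF chart_linear[OF assms]] linear_scale[OF chart_linear[OF assms]])
qed

lemma jac_nonzero:
  assumes "local_param \<Sigma> U \<phi>" "u \<in> U"
  shows "jac \<phi> u \<noteq> 0"
  unfolding jac_def
proof (rule vdet_eq_0_tangent)
  fix c assume "(\<Sum>i\<in>UNIV. c i *\<^sub>R pd \<phi> u i) = 0"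
  then have "D \<phi> u (\<chi> i. c i) = D \<phi> u 0"
    using deriv_expand[OF assms, of "\<chi> i. c i"] linear_0[OF chart_linear[OF assms]] by simp
  then have "(\<chi> i. c i) = 0" using chart_inj[OF assms] by (simp add: inj_eq)
  then show "c = (\<lambda>_. 0)" by (simp add: vec_eq_iff fun_eq_iff)
qed (use chart_mem[OF assms] normal_facts on_hyperboloid normal_orthogonal[OF assms] tangent_orthogonal[OF assms] in auto)

lemma gram_jac:
  assumes "local_param \<Sigma> U \<phi>" "u \<in> U"
  shows "det (\<chi> i j. lorentz (pd \<phi> u i) (pd \<phi> u j)) = (jac \<phi> u)\<^sup>2"
  unfolding jac_def
  by (rule gram_vdet_frame)
     (use chart_mem[OF assms] normal_facts on_hyperboloid normal_orthogonal[OF assms] tangent_orthogonal[OF assms] in auto)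

lemma area_density_jac:
  assumes "local_param \<Sigma> U \<phi>" "u \<in> U"
  shows "area_density \<phi> u = \<bar>jac \<phi> u\<bar>"
  using gram_jac[OF assms] by (simp add: area_density_def)

lemma jac_cont:
  assumes "local_param \<Sigma> U \<phi>"
  shows "continuous_on U (jac \<phi>)"
proof -
  have "continuous_on U (\<lambda>u. vdet (\<lambda>i. frame (\<nu> (\<phi> u)) (\<phi> u) (pd \<phi> u) i))"
  proof (rule continuous_on_vdet)
    fix i :: "'m option option"
    have "continuous_on U (\<lambda>u. pd \<phi> u j)" for j
      using Ck_on_continuous[OF Ck_on_deriv[OF chart_Ck[OF assms, of "Suc 0"]]] .
    then show "continuous_on U (\<lambda>u. frame (\<nu> (\<phi> u)) (\<phi> u) (pd \<phi> u) i)"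
      using chart_cont[OF assms] chart_normal_cont[OF assms]
      by (cases i; cases "the i") (auto simp: frame_def)
  qed
  then show ?thesis by (simp add: jac_def[abs_def])
qed

lemma area_density_cont: "local_param \<Sigma> U \<phi> \<Longrightarrow> continuous_on U (area_density \<phi>)"
  using continuous_on_cong[of U U "area_density \<phi>" "\<lambda>u. \<bar>jac \<phi> u\<bar>"] area_density_jac
    continuous_on_rabs[OF jac_cont] by auto

lemma area_density_pos: "local_param \<Sigma> U \<phi> \<Longrightarrow> u \<in> U \<Longrightarrow> area_density \<phi> u > 0"
  using area_density_jac jac_nonzero by simp

section \<open>Change of chart and Borel sets\<close>

lemma chart_preimage_open:
  assumes "local_param \<Sigma> U1 \<phi>1" "local_param \<Sigma> U2 \<phi>2"
  shows "open {u \<in> U1. \<phi>1 u \<in> \<phi>2 ` U2}"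
proof -
  obtain Q where O: "open Q" "\<phi>2 ` U2 = \<Sigma> \<inter> Q"
    using chart_openin[OF assms(2)] unfolding openin_open by blast
  have "{u \<in> U1. \<phi>1 u \<in> \<phi>2 ` U2} = U1 \<inter> \<phi>1 -` Q" using O chart_mem[OF assms(1)] by auto
  then show ?thesis
    using continuous_open_preimage[OF chart_cont[OF assms(1)] chart_open[OF assms(1)] O(1)] by simp
qed

text \<open>The inverses of charts are given as continuous maps only. The transition map is
  therefore first obtained as a homeomorphism and then differentiated by
  \<open>has_derivative_through_immersion\<close>.\<close>

lemma chart_transition:
  assumes 1: "local_param \<Sigma> U1 \<phi>1" and 2: "local_param \<Sigma> U2 \<phi>2"
  defines "W1 \<equiv> {u \<in> U1. \<phi>1 u \<in> \<phi>2 ` U2}" and "W2 \<equiv> {u \<in> U2. \<phi>2 u \<in> \<phi>1 ` U1}"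
  obtains \<tau> \<sigma> T where "homeomorphism W1 W2 \<tau> \<sigma>" "\<And>u. u \<in> W1 \<Longrightarrow> \<phi>2 (\<tau> u) = \<phi>1 u"
    "\<And>u. u \<in> W1 \<Longrightarrow> (\<tau> has_derivative T u) (at u)"
    "\<And>u v. u \<in> W1 \<Longrightarrow> D \<phi>2 (\<tau> u) (T u v) = D \<phi>1 u v"
proof -
  obtain \<psi>1 where h1: "homeomorphism U1 (\<phi>1 ` U1) \<phi>1 \<psi>1" using chart_homeomorphism[OF 1] by blast
  obtain \<psi>2 where h2: "homeomorphism U2 (\<phi>2 ` U2) \<phi>2 \<psi>2" using chart_homeomorphism[OF 2] by blast
  define \<tau> where "\<tau> = \<psi>2 \<circ> \<phi>1"
  define \<sigma> where "\<sigma> = \<psi>1 \<circ> \<phi>2"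
  have inv1: "\<psi>1 (\<phi>1 u) = u" if "u \<in> U1" for u using homeomorphism_apply1[OF h1 that] .
  have inv2: "\<psi>2 (\<phi>2 u) = u" if "u \<in> U2" for u using homeomorphism_apply1[OF h2 that] .
  have hom: "homeomorphism W1 W2 \<tau> \<sigma>"
  proof (rule homeomorphismI)
    show "continuous_on W1 \<tau>" unfolding \<tau>_def o_def
      by (rule continuous_on_compose2[OF homeomorphism_cont2[OF h2] continuous_on_subset[OF chart_cont[OF 1]]])
         (auto simp: W1_def)
    show "continuous_on W2 \<sigma>" unfolding \<sigma>_def o_def
      by (rule continuous_on_compose2[OF homeomorphism_cont2[OF h1] continuous_on_subset[OF chart_cont[OF 2]]])
         (auto simp: W2_def)
  qed (auto simp: W1_def W2_def \<tau>_def \<sigma>_def inv1 inv2, (metis imageI inv1 inv2)+)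
  have eq: "\<phi>2 (\<tau> u) = \<phi>1 u" if "u \<in> W1" for u
    using that by (auto simp: W1_def \<tau>_def inv2)
  have op: "open W1" unfolding W1_def by (rule chart_preimage_open[OF 1 2])
  have "\<exists>T. (\<tau> has_derivative T) (at u) \<and> (\<forall>v. D \<phi>2 (\<tau> u) (T v) = D \<phi>1 u v)" if u: "u \<in> W1" for u
  proof (rule has_derivative_through_immersion)
    have u1: "u \<in> U1" using u by (simp add: W1_def)
    have u2: "\<tau> u \<in> U2" using hom u by (auto simp: homeomorphism_def W2_def)
    show "(\<phi>1 has_derivative D \<phi>1 u) (at u)" using chart_deriv[OF 1 u1] .
    show "(\<phi>2 has_derivative D \<phi>2 (\<tau> u)) (at (\<tau> u))" using chart_deriv[OF 2 u2] .
    show "inj (D \<phi>2 (\<tau> u))" using chart_inj[OF 2 u2] .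
    show "isCont \<tau> u" using hom op u by (auto simp: homeomorphism_def continuous_on_eq_continuous_at)
    show "\<phi>2 (\<tau> u) = \<phi>1 u" using eq[OF u] .
    show "eventually (\<lambda>y. \<phi>2 (\<tau> y) = \<phi>1 y) (at u)"
      using eventually_at_in_open'[OF op u] by eventually_elim (rule eq)
  qed
  then obtain T where "\<And>u. u \<in> W1 \<Longrightarrow> (\<tau> has_derivative T u) (at u) \<and> (\<forall>v. D \<phi>2 (\<tau> u) (T u v) = D \<phi>1 u v)"
    by metis
  then show ?thesis using that hom eq by blast
qed

text \<open>The Gram matrices in the two charts are congruent, \<open>G1 = M^T G2 M\<close>, so
  their determinants differ by \<open>(det M)^2\<close>.\<close>

lemma area_density_transition:
  assumes 1: "local_param \<Sigma> U1 \<phi>1" "u1 \<in> U1" and 2: "local_param \<Sigma> U2 \<phi>2" "u2 \<in> U2"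
    and T: "\<And>v. D \<phi>2 u2 (T v) = D \<phi>1 u1 v"
  shows "area_density \<phi>1 u1 = \<bar>det (matrix T)\<bar> * area_density \<phi>2 u2"
proof -
  let ?M = "matrix T"
  have e: "pd \<phi>1 u1 i = (\<Sum>k\<in>UNIV. (?M $ k $ i) *\<^sub>R pd \<phi>2 u2 k)" for i
    using deriv_expand[OF 2, of "T (axis i 1)"] T by (simp add: matrix_def)
  have "lorentz (pd \<phi>1 u1 i) (pd \<phi>1 u1 j) =
      (\<Sum>k\<in>UNIV. ?M $ k $ i * (\<Sum>l\<in>UNIV. lorentz (pd \<phi>2 u2 k) (pd \<phi>2 u2 l) * ?M $ l $ j))" for i j
  proof -
    have "lorentz y (pd \<phi>1 u1 j) = (\<Sum>l\<in>UNIV. lorentz y (pd \<phi>2 u2 l) * ?M $ l $ j)" for y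
      unfolding e[of j] lorentz.sum_right lorentz.scaleR_right by (simp add: mult.commute)
    then show ?thesis
      unfolding e[of i] lorentz.sum_left lorentz.scaleR_left by simp
  qed
  then have "(\<chi> i j. lorentz (pd \<phi>1 u1 i) (pd \<phi>1 u1 j)) =
     transpose ?M ** ((\<chi> i j. lorentz (pd \<phi>2 u2 i) (pd \<phi>2 u2 j)) ** ?M)"
    by (simp add: vec_eq_iff matrix_matrix_mult_def transpose_def)
  then have "det (\<chi> i j. lorentz (pd \<phi>1 u1 i) (pd \<phi>1 u1 j)) =
     (det ?M)\<^sup>2 * det (\<chi> i j. lorentz (pd \<phi>2 u2 i) (pd \<phi>2 u2 j))"
    by (simp add: det_mul power2_eq_square mult_ac)
  then show ?thesis by (simp add: area_density_def real_sqrt_mult)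
qed

lemma chart_image_borel:
  assumes c: "local_param \<Sigma> U \<phi>" and A: "A \<in> sets borel" "A \<subseteq> U"
  shows "\<phi> ` A \<in> sets borel"
proof -
  obtain \<psi> where h: "homeomorphism U (\<phi> ` U) \<phi> \<psi>" using chart_homeomorphism[OF c] by blast
  obtain Q where O: "open Q" "\<phi> ` U = \<Sigma> \<inter> Q"
    using chart_openin[OF c] unfolding openin_open by blast
  then have U: "\<phi> ` U \<in> sets borel" using borel_surface by auto
  have m: "(\<lambda>y. if y \<in> \<phi> ` U then \<psi> y else 0) \<in> borel_measurable borel"
    using h U by (intro borel_measurable_continuous_on_if) (auto simp: homeomorphism_def)
  have "\<phi> ` A = \<phi> ` U \<inter> ((\<lambda>y. if y \<in> \<phi> ` U then \<psi> y else 0) -` A)"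
    using h A(2) by (auto simp: homeomorphism_def image_iff) (metis subsetD imageI)+
  then show ?thesis using measurable_sets[OF m A(1)] U by auto
qed

lemma chart_vimage_borel:
  assumes c: "local_param \<Sigma> U \<phi>" and B: "B \<in> sets borel"
  shows "{u \<in> U. \<phi> u \<in> B} \<in> sets borel"
proof -
  have U: "U \<in> sets borel" using chart_open[OF c] by auto
  have m: "(\<lambda>y. if y \<in> U then \<phi> y else 0) \<in> borel_measurable borel"
    using chart_cont[OF c] U by (intro borel_measurable_continuous_on_if) auto
  have "{u \<in> U. \<phi> u \<in> B} = U \<inter> ((\<lambda>y. if y \<in> U then \<phi> y else 0) -` B)" by auto
  then show ?thesis using measurable_sets[OF m B] U by auto
qed

text \<open>The compatibility on overlaps that allows the chart densities to be glued to one
  measure.\<close>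

lemma area_transition:
  assumes 1: "local_param \<Sigma> U1 \<phi>1" and 2: "local_param \<Sigma> U2 \<phi>2"
    and A: "A \<in> sets borel" "A \<subseteq> U1" and im: "\<phi>1 ` A \<subseteq> \<phi>2 ` U2"
  shows "(\<integral>\<^sup>+u\<in>A. ennreal (area_density \<phi>1 u) \<partial>lborel)
       = (\<integral>\<^sup>+u\<in>{u \<in> U2. \<phi>2 u \<in> \<phi>1 ` A}. ennreal (area_density \<phi>2 u) \<partial>lborel)"
proof -
  define W1 where "W1 = {u \<in> U1. \<phi>1 u \<in> \<phi>2 ` U2}"
  define W2 where "W2 = {u \<in> U2. \<phi>2 u \<in> \<phi>1 ` U1}"
  obtain \<tau> \<sigma> T where t: "homeomorphism W1 W2 \<tau> \<sigma>" "\<And>u. u \<in> W1 \<Longrightarrow> \<phi>2 (\<tau> u) = \<phi>1 u"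
    "\<And>u. u \<in> W1 \<Longrightarrow> (\<tau> has_derivative T u) (at u)"
    "\<And>u v. u \<in> W1 \<Longrightarrow> D \<phi>2 (\<tau> u) (T u v) = D \<phi>1 u v"
    using chart_transition[OF 1 2] unfolding W1_def W2_def by blast
  have AW: "A \<subseteq> W1" using A im by (auto simp: W1_def)
  have \<tau>U: "\<tau> u \<in> U2" if "u \<in> W1" for u using t(1) that by (auto simp: homeomorphism_def W2_def)
  define h where "h u = area_density \<phi>1 u / area_density \<phi>2 (\<tau> u)" for u
  have ad: "area_density \<phi>1 u = \<bar>det (matrix (T u))\<bar> * area_density \<phi>2 (\<tau> u)" if "u \<in> W1" for u
    using area_density_transition[OF 1 _ 2] t(4) \<tau>U that by (auto simp: W1_def)
  have hd: "h u = \<bar>det (matrix (T u))\<bar>" if "u \<in> W1" for u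
    using ad[OF that] area_density_pos[OF 2 \<tau>U[OF that]] by (simp add: h_def)
  have hc: "continuous_on W1 h"
    unfolding h_def
  proof (intro continuous_on_divide)
    show "continuous_on W1 (area_density \<phi>1)"
      using area_density_cont[OF 1] continuous_on_subset by (force simp: W1_def)
    show "continuous_on W1 (\<lambda>u. area_density \<phi>2 (\<tau> u))"
      using t(1) \<tau>U by (intro continuous_on_compose2[OF area_density_cont[OF 2]]) (auto simp: homeomorphism_def)
    show "\<forall>u\<in>W1. area_density \<phi>2 (\<tau> u) \<noteq> 0"
      using area_density_pos[OF 2 \<tau>U] by force
  qed
  have d2: "continuous_on W2 (area_density \<phi>2)"
    using area_density_cont[OF 2] continuous_on_subset by (force simp: W2_def)
  have op: "open W1" "open W2" unfolding W1_def W2_def by (intro chart_preimage_open 1 2)+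
  have "(\<integral>\<^sup>+y. ennreal (area_density \<phi>2 y) * indicator (\<tau> ` A) y \<partial>lborel)
       = (\<integral>\<^sup>+x. ennreal (h x * area_density \<phi>2 (\<tau> x)) * indicator A x \<partial>lborel)"
    by (rule nn_integral_change_of_variables[OF t(1) op t(3) hc hd d2 A(1) AW])
  also have "\<dots> = (\<integral>\<^sup>+x. ennreal (area_density \<phi>1 x) * indicator A x \<partial>lborel)"
    using ad hd AW by (intro nn_integral_cong) (auto simp: indicator_def)
  also have "\<tau> ` A = {u \<in> U2. \<phi>2 u \<in> \<phi>1 ` A}"
  proof -
    have "u \<in> \<tau> ` A" if u: "u \<in> U2" "\<phi>2 u \<in> \<phi>1 ` A" for u
    proof -
      obtain a where a: "a \<in> A" "\<phi>2 u = \<phi>1 a" using u by auto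
      then have "\<phi>2 (\<tau> a) = \<phi>2 u" using t(2) AW by auto
      moreover have "\<tau> a \<in> U2" using \<tau>U AW a by blast
      ultimately have "\<tau> a = u" using inj_onD[OF chart_inj_on[OF 2]] u by blast
      then show ?thesis using a by auto
    qed
    moreover have "\<tau> a \<in> U2 \<and> \<phi>2 (\<tau> a) \<in> \<phi>1 ` A" if "a \<in> A" for a
      using that AW \<tau>U t(2) by auto
    ultimately show ?thesis by auto
  qed
  finally show ?thesis by simp
qed

lemma ball_chart:
  assumes "x \<in> \<Sigma>"
  obtains U c r \<phi> where "local_param \<Sigma> U \<phi>" "r > 0" "cball c r \<subseteq> U" "\<phi> c = x"
proof -
  obtain U \<phi> c where "local_param \<Sigma> U \<phi>" "c \<in> U" "\<phi> c = x" using chart_exists[OF assms] by auto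
  then show ?thesis using that chart_open open_contains_cball by metis
qed

text \<open>The closed balls lie inside the chart domains, so continuous functions such as the area
  density are bounded on the open balls that do the covering.\<close>

lemma finite_ball_cover:
  obtains N :: nat and U :: "nat \<Rightarrow> (real^'m) set" and \<phi> and c and r
  where "\<And>i. i < N \<Longrightarrow> local_param \<Sigma> (U i) (\<phi> i) \<and> r i > 0 \<and> cball (c i) (r i) \<subseteq> U i"
    and "\<Sigma> = (\<Union>i<N. \<phi> i ` ball (c i) (r i))"
proof -
  let ?P = "\<lambda>(U, \<phi>, c, r). local_param \<Sigma> U \<phi> \<and> r > 0 \<and> cball c r \<subseteq> U"
  let ?I = "\<lambda>(U :: (real^'m) set, \<phi> :: real^'m \<Rightarrow> 'm minkowski, c, r). \<phi> ` ball c r"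
  have op: "openin (top_of_set \<Sigma>) (?I p)" if p: "?P p" for p
  proof -
    obtain U \<phi> c r where p': "p = (U, \<phi>, c, r)" by (cases p)
    have "local_param \<Sigma> (ball c r) \<phi>"
      using p unfolding p' by (auto intro!: chart_subset[of U])
    then show ?thesis using chart_openin by (simp add: p')
  qed
  have cov: "\<Sigma> \<subseteq> \<Union>(?I ` Collect ?P)"
  proof
    fix x assume "x \<in> \<Sigma>"
    then obtain U c r \<phi> where "local_param \<Sigma> U \<phi>" "r > 0" "cball c r \<subseteq> U" "\<phi> c = x" using ball_chart by metis
    then have "(U, \<phi>, c, r) \<in> Collect ?P" "x \<in> ?I (U, \<phi>, c, r)" by auto
    then show "x \<in> \<Union>(?I ` Collect ?P)" by blast
  qed
  have "\<exists>F\<subseteq>?I ` Collect ?P. finite F \<and> \<Sigma> \<subseteq> \<Union>F"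
    using compact_surface[unfolded compact_eq_openin_cover] op cov by (metis (no_types, lifting) imageE mem_Collect_eq)
  then obtain F where F: "F \<subseteq> ?I ` Collect ?P" "finite F" "\<Sigma> \<subseteq> \<Union>F" by blast
  obtain G where G: "G \<subseteq> Collect ?P" "finite G" "F = ?I ` G" using finite_subset_image[OF F(2,1)] by blast
  obtain f :: "nat \<Rightarrow> _" and N where f: "G = f ` {..<N}"
    using finite_imp_nat_seg_image_inj_on[OF G(2)] by (auto simp: lessThan_def)
  show ?thesis
  proof (rule that[of N "\<lambda>i. fst (f i)" "\<lambda>i. fst (snd (f i))" "\<lambda>i. snd (snd (snd (f i)))" "\<lambda>i. fst (snd (snd (f i)))"])
    show "local_param \<Sigma> (fst (f i)) (fst (snd (f i))) \<and> snd (snd (snd (f i))) > 0 \<and>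
        cball (fst (snd (snd (f i)))) (snd (snd (snd (f i)))) \<subseteq> fst (f i)" if "i < N" for i
    proof -
      have "f i \<in> G" unfolding f using that by blast
      then have "f i \<in> Collect ?P" using G(1) by (rule rev_subsetD)
      then have "?P (f i)" by (rule CollectD)
      then show ?thesis by (simp add: case_prod_beta)
    qed
    have "X \<subseteq> \<Sigma>" if "X \<in> F" for X
    proof -
      have "X \<in> ?I ` Collect ?P" using F(1) that by (rule subsetD)
      then obtain p where X: "X = ?I p" and p: "p \<in> Collect ?P" by (rule imageE)
      from openin_subset[OF op[OF CollectD[OF p]]] show ?thesis
        unfolding X topspace_euclidean_subtopology .
    qed
    then have "\<Union>F \<subseteq> \<Sigma>" by blast
    then have "\<Sigma> = \<Union>F" using F by blast
    then show "\<Sigma> = (\<Union>i<N. fst (snd (f i)) ` ball (fst (snd (snd (f i)))) (snd (snd (snd (f i)))))"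
      by (simp add: G(3) f image_image case_prod_beta)
  qed
qed

subsection \<open>The area measure\<close>

text \<open>The predicate under the \<open>THE\<close> in \<open>area_measure\<close>, named so that
  existence and uniqueness can be proved about it.\<close>

definition is_area :: "'m minkowski measure \<Rightarrow> bool" where
  "is_area \<mu> \<longleftrightarrow> sets \<mu> = sets (restrict_space borel \<Sigma>) \<and>
     (\<forall>U \<phi> A. local_param \<Sigma> U \<phi> \<longrightarrow> A \<in> sets borel \<longrightarrow> A \<subseteq> U \<longrightarrow>
        emeasure \<mu> (\<phi> ` A) = (\<integral>\<^sup>+u\<in>A. ennreal (area_density \<phi> u) \<partial>lborel))"

lemma surface_sets: "A \<in> sets (restrict_space borel \<Sigma>) \<longleftrightarrow> A \<subseteq> \<Sigma> \<and> A \<in> sets borel"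
  using borel_surface by (subst sets_restrict_space_iff) auto

text \<open>Removing from each chart image the earlier ones turns a finite chart cover into a Borel
  partition, so sums over charts count every point once.\<close>

lemma surface_partition:
  obtains N :: nat and V \<phi> P
  where "\<And>i. i < N \<Longrightarrow> local_param \<Sigma> (V i) (\<phi> i)"
    and "\<And>i. i < N \<Longrightarrow> (\<integral>\<^sup>+u\<in>V i. ennreal (area_density (\<phi> i) u) \<partial>lborel) < \<infinity>"
    and "\<And>i. i < N \<Longrightarrow> P i \<in> sets borel \<and> P i \<subseteq> \<phi> i ` V i"
    and "disjoint_family_on P {..<N}" and "\<Sigma> = (\<Union>i<N. P i)"
proof -
  obtain N :: nat and U \<phi> c r
    where c: "\<And>i. i < N \<Longrightarrow> local_param \<Sigma> (U i) (\<phi> i) \<and> r i > 0 \<and> cball (c i) (r i) \<subseteq> U i"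
      and S: "\<Sigma> = (\<Union>i<N. \<phi> i ` ball (c i) (r i))" by (rule finite_ball_cover) blast
  define V where "V i = ball (c i) (r i)" for i
  define P where "P = disjointed (\<lambda>i. \<phi> i ` V i)"
  have V: "local_param \<Sigma> (V i) (\<phi> i)" if "i < N" for i
  proof -
    have "ball (c i) (r i) \<subseteq> U i" using c[OF that] ball_subset_cball by blast
    then show ?thesis unfolding V_def using chart_subset[OF conjunct1[OF c[OF that]] open_ball] by blast
  qed
  have fin: "(\<integral>\<^sup>+u\<in>V i. ennreal (area_density (\<phi> i) u) \<partial>lborel) < \<infinity>" if i: "i < N" for i
  proof -
    have "compact (area_density (\<phi> i) ` cball (c i) (r i))"
      using c[OF i] by (intro compact_continuous_image continuous_on_subset[OF area_density_cont]) auto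
    then obtain B where "\<forall>y\<in>area_density (\<phi> i) ` cball (c i) (r i). norm y \<le> B"
      using compact_imp_bounded bounded_iff by blast
    then have B: "\<bar>area_density (\<phi> i) u\<bar> \<le> B" if "u \<in> cball (c i) (r i)" for u using that by simp
    have "(\<integral>\<^sup>+u\<in>V i. ennreal (area_density (\<phi> i) u) \<partial>lborel) \<le> (\<integral>\<^sup>+u. ennreal B * indicator (V i) u \<partial>lborel)"
    proof (intro nn_integral_mono)
      fix u
      show "ennreal (area_density (\<phi> i) u) * indicator (V i) u \<le> ennreal B * indicator (V i) u"
        using B[of u] by (auto simp: indicator_def V_def intro!: ennreal_leI)
    qed
    also have "\<dots> = ennreal B * emeasure lborel (V i)" by (subst nn_integral_cmult_indicator) (auto simp: V_def)
    also have "\<dots> < \<infinity>"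
      using emeasure_bounded_finite[OF bounded_ball] by (auto simp: V_def ennreal_mult_less_top)
    finally show ?thesis .
  qed
  have P: "P i \<in> sets borel \<and> P i \<subseteq> \<phi> i ` V i" if i: "i < N" for i
  proof -
    have "\<phi> j ` V j \<in> sets borel" if "j < N" for j
      using chart_image_borel[OF V[OF that] borel_open[OF chart_open[OF V[OF that]]] order_refl] .
    then have "P i \<in> sets borel" unfolding P_def disjointed_def using i
      by (intro sets.Diff sets.finite_UN) simp_all
    moreover have "P i \<subseteq> \<phi> i ` V i" unfolding P_def by (rule disjointed_subset)
    ultimately show ?thesis ..
  qed
  have "(\<Union>i<N. P i) = (\<Union>i<N. \<phi> i ` V i)"
    using finite_UN_disjointed_eq[of "\<lambda>i. \<phi> i ` V i" N] by (simp add: P_def atLeast0LessThan)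
  then have S': "\<Sigma> = (\<Union>i<N. P i)" unfolding S V_def by simp
  have dis: "disjoint_family_on P {..<N}"
    unfolding P_def by (rule disjoint_family_on_mono[OF subset_UNIV disjoint_family_disjointed])
  show ?thesis
    by (rule that[of N V \<phi> P]) (fact V, fact fin, fact P, fact dis, fact S')
qed

lemma density_measurable:
  assumes "local_param \<Sigma> U \<phi>"
  shows "(\<lambda>u. ennreal (area_density \<phi> u) * indicator U u) \<in> borel_measurable borel"
proof -
  have "(\<lambda>u. if u \<in> U then area_density \<phi> u else 0) \<in> borel_measurable borel"
    using area_density_cont[OF assms] chart_open[OF assms] by (intro borel_measurable_continuous_on_if) auto
  then have "(\<lambda>u. ennreal (if u \<in> U then area_density \<phi> u else 0)) \<in> borel_measurable borel" by simp
  moreover have "(\<lambda>u. ennreal (if u \<in> U then area_density \<phi> u else 0)) = (\<lambda>u. ennreal (area_density \<phi> u) * indicator U u)"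
    by (auto simp: indicator_def)
  ultimately show ?thesis by simp
qed

definition chart_measure :: "(real^'m) set \<Rightarrow> (real^'m \<Rightarrow> 'm minkowski) \<Rightarrow> (real^'m) measure" where
  "chart_measure U \<phi> = density lborel (\<lambda>u. ennreal (area_density \<phi> u) * indicator U u)"

lemma sets_chart_measure [simp]: "sets (chart_measure U \<phi>) = sets borel"
  and space_chart_measure [simp]: "space (chart_measure U \<phi>) = UNIV"
  by (simp_all add: chart_measure_def)

lemma emeasure_chart_measure:
  assumes "local_param \<Sigma> U \<phi>" "A \<in> sets borel" "A \<subseteq> U"
  shows "emeasure (chart_measure U \<phi>) A = (\<integral>\<^sup>+u\<in>A. ennreal (area_density \<phi> u) \<partial>lborel)"
proof -
  have "emeasure (chart_measure U \<phi>) A = (\<integral>\<^sup>+u\<in>A. (ennreal (area_density \<phi> u) * indicator U u) \<partial>lborel)"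
    unfolding chart_measure_def using density_measurable[OF assms(1)] assms(2) by (intro emeasure_density) auto
  also have "\<dots> = (\<integral>\<^sup>+u\<in>A. ennreal (area_density \<phi> u) \<partial>lborel)"
    using assms(3) by (intro nn_integral_cong) (auto simp: indicator_def)
  finally show ?thesis .
qed

text \<open>The right-hand side does not mention \<open>\<mu>\<close>. This gives uniqueness of the
  area measure, and it dictates the formula by which the measure is constructed.\<close>

lemma is_area_sum:
  assumes \<mu>: "is_area \<mu>" and c: "\<And>i. i < (N::nat) \<Longrightarrow> local_param \<Sigma> (V i) (\<phi> i)"
    and P: "\<And>i. i < N \<Longrightarrow> P i \<in> sets borel \<and> P i \<subseteq> \<phi> i ` V i"
    and dis: "disjoint_family_on P {..<N}" and S: "\<Sigma> = (\<Union>i<N. P i)"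
    and B: "B \<in> sets (restrict_space borel \<Sigma>)"
  shows "emeasure \<mu> B = (\<Sum>i<N. emeasure (chart_measure (V i) (\<phi> i)) {u \<in> V i. \<phi> i u \<in> B \<inter> P i})"
proof -
  have Bb: "B \<in> sets borel" "B \<subseteq> \<Sigma>" using B by (auto simp: surface_sets)
  have "B = (\<Union>i<N. B \<inter> P i)" using Bb S by auto
  also have "emeasure \<mu> \<dots> = (\<Sum>i<N. emeasure \<mu> (B \<inter> P i))"
    using dis P Bb \<mu> by (intro sum_emeasure[symmetric])
      (auto simp: disjoint_family_on_def is_area_def surface_sets image_subset_iff)
  also have "\<dots> = (\<Sum>i<N. emeasure (chart_measure (V i) (\<phi> i)) {u \<in> V i. \<phi> i u \<in> B \<inter> P i})"
  proof (rule sum.cong)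
    fix i assume "i \<in> {..<N}"
    then have i: "i < N" by simp
    let ?A = "{u \<in> V i. \<phi> i u \<in> B \<inter> P i}"
    have A: "?A \<in> sets borel" using chart_vimage_borel[OF c[OF i], of "B \<inter> P i"] Bb P[OF i] by auto
    have "B \<inter> P i = \<phi> i ` ?A" using P[OF i] by auto
    also have "emeasure \<mu> (\<phi> i ` ?A) = emeasure (chart_measure (V i) (\<phi> i)) ?A"
      using \<mu> c[OF i] A emeasure_chart_measure[OF c[OF i] A] by (auto simp: is_area_def)
    finally show "emeasure \<mu> (B \<inter> P i) = emeasure (chart_measure (V i) (\<phi> i)) ?A" .
  qed simp
  finally show ?thesis .
qed

text \<open>The measure is defined by the sum from \<open>is_area_sum\<close> for one fixed
  partition. That it has the prescribed density in every other chart is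
  \<open>area_transition\<close>, applied piece by piece.\<close>

lemma is_area_exists: "\<exists>\<mu>. is_area \<mu>"
proof -
  obtain N :: nat and V \<phi> P
    where c: "\<And>i. i < N \<Longrightarrow> local_param \<Sigma> (V i) (\<phi> i)"
    and P: "\<And>i. i < N \<Longrightarrow> P i \<in> sets borel \<and> P i \<subseteq> \<phi> i ` V i"
    and dis: "disjoint_family_on P {..<N}" and S: "\<Sigma> = (\<Union>i<N. P i)" by (rule surface_partition) blast
  let ?C = "\<lambda>i A. {u \<in> V i. \<phi> i u \<in> A \<inter> P i}"
  define m where "m A = (\<Sum>i<N. emeasure (chart_measure (V i) (\<phi> i)) (?C i A))" for A
  let ?A = "sets (restrict_space borel \<Sigma>)"
  define \<mu> where "\<mu> = measure_of \<Sigma> ?A m"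
  have Cb: "?C i A \<in> sets borel" if "i < N" "A \<in> ?A" for i A
    using chart_vimage_borel[OF c[OF that(1)], of "A \<inter> P i"] that P by (auto simp: surface_sets)
  have sa: "sigma_algebra \<Sigma> ?A"
    using sets.sigma_algebra_axioms[of "restrict_space borel \<Sigma>"] by (simp add: space_restrict_space)
  have pos: "positive ?A m" by (simp add: positive_def m_def)
  have ca: "countably_additive ?A m"
  proof (rule countably_additiveI)
    fix A :: "nat \<Rightarrow> 'm minkowski set"
    assume A: "range A \<subseteq> ?A" and d: "disjoint_family A"
    have "(\<Sum>n. m (A n)) = (\<Sum>i<N. \<Sum>n. emeasure (chart_measure (V i) (\<phi> i)) (?C i (A n)))"
      unfolding m_def by (rule suminf_sum) simp
    also have "\<dots> = m (\<Union>n. A n)"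
      unfolding m_def
    proof (rule sum.cong)
      fix i assume i: "i \<in> {..<N}"
      have "(\<Sum>n. emeasure (chart_measure (V i) (\<phi> i)) (?C i (A n)))
          = emeasure (chart_measure (V i) (\<phi> i)) (\<Union>n. ?C i (A n))"
      proof (rule suminf_emeasure)
        show "disjoint_family (\<lambda>n. ?C i (A n))" using d unfolding disjoint_family_on_def by blast
        show "range (\<lambda>n. ?C i (A n)) \<subseteq> sets (chart_measure (V i) (\<phi> i))"
          using Cb[of i] i A by auto
      qed
      also have "(\<Union>n. ?C i (A n)) = ?C i (\<Union>n. A n)" by auto
      finally show "(\<Sum>n. emeasure (chart_measure (V i) (\<phi> i)) (?C i (A n)))
          = emeasure (chart_measure (V i) (\<phi> i)) (?C i (\<Union>n. A n))" .
    qed simp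
    finally show "(\<Sum>n. m (A n)) = m (\<Union>n. A n)" .
  qed
  have em: "emeasure \<mu> A = m A" if "A \<in> ?A" for A
    unfolding \<mu>_def by (rule emeasure_measure_of_sigma[OF sa pos ca that])
  have "sets \<mu> = ?A" unfolding \<mu>_def using sa by (simp add: sigma_algebra.sets_measure_of_eq)
  moreover have "emeasure \<mu> (\<psi> ` A) = (\<integral>\<^sup>+u\<in>A. ennreal (area_density \<psi> u) \<partial>lborel)"
    if L: "local_param \<Sigma> U \<psi>" and A: "A \<in> sets borel" "A \<subseteq> U" for U \<psi> A
  proof -
    have im: "\<psi> ` A \<in> ?A"
      unfolding surface_sets using chart_image_borel[OF L A] chart_mem[OF L] A by auto
    \<comment> \<open>The part of \<open>A\<close> that the arbitrary chart \<open>\<psi>\<close>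
      sends into the \<open>i\<close>-th piece; on it the charts \<open>\<psi>\<close> and
      \<open>\<phi> i\<close> can be exchanged.\<close>
    define F where "F i = {u \<in> A. \<psi> u \<in> P i}" for i
    have Fb: "F i \<in> sets borel" if "i < N" for i
    proof -
      have "F i = A \<inter> {u \<in> U. \<psi> u \<in> P i}" using A by (auto simp: F_def)
      then show ?thesis using chart_vimage_borel[OF L] P[OF that] A by auto
    qed
    have "emeasure \<mu> (\<psi> ` A) = m (\<psi> ` A)" by (rule em[OF im])
    also have "\<dots> = (\<Sum>i<N. emeasure (chart_measure U \<psi>) (F i))"
      unfolding m_def
    proof (rule sum.cong)
      fix i assume "i \<in> {..<N}"
      then have i: "i < N" by simp
      have FU: "F i \<subseteq> U" and Fim: "\<psi> ` F i \<subseteq> \<phi> i ` V i" using A P[OF i] by (auto simp: F_def)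
      have eq: "?C i (\<psi> ` A) = {u \<in> V i. \<phi> i u \<in> \<psi> ` F i}" by (auto simp: F_def)
      have "emeasure (chart_measure U \<psi>) (F i) = (\<integral>\<^sup>+u\<in>F i. ennreal (area_density \<psi> u) \<partial>lborel)"
        by (rule emeasure_chart_measure[OF L Fb[OF i] FU])
      also have "\<dots> = (\<integral>\<^sup>+u\<in>?C i (\<psi> ` A). ennreal (area_density (\<phi> i) u) \<partial>lborel)"
        unfolding eq by (rule area_transition[OF L c[OF i] Fb[OF i] FU Fim])
      also have "\<dots> = emeasure (chart_measure (V i) (\<phi> i)) (?C i (\<psi> ` A))"
        by (rule emeasure_chart_measure[OF c[OF i] Cb[OF i im], symmetric]) auto
      finally show "emeasure (chart_measure (V i) (\<phi> i)) (?C i (\<psi> ` A)) = emeasure (chart_measure U \<psi>) (F i)" ..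
    qed simp
    also have "\<dots> = emeasure (chart_measure U \<psi>) (\<Union>i<N. F i)"
      using dis Fb by (intro sum_emeasure) (auto simp: disjoint_family_on_def F_def image_subset_iff)
    also have "(\<Union>i<N. F i) = A" using S chart_mem[OF L] A by (auto simp: F_def)
    finally show ?thesis using emeasure_chart_measure[OF L A] by simp
  qed
  ultimately have "is_area \<mu>" unfolding is_area_def by blast
  then show ?thesis ..
qed

lemma is_area_unique:
  assumes "is_area \<mu>1" "is_area \<mu>2"
  shows "\<mu>1 = \<mu>2"
proof (rule measure_eqI)
  obtain N :: nat and V \<phi> P
    where c: "\<And>i. i < N \<Longrightarrow> local_param \<Sigma> (V i) (\<phi> i)"
    and P: "\<And>i. i < N \<Longrightarrow> P i \<in> sets borel \<and> P i \<subseteq> \<phi> i ` V i"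
    and dis: "disjoint_family_on P {..<N}" and S: "\<Sigma> = (\<Union>i<N. P i)" by (rule surface_partition) blast
  show "sets \<mu>1 = sets \<mu>2" using assms by (simp add: is_area_def)
  fix B assume "B \<in> sets \<mu>1"
  then have B: "B \<in> sets (restrict_space borel \<Sigma>)" using assms by (simp add: is_area_def)
  show "emeasure \<mu>1 B = emeasure \<mu>2 B"
    using is_area_sum[OF assms(1) c P dis S B] is_area_sum[OF assms(2) c P dis S B] by simp
qed

lemma is_area_area_measure: "is_area (area_measure \<Sigma>)"
proof -
  have "\<exists>!\<mu>. is_area \<mu>" using is_area_exists is_area_unique by blast
  then have "is_area (THE \<mu>. is_area \<mu>)" by (rule theI')
  then show ?thesis unfolding is_area_def area_measure_def .
qed

lemma sets_area_measure: "sets (area_measure \<Sigma>) = sets (restrict_space borel \<Sigma>)"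
  using is_area_area_measure by (simp add: is_area_def)

lemma space_area_measure: "space (area_measure \<Sigma>) = \<Sigma>"
  using sets_eq_imp_space_eq[OF sets_area_measure] by (simp add: space_restrict_space)

lemma finite_area: "finite_measure (area_measure \<Sigma>)"
proof
  obtain N :: nat and V \<phi> P
    where c: "\<And>i. i < N \<Longrightarrow> local_param \<Sigma> (V i) (\<phi> i)"
    and fin: "\<And>i. i < N \<Longrightarrow> (\<integral>\<^sup>+u\<in>V i. ennreal (area_density (\<phi> i) u) \<partial>lborel) < \<infinity>"
    and P: "\<And>i. i < N \<Longrightarrow> P i \<in> sets borel \<and> P i \<subseteq> \<phi> i ` V i"
    and dis: "disjoint_family_on P {..<N}" and S: "\<Sigma> = (\<Union>i<N. P i)" by (rule surface_partition) blast
  have "emeasure (area_measure \<Sigma>) \<Sigma> =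
      (\<Sum>i<N. emeasure (chart_measure (V i) (\<phi> i)) {u \<in> V i. \<phi> i u \<in> \<Sigma> \<inter> P i})"
    by (rule is_area_sum[OF is_area_area_measure c P dis S]) (auto simp: surface_sets borel_surface)
  also have "\<dots> \<le> (\<Sum>i<N. emeasure (chart_measure (V i) (\<phi> i)) (V i))"
    using c chart_open by (intro sum_mono emeasure_mono) auto
  also have "\<dots> < \<infinity>"
    using fin emeasure_chart_measure[OF c _ order_refl] chart_open[OF c] by (simp add: less_top[symmetric])
  finally show "emeasure (area_measure \<Sigma>) (space (area_measure \<Sigma>)) \<noteq> \<infinity>"
    by (simp add: space_area_measure)
qed

section \<open>Integration of functions on the hypersurface\<close>

lemma continuous_measurable: "continuous_on \<Sigma> f \<Longrightarrow> f \<in> borel_measurable (area_measure \<Sigma>)"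
  using borel_measurable_continuous_on_restrict measurable_cong_sets[OF sets_area_measure refl] by blast

lemma bounded_integrable:
  fixes f :: "'m minkowski \<Rightarrow> real"
  assumes "f \<in> borel_measurable (area_measure \<Sigma>)" "\<And>x. x \<in> \<Sigma> \<Longrightarrow> \<bar>f x\<bar> \<le> B"
  shows "integrable (area_measure \<Sigma>) f"
  by (rule finite_measure.integrable_const_bound[OF finite_area, of _ B])
     (use assms in \<open>auto intro!: AE_I2 simp: space_area_measure\<close>)

lemma continuous_integrable:
  fixes f :: "'m minkowski \<Rightarrow> real"
  assumes "continuous_on \<Sigma> f"
  shows "integrable (area_measure \<Sigma>) f"
proof -
  have "compact (f ` \<Sigma>)" using compact_continuous_image[OF assms compact_surface] .
  then obtain B where "\<forall>y\<in>f ` \<Sigma>. norm y \<le> B" using compact_imp_bounded bounded_iff by blast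
  then have "\<bar>f x\<bar> \<le> B" if "x \<in> \<Sigma>" for x using that by simp
  then show ?thesis using bounded_integrable continuous_measurable[OF assms] by blast
qed

lemma integral_chart:
  fixes f :: "'m minkowski \<Rightarrow> real"
  assumes c: "local_param \<Sigma> U \<phi>" and f: "f \<in> borel_measurable (area_measure \<Sigma>)"
    and supp: "\<And>x. x \<in> \<Sigma> \<Longrightarrow> x \<notin> \<phi> ` U \<Longrightarrow> f x = 0"
  shows "(\<integral>x. f x \<partial>area_measure \<Sigma>) = (\<integral>u. (if u \<in> U then area_density \<phi> u * f (\<phi> u) else 0) \<partial>lborel)"
proof (cases "U = {}")
  case True
  then have "(\<integral>x. f x \<partial>area_measure \<Sigma>) = (\<integral>x. 0 \<partial>area_measure \<Sigma>)"
    using supp by (intro Bochner_Integration.integral_cong) (auto simp: space_area_measure)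
  then show ?thesis using True by simp
next
  case False
  then obtain p where p: "p \<in> U" by blast
  \<comment> \<open>A total extension of the chart: points outside \<open>U\<close> go to a fixed
    point of the hypersurface, so that \<open>\<Phi>\<close> is measurable into
    \<open>area_measure\<close>. \<open>chart_measure\<close> gives no mass to these points.\<close>
  define \<Phi> where "\<Phi> u = (if u \<in> U then \<phi> u else \<phi> p)" for u
  have U: "U \<in> sets borel" "\<phi> ` U \<in> sets borel"
    using chart_open[OF c] chart_image_borel[OF c] by auto
  have Us: "\<phi> ` U \<in> sets (area_measure \<Sigma>)"
    unfolding sets_area_measure surface_sets using U chart_mem[OF c] by auto
  have "\<Phi> \<in> borel_measurable borel" unfolding \<Phi>_def
    using chart_cont[OF c] U by (intro borel_measurable_continuous_on_if) auto
  then have "\<Phi> \<in> measurable borel (restrict_space borel \<Sigma>)"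
    by (rule measurable_restrict_space2[rotated]) (auto simp: \<Phi>_def chart_mem[OF c] p)
  then have Pm: "\<Phi> \<in> measurable (chart_measure U \<phi>) (area_measure \<Sigma>)"
    using measurable_cong_sets[OF sets_chart_measure sets_area_measure] by blast
  \<comment> \<open>The defining property of the area measure, read as an equality of measures:
    restricted to the chart image it is the image of \<open>chart_measure\<close>.\<close>
  have eq: "density (area_measure \<Sigma>) (indicator (\<phi> ` U)) = distr (chart_measure U \<phi>) (area_measure \<Sigma>) \<Phi>"
  proof (rule measure_eqI)
    fix B assume "B \<in> sets (density (area_measure \<Sigma>) (indicator (\<phi> ` U)))"
    then have B: "B \<in> sets (area_measure \<Sigma>)" by simp
    then have Bb: "B \<in> sets borel" by (simp add: sets_area_measure surface_sets)
    let ?A = "{u \<in> U. \<phi> u \<in> B}"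
    have A: "?A \<in> sets borel" using chart_vimage_borel[OF c Bb] .
    have "emeasure (density (area_measure \<Sigma>) (indicator (\<phi> ` U))) B = emeasure (area_measure \<Sigma>) (\<phi> ` U \<inter> B)"
      using B Us by (simp add: emeasure_density indicator_inter_arith[symmetric])
    also have "\<phi> ` U \<inter> B = \<phi> ` ?A" by auto
    also have "emeasure (area_measure \<Sigma>) (\<phi> ` ?A) = emeasure (chart_measure U \<phi>) ?A"
      using is_area_area_measure c A emeasure_chart_measure[OF c A] by (auto simp: is_area_def)
    also have "\<dots> = emeasure (chart_measure U \<phi>) (\<Phi> -` B)"
    proof -
      have V: "\<Phi> -` B \<in> sets borel" using measurable_sets[OF Pm B] by simp
      show ?thesis
        unfolding chart_measure_def using A V density_measurable[OF c]
        by (auto simp: emeasure_density \<Phi>_def indicator_def intro!: nn_integral_cong)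
    qed
    also have "\<dots> = emeasure (distr (chart_measure U \<phi>) (area_measure \<Sigma>) \<Phi>) B"
      using Pm B by (simp add: emeasure_distr)
    finally show "emeasure (density (area_measure \<Sigma>) (indicator (\<phi> ` U))) B
      = emeasure (distr (chart_measure U \<phi>) (area_measure \<Sigma>) \<Phi>) B" .
  qed simp
  have "(\<integral>x. f x \<partial>area_measure \<Sigma>) = (\<integral>x. indicator (\<phi> ` U) x *\<^sub>R f x \<partial>area_measure \<Sigma>)"
    using supp by (intro Bochner_Integration.integral_cong) (auto simp: space_area_measure indicator_def)
  also have "\<dots> = (\<integral>x. f x \<partial>density (area_measure \<Sigma>) (\<lambda>x. ennreal (indicator (\<phi> ` U) x)))"
    using f Us by (intro integral_density[symmetric]) auto
  also have "\<dots> = (\<integral>x. f x \<partial>distr (chart_measure U \<phi>) (area_measure \<Sigma>) \<Phi>)"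
    unfolding eq[symmetric] ennreal_indicator by simp
  also have "\<dots> = (\<integral>u. f (\<Phi> u) \<partial>chart_measure U \<phi>)"
    by (rule integral_distr[OF Pm f])
  also have "chart_measure U \<phi> = density lborel (\<lambda>u. ennreal (if u \<in> U then area_density \<phi> u else 0))"
    unfolding chart_measure_def by (rule arg_cong[of _ _ "density lborel"]) (auto simp: indicator_def)
  also have "(\<integral>u. f (\<Phi> u) \<partial>\<dots>) = (\<integral>u. (if u \<in> U then area_density \<phi> u else 0) *\<^sub>R f (\<Phi> u) \<partial>lborel)"
  proof (rule integral_density)
    show "(\<lambda>u. f (\<Phi> u)) \<in> borel_measurable lborel"
      using measurable_compose[OF Pm f] by (simp add: measurable_cong_sets[OF sets_chart_measure refl])
    show "(\<lambda>u. if u \<in> U then area_density \<phi> u else 0) \<in> borel_measurable lborel"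
      using area_density_cont[OF c] U by (auto intro!: borel_measurable_continuous_on_if)
    show "AE u in lborel. 0 \<le> (if u \<in> U then area_density \<phi> u else 0)"
      using area_density_pos[OF c] by (auto intro: less_imp_le)
  qed
  also have "\<dots> = (\<integral>u. (if u \<in> U then area_density \<phi> u * f (\<phi> u) else 0) \<partial>lborel)"
    by (rule Bochner_Integration.integral_cong) (auto simp: \<Phi>_def)
  finally show ?thesis .
qed

end

subsection \<open>The spectral theorem for a positive definite form on a subspace\<close>

lemma quadratic_nonneg_imp_linear_zero:
  fixes a b :: real
  assumes "\<And>s. 0 \<le> 2 * s * a + s\<^sup>2 * b"
  shows "a = 0"
proof (rule ccontr)
  assume a: "a \<noteq> 0"
  define p where "p = \<bar>b\<bar> + 1"
  have p: "p > 0" "b < 2 * p" by (auto simp: p_def)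
  \<comment> \<open>With \<open>p > \<bar>b\<bar>\<close> the linear term dominates the quadratic
    one at this point, so the expression is negative unless \<open>a = 0\<close>.\<close>
  define s where "s = - a / p"
  have "2 * s * a + s\<^sup>2 * b = (a\<^sup>2 / p) * (b / p - 2)"
    using p by (simp add: s_def power2_eq_square field_simps)
  moreover have "b / p < 2" using p by (simp add: pos_divide_less_eq)
  moreover have "a\<^sup>2 / p > 0" using a p by simp
  ultimately have "2 * s * a + s\<^sup>2 * b < 0" using mult_pos_neg[of "a\<^sup>2 / p" "b / p - 2"] by linarith
  then show False using assms[of s] by simp
qed

text \<open>The form is positive on \<open>T\<close> only, since the Lorentz form is indefinite on
  the ambient space. A minimizer of the Rayleigh quotient on the Euclidean unit sphere of
  \<open>T\<close> is an eigenvector; the induction continues on its \<open>B\<close>-orthogonal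
  complement. Splitting off the smallest eigenvalue each time yields a sorted list.\<close>

lemma spectral_theorem_form:
  fixes B :: "'a::euclidean_space \<Rightarrow> 'a \<Rightarrow> real" and A :: "'a \<Rightarrow> 'a"
  assumes B: "bounded_bilinear B" "\<And>v w. B v w = B w v" and A: "linear A" and T: "subspace T"
    and pos: "\<And>v. v \<in> T \<Longrightarrow> v \<noteq> 0 \<Longrightarrow> B v v > 0"
    and inv: "\<And>v. v \<in> T \<Longrightarrow> A v \<in> T"
    and adj: "\<And>v w. v \<in> T \<Longrightarrow> w \<in> T \<Longrightarrow> B (A v) w = B v (A w)"
  shows "\<exists>es ks. length es = length ks \<and> sorted ks \<and> span (set es) = T \<and>
     (\<forall>i<length es. \<forall>j<length es. B (es ! i) (es ! j) = (if i = j then 1 else 0)) \<and>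
     (\<forall>i<length es. A (es ! i) = (ks ! i) *\<^sub>R (es ! i))"
  using T pos inv adj
proof (induction "dim T" arbitrary: T rule: less_induct)
  case less
  note T = less.prems(1) and pos = less.prems(2) and inv = less.prems(3) and adj = less.prems(4)
  interpret B: bounded_bilinear B by (rule B(1))
  show ?case
  proof (cases "T = {0}")
    case True
    then show ?thesis by (intro exI[of _ "[]"]) auto
  next
    case False
    define K where "K = T \<inter> sphere 0 1"
    have cK: "compact K" unfolding K_def using T by (intro closed_Int_compact closed_subspace) auto
    have nK: "K \<noteq> {}"
    proof -
      obtain v where "v \<in> T" "v \<noteq> 0" using False subspace_0[OF T] by blast
      then have "inverse (norm v) *\<^sub>R v \<in> K" using T by (auto simp: K_def subspace_scale)
      then show ?thesis by blast
    qed
    have posK: "B v v > 0" if "v \<in> K" for v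
    proof -
      have "v \<in> T" "v \<noteq> 0" using that by (auto simp: K_def)
      then show ?thesis by (rule pos)
    qed
    have "continuous_on K (\<lambda>v. B (A v) v / B v v)"
      using posK linear_continuous_on[OF A[unfolded linear_conv_bounded_linear]]
      by (intro continuous_on_divide B.continuous_on continuous_on_id) (auto simp: less_le)
    then obtain e0 where e0: "e0 \<in> K" "\<And>v. v \<in> K \<Longrightarrow> B (A e0) e0 / B e0 e0 \<le> B (A v) v / B v v"
      using continuous_attains_inf[OF cK nK] by blast
    define l where "l = B (A e0) e0 / B e0 e0"
    have low: "l * B w w \<le> B (A w) w" if w: "w \<in> T" for w
    proof (cases "w = 0")
      case True
      then show ?thesis by (simp add: B.zero_right)
    next
      case False
      let ?v = "inverse (norm w) *\<^sub>R w"
      have v: "?v \<in> K" using w T False by (auto simp: K_def subspace_scale)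
      have "l \<le> B (A ?v) ?v / B ?v ?v" using e0(2)[OF v] by (simp add: l_def)
      also have "\<dots> = B (A w) w / B w w"
        using False by (simp add: linear_scale[OF A] B.scaleR_left B.scaleR_right)
      finally show ?thesis using pos[OF w False] by (simp add: pos_le_divide_eq)
    qed
    define e where "e = inverse (sqrt (B e0 e0)) *\<^sub>R e0"
    have eT: "e \<in> T" using e0(1) T by (auto simp: e_def K_def subspace_scale)
    have p0: "B e0 e0 > 0" using posK e0(1) .
    have ee: "B e e = 1"
      using p0 by (simp add: e_def B.scaleR_left B.scaleR_right flip: power2_eq_square)
                  (simp add: field_simps flip: power2_eq_square)
    have Ae0: "B (A e0) e0 = l * B e0 e0" using p0 by (simp add: l_def)
    have Aee: "B (A e) e = l"
    proof -
      have "B (A e) e = l * B e e"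
        by (simp add: e_def linear_scale[OF A] B.scaleR_left B.scaleR_right Ae0)
      then show ?thesis using ee by simp
    qed
    \<comment> \<open>First variation at the minimizer: along \<open>e + s w\<close> the nonnegative
      expression \<open>B (A v) v - l * B v v\<close> is a quadratic in \<open>s\<close> without
      constant term, so its linear coefficient vanishes.\<close>
    have orth: "B (A e - l *\<^sub>R e) w = 0" if w: "w \<in> T" for w
    proof (rule quadratic_nonneg_imp_linear_zero)
      fix s :: real
      have "l * B (e + s *\<^sub>R w) (e + s *\<^sub>R w) \<le> B (A (e + s *\<^sub>R w)) (e + s *\<^sub>R w)"
        using low eT w T by (simp add: subspace_add subspace_scale)
      moreover have "B (A w) e = B (A e) w" using adj[OF w eT] B(2) by simp
      moreover have "B w e = B e w" by (rule B(2))
      ultimately show "0 \<le> 2 * s * B (A e - l *\<^sub>R e) w + s\<^sup>2 * (B (A w) w - l * B w w)"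
        using ee Aee
        by (simp add: linear_add[OF A] linear_scale[OF A] B.add_left B.add_right B.diff_left
            B.scaleR_left B.scaleR_right power2_eq_square algebra_simps)
    qed
    have Ae: "A e = l *\<^sub>R e"
    proof (rule ccontr)
      assume "A e \<noteq> l *\<^sub>R e"
      moreover have "A e - l *\<^sub>R e \<in> T" using inv[OF eT] eT T by (simp add: subspace_diff subspace_scale)
      ultimately show False using pos[of "A e - l *\<^sub>R e"] orth by force
    qed
    define T' where "T' = {w \<in> T. B e w = 0}"
    have T': "subspace T'"
      using T by (auto simp: T'_def subspace_def B.add_right B.scaleR_right B.zero_right)
    have "e \<notin> T'" using ee by (simp add: T'_def)
    then have "T' \<subset> T" using eT by (auto simp: T'_def)
    then have dl: "dim T' < dim T" by (intro dim_psubset) (simp only: iffD2[OF span_eq_iff T] iffD2[OF span_eq_iff T'])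
    have inv': "A v \<in> T'" if "v \<in> T'" for v
      using that inv adj[OF eT, of v] Ae by (auto simp: T'_def B.scaleR_left)
    obtain es ks where IH: "length es = length ks" "sorted ks" "span (set es) = T'"
      "\<forall>i<length es. \<forall>j<length es. B (es ! i) (es ! j) = (if i = j then 1 else 0)"
      "\<forall>i<length es. A (es ! i) = (ks ! i) *\<^sub>R (es ! i)"
      using less.hyps[OF dl T' _ inv'] pos adj unfolding T'_def by blast
    have esT: "es ! i \<in> T'" if "i < length es" for i
      using IH(3) that by (metis nth_mem span_base)
    have "l \<le> k" if k: "k \<in> set ks" for k
    proof -
      obtain i where i: "i < length ks" "k = ks ! i" using k by (auto simp: in_set_conv_nth)
      then have "B (A (es ! i)) (es ! i) = k" using IH by (simp add: B.scaleR_left)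
      moreover have "B (es ! i) (es ! i) = 1" using IH i by simp
      ultimately show ?thesis using low[of "es ! i"] esT[of i] i IH(1) by (simp add: T'_def)
    qed
    then have s: "sorted (l # ks)" using IH(2) by simp
    have sp: "span (set (e # es)) = T"
    proof
      have "set (e # es) \<subseteq> T" using eT IH(3) span_superset[of "set es"] by (auto simp: T'_def)
      then show "span (set (e # es)) \<subseteq> T" using T span_minimal by blast
      show "T \<subseteq> span (set (e # es))"
      proof
        fix w assume w: "w \<in> T"
        have "w - B e w *\<^sub>R e \<in> T'"
          using w eT T ee by (auto simp: T'_def subspace_diff subspace_scale B.diff_right B.scaleR_right)
        then have "w - B e w *\<^sub>R e \<in> span (set es)" using IH(3) by simp
        then show "w \<in> span (set (e # es))" by (auto simp: span_insert)
      qed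
    qed
    have "B ((e # es) ! i) ((e # es) ! j) = (if i = j then 1 else 0)"
      if "i < length (e # es)" "j < length (e # es)" for i j
    proof -
      have "B e (es ! k) = 0" "B (es ! k) e = 0" if "k < length es" for k
        using esT[OF that] B(2)[of "es ! k" e] by (simp_all add: T'_def)
      then show ?thesis using that IH(4) ee by (cases i; cases j) simp_all
    qed
    moreover have "A ((e # es) ! i) = ((l # ks) ! i) *\<^sub>R ((e # es) ! i)" if "i < length (e # es)" for i
      using that IH(5) Ae by (cases i) simp_all
    moreover have "length (e # es) = length (l # ks)" using IH(1) by simp
    ultimately show ?thesis using s sp by blast
  qed
qed

subsection \<open>Smoothness of the normal and the shape operator\<close>

lemma vdet_spans:
  assumes "vdet f \<noteq> 0"
  shows "\<exists>c. w = (\<Sum>i\<in>UNIV. c i *\<^sub>R f i)"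
proof -
  let ?M = "transpose (\<chi> i. coords (f i))"
  have "det ?M \<noteq> 0" using assms by (simp add: vdet_def)
  then obtain c where c: "?M *v c = coords w" using cramer by blast
  have "coords (\<Sum>i\<in>UNIV. c $ i *\<^sub>R f i) = coords w"
    unfolding c[symmetric]
    by (simp add: vec_eq_iff linear_sum[OF linear_coords] coords_scaleR matrix_vector_mult_def transpose_def mult.commute)
  moreover have "X = Y" if "coords X = coords Y" for X Y :: "'a minkowski"
  proof -
    have "coords X $ None = coords Y $ None" "coords X $ Some None = coords Y $ Some None"
      "coords X $ Some (Some j) = coords Y $ Some (Some j)" for j using that by simp_all
    then show ?thesis by (auto simp: coords_def prod_eq_iff vec_eq_iff)
  qed
  ultimately show ?thesis by metis
qed

lemma vdet_frame_spans:
  assumes "vdet (frame n x w) \<noteq> 0"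
  obtains a b c where "y = a *\<^sub>R n + b *\<^sub>R x + (\<Sum>i\<in>UNIV. c i *\<^sub>R w i)"
  using vdet_spans[OF assms, of y] by (auto simp: sum_option add.assoc)

lemma lorentz_Basis:
  fixes y :: "'m::finite minkowski"
  assumes "b \<in> Basis"
  shows "lorentz y b = lorentz b b * (y \<bullet> b)" "(lorentz b b)\<^sup>2 = 1"
  using assms by (auto simp: Basis_prod_def lorentz_def inner_prod_def inner_same_Basis)

context oriented_hypersurface
begin

abbreviation Dn :: "(real^'m \<Rightarrow> 'm minkowski) \<Rightarrow> real^'m \<Rightarrow> real^'m \<Rightarrow> 'm minkowski" where
  "Dn \<phi> u \<equiv> frechet_derivative (\<nu> \<circ> \<phi>) (at u)"

text \<open>The normal, the position and the coordinate vectors form a basis because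
  \<open>jac\<close> is nonzero. The coefficient of the position carries a minus sign as the
  position vector is timelike.\<close>

lemma chart_decompose:
  assumes c: "local_param \<Sigma> U \<phi>" "u \<in> U"
  obtains v where "y = lorentz (\<nu> (\<phi> u)) y *\<^sub>R \<nu> (\<phi> u) - lorentz (\<phi> u) y *\<^sub>R \<phi> u + D \<phi> u v"
proof -
  have x: "\<phi> u \<in> \<Sigma>" using chart_mem[OF c] .
  obtain a b k where y: "y = a *\<^sub>R \<nu> (\<phi> u) + b *\<^sub>R \<phi> u + (\<Sum>i\<in>UNIV. k i *\<^sub>R pd \<phi> u i)"
    using vdet_frame_spans[OF jac_nonzero[OF c, unfolded jac_def]] by blast
  have v: "(\<Sum>i\<in>UNIV. k i *\<^sub>R pd \<phi> u i) = D \<phi> u (\<chi> i. k i)" using deriv_expand[OF c, of "\<chi> i. k i"] by simp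
  have "lorentz (\<nu> (\<phi> u)) y = a" "lorentz (\<phi> u) y = - b"
    using normal_facts[OF x] on_hyperboloid[OF x] normal_orthogonal[OF c] tangent_orthogonal[OF c]
    by (simp_all add: y v lorentz.add_right lorentz.scaleR_right lorentz_commute[of "\<phi> u" "\<nu> (\<phi> u)"])
  then show ?thesis using that[of "\<chi> i. k i"] y v by simp
qed

text \<open>\<open>tangent_space\<close> collects derivatives from all charts; this description as
  an orthogonal complement involves no chart.\<close>

lemma tangent_space_eq:
  assumes "x \<in> \<Sigma>"
  shows "tangent_space \<Sigma> x = {y. lorentz (\<nu> x) y = 0 \<and> lorentz x y = 0}"
proof -
  obtain U \<phi> u where c: "local_param \<Sigma> U \<phi>" "u \<in> U" "\<phi> u = x" using chart_exists[OF assms] by auto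
  have "y \<in> tangent_space \<Sigma> x" if y: "lorentz (\<nu> x) y = 0" "lorentz x y = 0" for y
  proof -
    obtain v where "y = D \<phi> u v" using chart_decompose[OF c(1,2), of y] y c(3) by auto
    then show ?thesis using deriv_tangent[OF c(1,2)] c(3) by simp
  qed
  moreover have "lorentz x y = 0" if "y \<in> tangent_space \<Sigma> x" for y
    using that tangent_orthogonal unfolding tangent_space_def by blast
  ultimately show ?thesis using normal_facts(3)[OF assms] by blast
qed

lemma tangent_space_range:
  assumes "local_param \<Sigma> U \<phi>" "u \<in> U"
  shows "tangent_space \<Sigma> (\<phi> u) = range (D \<phi> u)"
proof
  show "range (D \<phi> u) \<subseteq> tangent_space \<Sigma> (\<phi> u)" using deriv_tangent[OF assms] by blast
  show "tangent_space \<Sigma> (\<phi> u) \<subseteq> range (D \<phi> u)"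
  proof
    fix y assume "y \<in> tangent_space \<Sigma> (\<phi> u)"
    then have "lorentz (\<nu> (\<phi> u)) y = 0" "lorentz (\<phi> u) y = 0"
      using tangent_space_eq[OF chart_mem[OF assms]] by auto
    then show "y \<in> range (D \<phi> u)" using chart_decompose[OF assms, of y] by auto
  qed
qed

text \<open>Of the decomposition of \<open>w\<close> only the normal component survives, the others
  repeat rows. In other words, \<open>jac\<close> times the normal is the generalized cross product
  of the position and the coordinate vectors.\<close>

lemma normal_vdet:
  assumes c: "local_param \<Sigma> U \<phi>" "u \<in> U"
  shows "vdet (frame w (\<phi> u) (pd \<phi> u)) = lorentz (\<nu> (\<phi> u)) w * jac \<phi> u"
proof -
  let ?f = "frame w (\<phi> u) (pd \<phi> u)"
  obtain v where w: "w = lorentz (\<nu> (\<phi> u)) w *\<^sub>R \<nu> (\<phi> u) - lorentz (\<phi> u) w *\<^sub>R \<phi> u + D \<phi> u v"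
    using chart_decompose[OF c] by blast
  have z: "vdet (?f(None := \<phi> u)) = 0" "\<And>i. vdet (?f(None := pd \<phi> u i)) = 0"
    using vdet_equal_rows[of None "Some None" "?f(None := \<phi> u)"]
      vdet_equal_rows[of None "Some (Some i)" "?f(None := pd \<phi> u i)" for i] by auto
  have "vdet ?f = vdet (?f(None := w))" by (rule arg_cong[of _ _ vdet]) (auto simp: fun_eq_iff frame_def)
  also have "\<dots> = vdet (?f(None := lorentz (\<nu> (\<phi> u)) w *\<^sub>R \<nu> (\<phi> u) - lorentz (\<phi> u) w *\<^sub>R \<phi> u + D \<phi> u v))"
    using w by simp
  also have "\<dots> = lorentz (\<nu> (\<phi> u)) w * vdet (?f(None := \<nu> (\<phi> u)))"
    unfolding deriv_expand[OF c, of v]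
    by (simp add: vdet_upd_add linear_diff[OF linear_vdet_upd] vdet_upd_scaleR vdet_upd_sum z)
  also have "?f(None := \<nu> (\<phi> u)) = frame (\<nu> (\<phi> u)) (\<phi> u) (pd \<phi> u)"
    by (auto simp: fun_eq_iff frame_def)
  finally show ?thesis by (simp add: jac_def)
qed

text \<open>The normal is assumed to be continuous only. The cross product \<open>N\<close> is built
  from \<open>\<phi>\<close> and its derivatives and is smooth, and it equals \<open>jac\<close>
  times the normal. As \<open>lorentz (N u) (N u)\<close> is the square of \<open>jac\<close>,
  \<open>Ck_on_inverse_sqrt\<close> makes the reciprocal of \<open>jac\<close> smooth as
  well.\<close>

lemma chart_normal_Ck:
  assumes c: "local_param \<Sigma> U \<phi>"
  shows "Ck_on k U (\<nu> \<circ> \<phi>)"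
proof -
  \<comment> \<open>The vector that represents the functional of \<open>normal_vdet\<close>; the
    factor \<open>lorentz b b\<close> converts Lorentz components into Euclidean ones.\<close>
  define N where "N u = (\<Sum>b\<in>Basis. (lorentz b b * vdet (frame b (\<phi> u) (pd \<phi> u))) *\<^sub>R b)" for u
  have U: "open U" using chart_open[OF c] .
  have N: "N u = jac \<phi> u *\<^sub>R \<nu> (\<phi> u)" if u: "u \<in> U" for u
  proof -
    have "N u = (\<Sum>b\<in>Basis. (jac \<phi> u * (\<nu> (\<phi> u) \<bullet> b)) *\<^sub>R b)"
      unfolding N_def normal_vdet[OF c u]
    proof (rule sum.cong)
      fix b :: "'m minkowski" assume b: "b \<in> Basis"
      have "lorentz b b * (lorentz (\<nu> (\<phi> u)) b * jac \<phi> u) = (lorentz b b)\<^sup>2 * (jac \<phi> u * (\<nu> (\<phi> u) \<bullet> b))"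
        unfolding lorentz_Basis(1)[OF b, of "\<nu> (\<phi> u)"] by (simp add: power2_eq_square)
      then show "(lorentz b b * (lorentz (\<nu> (\<phi> u)) b * jac \<phi> u)) *\<^sub>R b = (jac \<phi> u * (\<nu> (\<phi> u) \<bullet> b)) *\<^sub>R b"
        using lorentz_Basis(2)[OF b] by simp
    qed simp
    also have "\<dots> = jac \<phi> u *\<^sub>R (\<Sum>b\<in>Basis. (\<nu> (\<phi> u) \<bullet> b) *\<^sub>R b)" by (simp add: scaleR_sum_right)
    finally show ?thesis by (simp add: euclidean_representation)
  qed
  have fr: "Ck_on k U (\<lambda>u. frame b (\<phi> u) (pd \<phi> u) i)" for b i
  proof -
    have "Ck_on k U (\<lambda>u. pd \<phi> u j)" for j by (rule Ck_on_deriv[OF chart_Ck[OF c, of "Suc k"]])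
    then show ?thesis using chart_Ck[OF c, of k]
      by (cases i; cases "the i") (auto simp: frame_def Ck_on_const)
  qed
  have NCk: "Ck_on k U N"
    unfolding N_def
    by (intro Ck_on_sum U Ck_on_bilinear[OF bounded_bilinear_scaleR U]
        Ck_on_bilinear[OF bounded_bilinear_mult U] Ck_on_const Ck_on_vdet fr)
  have "Ck_on k U (\<lambda>u. inverse (jac \<phi> u))"
  proof (rule Ck_on_inverse_sqrt[OF U])
    show "continuous_on U (\<lambda>u. inverse (jac \<phi> u))"
      using jac_cont[OF c] jac_nonzero[OF c] by (intro continuous_on_inverse) auto
    show "(inverse (jac \<phi> u))\<^sup>2 * lorentz (N u) (N u) = 1" if "u \<in> U" for u
      using jac_nonzero[OF c that] normal_facts(2)[OF chart_mem[OF c that]]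
      by (simp add: N[OF that] lorentz.scaleR_left lorentz.scaleR_right power2_eq_square field_simps)
    show "Ck_on k U (\<lambda>u. lorentz (N u) (N u))"
      by (rule Ck_on_bilinear[OF bounded_bilinear_lorentz U NCk NCk])
  qed
  then have "Ck_on k U (\<lambda>u. inverse (jac \<phi> u) *\<^sub>R N u)"
    using NCk by (rule Ck_on_bilinear[OF bounded_bilinear_scaleR U])
  then show ?thesis
    by (rule Ck_on_cong[OF U, rotated]) (simp add: N jac_nonzero[OF c])
qed

lemma normal_deriv: "local_param \<Sigma> U \<phi> \<Longrightarrow> u \<in> U \<Longrightarrow> ((\<nu> \<circ> \<phi>) has_derivative Dn \<phi> u) (at u)"
  using Ck_on_has_derivative[OF chart_normal_Ck] by blast

lemma normal_deriv_linear: "local_param \<Sigma> U \<phi> \<Longrightarrow> u \<in> U \<Longrightarrow> linear (Dn \<phi> u)"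
  using normal_deriv has_derivative_linear by blast

lemma normal_deriv_orthogonal:
  assumes c: "local_param \<Sigma> U \<phi>" "u \<in> U"
  shows "lorentz (\<nu> (\<phi> u)) (Dn \<phi> u v) = 0" "lorentz (\<phi> u) (Dn \<phi> u v) = 0"
proof -
  have d: "((\<lambda>w. \<nu> (\<phi> w)) has_derivative Dn \<phi> u) (at u)" using normal_deriv[OF c] by (simp add: o_def)
  have "((\<lambda>w. lorentz (\<nu> (\<phi> w)) (\<nu> (\<phi> w))) has_derivative
      (\<lambda>v. lorentz (\<nu> (\<phi> u)) (Dn \<phi> u v) + lorentz (Dn \<phi> u v) (\<nu> (\<phi> u)))) (at u)"
    by (rule lorentz.FDERIV[OF d d])
  moreover have "((\<lambda>w. lorentz (\<nu> (\<phi> w)) (\<nu> (\<phi> w))) has_derivative (\<lambda>_. 0)) (at u)"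
    by (rule has_derivative_transform_within_open[of "\<lambda>_. 1" _ _ _ U])
       (use c chart_open chart_mem normal_facts in auto)
  ultimately have "(\<lambda>v. lorentz (\<nu> (\<phi> u)) (Dn \<phi> u v) + lorentz (Dn \<phi> u v) (\<nu> (\<phi> u))) = (\<lambda>_. 0)"
    by (rule has_derivative_unique)
  from fun_cong[OF this, of v] show "lorentz (\<nu> (\<phi> u)) (Dn \<phi> u v) = 0" by (simp add: lorentz_commute)
  have "((\<lambda>w. lorentz (\<nu> (\<phi> w)) (\<phi> w)) has_derivative
      (\<lambda>v. lorentz (\<nu> (\<phi> u)) (D \<phi> u v) + lorentz (Dn \<phi> u v) (\<phi> u))) (at u)"
    by (rule lorentz.FDERIV[OF d chart_deriv[OF c]])
  moreover have "((\<lambda>w. lorentz (\<nu> (\<phi> w)) (\<phi> w)) has_derivative (\<lambda>_. 0)) (at u)"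
    by (rule has_derivative_transform_within_open[of "\<lambda>_. 0" _ _ _ U])
       (use c chart_open chart_mem normal_facts in auto)
  ultimately have "(\<lambda>v. lorentz (\<nu> (\<phi> u)) (D \<phi> u v) + lorentz (Dn \<phi> u v) (\<phi> u)) = (\<lambda>_. 0)"
    by (rule has_derivative_unique)
  from fun_cong[OF this, of v] show "lorentz (\<phi> u) (Dn \<phi> u v) = 0"
    using normal_orthogonal[OF c] by (simp add: lorentz_commute)
qed

text \<open>Differentiating \<open>lorentz (\<nu> (\<phi> y)) (D \<phi> y w) = 0\<close> expresses
  the form through second derivatives of \<open>\<phi>\<close>, which are symmetric.\<close>

lemma normal_deriv_self_adjoint:
  assumes c: "local_param \<Sigma> U \<phi>" "u \<in> U"
  shows "lorentz (Dn \<phi> u v) (D \<phi> u w) = lorentz (Dn \<phi> u w) (D \<phi> u v)"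
proof -
  have d: "((\<lambda>w. \<nu> (\<phi> w)) has_derivative Dn \<phi> u) (at u)" using normal_deriv[OF c] by (simp add: o_def)
  have C2: "Ck_on (Suc (Suc 0)) U \<phi>" by (rule chart_Ck[OF c(1)])
  have key: "lorentz (Dn \<phi> u v) (D \<phi> u w) = - lorentz (\<nu> (\<phi> u)) (frechet_derivative (\<lambda>y. D \<phi> y w) (at u) v)" for v w
  proof -
    have "((\<lambda>y. lorentz (\<nu> (\<phi> y)) (D \<phi> y w)) has_derivative
        (\<lambda>v. lorentz (\<nu> (\<phi> u)) (frechet_derivative (\<lambda>y. D \<phi> y w) (at u) v) + lorentz (Dn \<phi> u v) (D \<phi> u w))) (at u)"
      by (rule lorentz.FDERIV[OF d Ck_on_has_derivative[OF Ck_on_deriv[OF C2] c(2)]])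
    moreover have "((\<lambda>y. lorentz (\<nu> (\<phi> y)) (D \<phi> y w)) has_derivative (\<lambda>_. 0)) (at u)"
      by (rule has_derivative_transform_within_open[of "\<lambda>_. 0" _ _ _ U])
         (use c chart_open normal_orthogonal in auto)
    ultimately have "(\<lambda>v. lorentz (\<nu> (\<phi> u)) (frechet_derivative (\<lambda>y. D \<phi> y w) (at u) v) + lorentz (Dn \<phi> u v) (D \<phi> u w)) = (\<lambda>_. 0)"
      by (rule has_derivative_unique)
    from fun_cong[OF this, of v] show ?thesis by simp
  qed
  show ?thesis
    unfolding key using symmetric_second_derivative[OF chart_open[OF c(1)] c(2), of \<phi> v w] chart_Ck[OF c(1)] by simp
qed

text \<open>Two charts with the same point and the same tangent vector give the same derivative of
  the normal, by the chain rule for the transition map and injectivity of the chart derivative. This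
  resolves the \<open>THE\<close> in the definition.\<close>

lemma shape_operator_chart:
  assumes c: "local_param \<Sigma> U \<phi>" "u \<in> U"
  shows "shape_operator \<Sigma> \<nu> (\<phi> u) (D \<phi> u w) = Dn \<phi> u w"
  unfolding shape_operator_def
proof (rule the_equality)
  show "\<exists>U' \<phi>' u' w'. local_param \<Sigma> U' \<phi>' \<and> u' \<in> U' \<and> \<phi>' u' = \<phi> u \<and>
     D \<phi>' u' w' = D \<phi> u w \<and> Dn \<phi>' u' w' = Dn \<phi> u w" using c by blast
  fix s assume "\<exists>U' \<phi>' u' w'. local_param \<Sigma> U' \<phi>' \<and> u' \<in> U' \<and> \<phi>' u' = \<phi> u \<and>
     D \<phi>' u' w' = D \<phi> u w \<and> Dn \<phi>' u' w' = s"
  then obtain U' \<phi>' u' w' where c': "local_param \<Sigma> U' \<phi>'" "u' \<in> U'" "\<phi>' u' = \<phi> u"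
    "D \<phi>' u' w' = D \<phi> u w" "Dn \<phi>' u' w' = s" by blast
  obtain \<tau> \<sigma> T where t: "homeomorphism {u \<in> U. \<phi> u \<in> \<phi>' ` U'} {u \<in> U'. \<phi>' u \<in> \<phi> ` U} \<tau> \<sigma>"
    "\<And>u. u \<in> {u \<in> U. \<phi> u \<in> \<phi>' ` U'} \<Longrightarrow> \<phi>' (\<tau> u) = \<phi> u"
    "\<And>u. u \<in> {u \<in> U. \<phi> u \<in> \<phi>' ` U'} \<Longrightarrow> (\<tau> has_derivative T u) (at u)"
    "\<And>u v. u \<in> {u \<in> U. \<phi> u \<in> \<phi>' ` U'} \<Longrightarrow> D \<phi>' (\<tau> u) (T u v) = D \<phi> u v"
    by (rule chart_transition[OF c(1) c'(1)]) blast
  have u: "u \<in> {u \<in> U. \<phi> u \<in> \<phi>' ` U'}" using c c' by (auto intro: rev_image_eqI)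
  then have "\<tau> u \<in> U'" using homeomorphism_image1[OF t(1)] by blast
  then have tu: "\<tau> u = u'" using inj_onD[OF chart_inj_on[OF c'(1)]] t(2)[OF u] c' by auto
  have "D \<phi>' u' (T u w) = D \<phi>' u' w'" using t(4)[OF u] tu c' by simp
  then have Tw: "T u w = w'" using chart_inj[OF c'(1,2)] by (simp add: inj_eq)
  have "((\<lambda>y. (\<nu> \<circ> \<phi>') (\<tau> y)) has_derivative (\<lambda>v. Dn \<phi>' u' (T u v))) (at u)"
    using has_derivative_compose[OF t(3)[OF u]] normal_deriv[OF c'(1,2)] tu by blast
  then have "((\<nu> \<circ> \<phi>) has_derivative (\<lambda>v. Dn \<phi>' u' (T u v))) (at u)"
    by (rule has_derivative_transform_within_open[OF _ chart_preimage_open[OF c(1) c'(1)] u]) (simp add: t(2))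
  then have "(\<lambda>v. Dn \<phi>' u' (T u v)) = Dn \<phi> u" using normal_deriv[OF c] by (rule has_derivative_unique)
  from fun_cong[OF this, of w] show "s = Dn \<phi> u w" using Tw c' by simp
qed

lemma principal_curvatures_exist:
  assumes x: "x \<in> \<Sigma>"
  obtains es where "length es = length (principal_curvatures \<Sigma> \<nu> x)" "span (set es) = tangent_space \<Sigma> x"
    "\<And>i j. i < length es \<Longrightarrow> j < length es \<Longrightarrow> lorentz (es ! i) (es ! j) = (if i = j then 1 else 0)"
    "\<And>i. i < length es \<Longrightarrow> shape_operator \<Sigma> \<nu> x (es ! i) = (principal_curvatures \<Sigma> \<nu> x ! i) *\<^sub>R (es ! i)"
proof -
  obtain U \<phi> u where c: "local_param \<Sigma> U \<phi>" "u \<in> U" "\<phi> u = x" using chart_exists[OF x] by auto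
  let ?T = "tangent_space \<Sigma> x"
  have T: "?T = range (D \<phi> u)" using tangent_space_range[OF c(1,2)] c(3) by simp
  obtain L where L: "linear L" "L \<circ> D \<phi> u = id"
    using linear_injective_left_inverse[OF chart_linear[OF c(1,2)] chart_inj[OF c(1,2)]] by blast
  have L1: "L (D \<phi> u w) = w" for w using L(2) by (metis comp_apply id_apply)
  \<comment> \<open>The left inverse \<open>L\<close> extends the shape operator to a linear map of
    the whole ambient space, the form in which \<open>spectral_theorem_form\<close> expects an
    operator.\<close>
  define A where "A = Dn \<phi> u \<circ> L"
  have AD: "A (D \<phi> u w) = Dn \<phi> u w" for w by (simp add: A_def L1)
  have AS: "shape_operator \<Sigma> \<nu> x y = A y" if "y \<in> ?T" for y
    using that T AD shape_operator_chart[OF c(1,2)] c(3) by auto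
  have "\<exists>es ks. length es = length ks \<and> sorted ks \<and> span (set es) = ?T \<and>
     (\<forall>i<length es. \<forall>j<length es. lorentz (es ! i) (es ! j) = (if i = j then 1 else 0)) \<and>
     (\<forall>i<length es. A (es ! i) = (ks ! i) *\<^sub>R (es ! i))"
  proof (rule spectral_theorem_form[OF bounded_bilinear_lorentz lorentz_commute])
    show "linear A" unfolding A_def using L(1) normal_deriv_linear[OF c(1,2)] linear_compose by blast
    show "subspace ?T" unfolding T using linear_subspace_image[OF chart_linear[OF c(1,2)] subspace_UNIV] .
    show "lorentz v v > 0" if "v \<in> ?T" "v \<noteq> 0" for v
      using that lorentz_tangent_pos[OF on_hyperboloid(2)[OF x], of v] tangent_space_eq[OF x] by force
    show "A v \<in> ?T" if "v \<in> ?T" for v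
      using that normal_deriv_orthogonal[OF c(1,2)] c(3) AD T tangent_space_eq[OF x] by auto
    show "lorentz (A v) w = lorentz v (A w)" if "v \<in> ?T" "w \<in> ?T" for v w
      using that normal_deriv_self_adjoint[OF c(1,2)] AD T by (auto simp: lorentz_commute)
  qed
  then obtain es ks where k: "length es = length ks" "sorted ks" "span (set es) = ?T"
     "\<forall>i<length es. \<forall>j<length es. lorentz (es ! i) (es ! j) = (if i = j then 1 else 0)"
     "\<forall>i<length es. A (es ! i) = (ks ! i) *\<^sub>R (es ! i)" by blast
  have "shape_operator \<Sigma> \<nu> x (es ! i) = (ks ! i) *\<^sub>R (es ! i)" if "i < length es" for i
  proof -
    have "es ! i \<in> ?T" using k(3) that by (metis nth_mem span_base)
    then show ?thesis using AS k(5) that by simp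
  qed
  then have "\<exists>ks. sorted ks \<and>
        (\<exists>es. length es = length ks \<and> span (set es) = tangent_space \<Sigma> x \<and>
          (\<forall>i<length es. \<forall>j<length es. lorentz (es ! i) (es ! j) = (if i = j then 1 else 0)) \<and>
          (\<forall>i<length es. shape_operator \<Sigma> \<nu> x (es ! i) = (ks ! i) *\<^sub>R (es ! i)))"
    using k by blast
  from someI_ex[OF this] show ?thesis using that unfolding principal_curvatures_def[symmetric] by blast
qed

end

subsection \<open>Elementary symmetric polynomials\<close>

text \<open>The index set is a parameter because the eigenvalues of the Newton tensors are symmetric
  functions with one index deleted.\<close>

definition esym :: "'b set \<Rightarrow> nat \<Rightarrow> ('b \<Rightarrow> real) \<Rightarrow> real" where
  "esym A j f = (\<Sum>I | I \<subseteq> A \<and> card I = j. \<Prod>i\<in>I. f i)"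

lemma prod_one_plus_esym:
  fixes t :: real
  assumes "finite A"
  shows "(\<Prod>i\<in>A. 1 + t * f i) = (\<Sum>j\<le>card A. esym A j f * t ^ j)"
proof -
  have "(\<Prod>i\<in>A. 1 + t * f i) = (\<Prod>i\<in>A. t * f i + 1)" by (simp add: add.commute)
  also have "\<dots> = (\<Sum>I\<in>Pow A. (\<Prod>i\<in>I. t * f i) * (\<Prod>i\<in>A - I. 1))" by (rule prod_add[OF assms])
  also have "\<dots> = (\<Sum>I\<in>Pow A. (\<Prod>i\<in>I. f i) * t ^ card I)"
    by (simp add: prod.distrib mult.commute)
  also have "\<dots> = (\<Sum>j\<le>card A. \<Sum>I\<in>{I \<in> Pow A. card I = j}. (\<Prod>i\<in>I. f i) * t ^ card I)"
    by (rule sum.group[symmetric]) (use assms card_mono in auto)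
  also have "\<dots> = (\<Sum>j\<le>card A. esym A j f * t ^ j)"
    unfolding esym_def by (intro sum.cong refl) (simp add: sum_distrib_right)
  finally show ?thesis .
qed

lemma esym_nonneg: "(\<And>i. i \<in> A \<Longrightarrow> f i \<ge> 0) \<Longrightarrow> esym A j f \<ge> 0"
  unfolding esym_def by (intro sum_nonneg prod_nonneg) auto

lemma esym_eq_0:
  assumes "finite A" "card A < j"
  shows "esym A j f = 0"
proof -
  have "\<not> (I \<subseteq> A \<and> card I = j)" for I using card_mono[OF assms(1), of I] assms(2) by auto
  then have "{I. I \<subseteq> A \<and> card I = j} = {}" by blast
  then show ?thesis by (simp only: esym_def sum.empty)
qed

lemma elem_sym_esym: "elem_sym j ks = esym {..<length ks} j (\<lambda>i. ks ! i)"
  by (simp add: elem_sym_def esym_def)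

lemma esym_reindex:
  assumes h: "bij_betw h A B"
  shows "esym A j (\<lambda>i. f (h i)) = esym B j f"
proof -
  have inj: "inj_on h A" using h by (simp add: bij_betw_def)
  have "bij_betw (image h) {I. I \<subseteq> A \<and> card I = j} {I. I \<subseteq> B \<and> card I = j}"
    unfolding bij_betw_def
  proof
    show "inj_on (image h) {I. I \<subseteq> A \<and> card I = j}"
      using inj_on_image_eq_iff[OF inj] by (auto simp: inj_on_def)
    have "J \<in> image h ` {I. I \<subseteq> A \<and> card I = j}" if J: "J \<subseteq> B" "card J = j" for J
    proof -
      obtain I where "I \<subseteq> A" "J = h ` I" using J(1) h by (auto simp: bij_betw_def subset_image_iff)
      moreover have "card (h ` I) = card I" using card_image inj_on_subset[OF inj] calculation(1) by blast
      ultimately show ?thesis using J by auto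
    qed
    moreover have "h ` I \<subseteq> B \<and> card (h ` I) = j" if "I \<subseteq> A" "card I = j" for I
      using that h card_image[OF inj_on_subset[OF inj]] by (auto simp: bij_betw_def)
    ultimately show "image h ` {I. I \<subseteq> A \<and> card I = j} = {I. I \<subseteq> B \<and> card I = j}" by blast
  qed
  then have "esym B j f = (\<Sum>I | I \<subseteq> A \<and> card I = j. \<Prod>i\<in>h ` I. f i)"
    unfolding esym_def by (intro sum.reindex_bij_betw[symmetric])
  also have "\<dots> = esym A j (\<lambda>i. f (h i))"
    unfolding esym_def by (intro sum.cong refl) (simp add: prod.reindex[OF inj_on_subset[OF inj]])
  finally show ?thesis ..
qed

text \<open>Both sides are the derivative in \<open>t\<close> of the product of all
  \<open>1 + t * \<kappa> i\<close>, by the product rule and term by term. The top summand on the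
  right is zero; it is kept so that all generating functions run over the same degrees.\<close>

lemma esym_derivative:
  fixes \<kappa> :: "'m::finite \<Rightarrow> real"
  shows "(\<Sum>i\<in>UNIV. \<kappa> i * (\<Prod>l\<in>UNIV - {i}. 1 + t * \<kappa> l))
       = (\<Sum>j\<le>CARD('m). real (Suc j) * esym UNIV (Suc j) \<kappa> * t ^ j)"
proof -
  let ?e = "\<lambda>j. esym UNIV j \<kappa>"
  have "((\<lambda>t. \<Prod>i\<in>UNIV. 1 + t * \<kappa> i) has_real_derivative
      (\<Sum>i\<in>UNIV. \<kappa> i * (\<Prod>l\<in>UNIV - {i}. 1 + t * \<kappa> l))) (at t)"
    by (rule has_field_derivative_prod) (auto intro!: derivative_eq_intros)
  moreover have "((\<lambda>t. \<Sum>j\<le>CARD('m). ?e j * t ^ j) has_real_derivative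
      (\<Sum>j\<le>CARD('m). ?e j * (real j * t ^ (j - 1)))) (at t)"
    by (auto intro!: derivative_eq_intros sum.cong)
  ultimately have "(\<Sum>i\<in>UNIV. \<kappa> i * (\<Prod>l\<in>UNIV - {i}. 1 + t * \<kappa> l)) = (\<Sum>j\<le>CARD('m). ?e j * (real j * t ^ (j - 1)))"
    unfolding prod_one_plus_esym[OF finite] by (rule DERIV_unique)
  also have "\<dots> = (\<Sum>j\<le>Suc (CARD('m)). ?e j * (real j * t ^ (j - 1)))" by (simp add: esym_eq_0)
  also have "\<dots> = (\<Sum>j\<le>CARD('m). real (Suc j) * ?e (Suc j) * t ^ j)"
    by (subst sum.atMost_Suc_shift) (simp add: mult_ac)
  finally show ?thesis .
qed

text \<open>Each deleted product is the full product minus \<open>t * \<kappa> i\<close> times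
  itself; summing over \<open>i\<close> reduces the claim to \<open>esym_derivative\<close>.\<close>

lemma esym_deleted_sum:
  fixes \<kappa> :: "'m::finite \<Rightarrow> real"
  shows "(\<Sum>i\<in>UNIV. \<Prod>l\<in>UNIV - {i}. 1 + t * \<kappa> l)
       = (\<Sum>j\<le>CARD('m). (real (CARD('m)) - real j) * esym UNIV j \<kappa> * t ^ j)"
proof -
  let ?e = "\<lambda>j. esym UNIV j \<kappa>" and ?P = "\<lambda>i. \<Prod>l\<in>UNIV - {i}. 1 + t * \<kappa> l"
  have P: "?P i = (\<Prod>l\<in>UNIV. 1 + t * \<kappa> l) - t * (\<kappa> i * ?P i)" for i
    by (subst prod.remove[of UNIV i]) (auto simp: algebra_simps)
  have "(\<Sum>i\<in>UNIV. ?P i) = (\<Sum>i\<in>UNIV. (\<Prod>l\<in>UNIV. 1 + t * \<kappa> l) - t * (\<kappa> i * ?P i))"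
    using P by (intro sum.cong) auto
  also have "\<dots> = real (CARD('m)) * (\<Prod>l\<in>UNIV. 1 + t * \<kappa> l) - t * (\<Sum>i\<in>UNIV. \<kappa> i * ?P i)"
    by (simp add: sum_subtractf sum_distrib_left)
  also have "t * (\<Sum>i\<in>UNIV. \<kappa> i * ?P i) = (\<Sum>j\<le>CARD('m). real j * ?e j * t ^ j)"
  proof -
    have "t * (\<Sum>i\<in>UNIV. \<kappa> i * ?P i) = (\<Sum>j\<le>CARD('m). real (Suc j) * ?e (Suc j) * t ^ Suc j)"
      unfolding esym_derivative by (simp add: sum_distrib_left mult_ac)
    also have "\<dots> = (\<Sum>j\<le>Suc (CARD('m)). real j * ?e j * t ^ j)"
      by (subst sum.atMost_Suc_shift) simp
    also have "\<dots> = (\<Sum>j\<le>CARD('m). real j * ?e j * t ^ j)" by (simp add: esym_eq_0)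
    finally show ?thesis .
  qed
  finally show ?thesis
    by (simp add: prod_one_plus_esym sum_distrib_left sum_subtractf[symmetric] algebra_simps)
qed

subsection \<open>Principal frames\<close>

text \<open>Independent rows would span, so \<open>n\<close> would be a combination of vectors
  orthogonal to it and hence null.\<close>

lemma vdet_orthogonal_rows:
  assumes "\<And>i. lorentz n (f i) = 0" "lorentz n n \<noteq> 0"
  shows "vdet f = 0"
proof (rule ccontr)
  assume "vdet f \<noteq> 0"
  then obtain c where n: "n = (\<Sum>i\<in>UNIV. c i *\<^sub>R f i)" using vdet_spans by blast
  have "lorentz n (\<Sum>i\<in>UNIV. c i *\<^sub>R f i) = (\<Sum>i\<in>UNIV. c i * lorentz n (f i))"
    by (simp add: lorentz.sum_right lorentz.scaleR_right)
  then have "lorentz n n = (\<Sum>i\<in>UNIV. c i * lorentz n (f i))" using n by simp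
  then show False using assms by simp
qed

lemma vdet_frame_scale: "vdet (frame n x (\<lambda>i. c i *\<^sub>R e i)) = (\<Prod>i\<in>UNIV. c i) * vdet (frame n x e)"
proof -
  have "(\<Sum>j\<in>UNIV. (if i = j then c i else 0) *\<^sub>R e j) = (\<Sum>j\<in>UNIV. if j = i then c i *\<^sub>R e j else 0)" for i
    by (rule sum.cong) auto
  then have "(\<lambda>i. c i *\<^sub>R e i) = (\<lambda>i. \<Sum>j\<in>UNIV. (if i = j then c i else 0) *\<^sub>R e j)" by simp
  then have "vdet (frame n x (\<lambda>i. c i *\<^sub>R e i)) = det (\<chi> i j. if i = j then c i else 0) * vdet (frame n x e)"
    by (simp add: vdet_frame_expand)
  also have "det (\<chi> i j. if i = j then c i else 0) = (\<Prod>i\<in>UNIV. c i)"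
    by (subst det_diagonal) auto
  finally show ?thesis .
qed

lemma frame_upd: "(frame n x w)(Some (Some i) := b) = frame n x (w(i := b))"
  by (auto simp: fun_eq_iff frame_def split: option.split)

lemma vdet_frame_scaleR: "vdet (frame n x (w(i := r *\<^sub>R b))) = r * vdet (frame n x (w(i := b)))"
  unfolding frame_upd[symmetric] by (rule vdet_upd_scaleR)

lemma frame_None_upd: "(frame n x w)(None := b) = frame b x w"
  by (auto simp: fun_eq_iff frame_def split: option.split)

lemma frame_Some_None_upd: "(frame n x w)(Some None := b) = frame n b w"
  by (auto simp: fun_eq_iff frame_def split: option.split)

text \<open>
  This is the derivative at \<open>s = 0\<close> of the expansion \<open>vdet_frame_expand\<close> for the vectors \<open>d j + s b j\<close>.
\<close>

lemma vdet_frame_derivation: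
  fixes d b :: "'m::finite \<Rightarrow> 'm minkowski"
  shows "(\<Sum>i\<in>UNIV. vdet (frame n x ((\<lambda>i. \<Sum>j\<in>UNIV. C i j *\<^sub>R d j)(i := \<Sum>j\<in>UNIV. C i j *\<^sub>R b j))))
       = det (\<chi> i j. C i j) * (\<Sum>j\<in>UNIV. vdet (frame n x (d(j := b j))))"
proof -
  have der: "((\<lambda>s. vdet (frame n x (\<lambda>i. p i + s *\<^sub>R q i))) has_derivative
      (\<lambda>h. h * (\<Sum>i\<in>UNIV. vdet (frame n x (p(i := q i)))))) (at 0)" for p q :: "'m \<Rightarrow> 'm minkowski"
  proof -
    define f where "f i s = frame n x (\<lambda>i. p i + s *\<^sub>R q i) i" for i and s :: real
    define f' where "f' i h = frame 0 0 (\<lambda>i. h *\<^sub>R q i) i" for i and h :: real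
    have "(f i has_derivative f' i) (at 0)" for i
    proof (cases "i = None \<or> i = Some None")
      case True
      then show ?thesis by (auto simp: f_def[abs_def] f'_def[abs_def])
    next
      case False
      then obtain j where "i = Some (Some j)" by (cases i; cases "the i") auto
      then show ?thesis by (auto simp: f_def[abs_def] f'_def[abs_def] intro!: derivative_eq_intros)
    qed
    then have "((\<lambda>s. vdet (\<lambda>i. f i s)) has_derivative (\<lambda>h. \<Sum>k\<in>UNIV. vdet ((\<lambda>j. f j 0)(k := f' k h)))) (at 0)"
      by (rule has_derivative_vdet)
    moreover have "(\<lambda>j. f j 0) = frame n x p" by (simp add: f_def frame_def fun_eq_iff split: option.split)
    moreover have "vdet ((frame n x p)(k := 0)) = 0" for k
      using linear_0[OF linear_vdet_upd] .
    ultimately show ?thesis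
      by (simp add: sum_option f'_def vdet_frame_scaleR frame_upd sum_distrib_left f_def[abs_def])
  qed
  let ?d = "\<lambda>i. \<Sum>j\<in>UNIV. C i j *\<^sub>R d j" and ?b = "\<lambda>i. \<Sum>j\<in>UNIV. C i j *\<^sub>R b j"
  have eq: "vdet (frame n x (\<lambda>i. ?d i + s *\<^sub>R ?b i)) = det (\<chi> i j. C i j) * vdet (frame n x (\<lambda>j. d j + s *\<^sub>R b j))" for s
  proof -
    have "(\<lambda>i. ?d i + s *\<^sub>R ?b i) = (\<lambda>i. \<Sum>j\<in>UNIV. C i j *\<^sub>R (d j + s *\<^sub>R b j))"
      by (simp add: scaleR_sum_right sum.distrib[symmetric] algebra_simps)
    then show ?thesis by (simp add: vdet_frame_expand)
  qed
  have "((\<lambda>s. det (\<chi> i j. C i j) * vdet (frame n x (\<lambda>j. d j + s *\<^sub>R b j))) has_derivative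
      (\<lambda>h. det (\<chi> i j. C i j) * (h * (\<Sum>j\<in>UNIV. vdet (frame n x (d(j := b j))))))) (at 0)"
    by (intro has_derivative_mult_right der)
  from has_derivative_unique[OF der[of ?d ?b, unfolded eq] this]
  have "1 * (\<Sum>i\<in>UNIV. vdet (frame n x (?d(i := ?b i)))) =
     det (\<chi> i j. C i j) * (1 * (\<Sum>j\<in>UNIV. vdet (frame n x (d(j := b j)))))" by (rule fun_cong)
  then show ?thesis by simp
qed

context oriented_hypersurface
begin

text \<open>The sorted list of principal curvatures is moved to the index type \<open>'m\<close>, so
  that principal directions can be used as rows of a \<open>frame\<close>. The last two clauses
  record that symmetric functions and the set of values are unaffected.\<close>

definition principal_frame :: "'m minkowski \<Rightarrow> ('m \<Rightarrow> 'm minkowski) \<Rightarrow> ('m \<Rightarrow> real) \<Rightarrow> bool" where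
  "principal_frame x e \<kappa> \<longleftrightarrow>
     (\<forall>i j. lorentz (e i) (e j) = (if i = j then 1 else 0)) \<and>
     (\<forall>i. e i \<in> tangent_space \<Sigma> x \<and> shape_operator \<Sigma> \<nu> x (e i) = \<kappa> i *\<^sub>R e i) \<and>
     (\<forall>y\<in>tangent_space \<Sigma> x. y = (\<Sum>i\<in>UNIV. lorentz y (e i) *\<^sub>R e i)) \<and>
     (\<forall>j. elem_sym j (principal_curvatures \<Sigma> \<nu> x) = esym UNIV j \<kappa>) \<and>
     range \<kappa> = set (principal_curvatures \<Sigma> \<nu> x)"

text \<open>An orthonormal list is independent, so its length is the dimension of the tangent space,
  which is \<open>CARD('m)\<close> by injectivity of a chart derivative. A bijection of
  \<open>'m\<close> with list positions then does the relabelling.\<close>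

lemma principal_frame_exists:
  assumes x: "x \<in> \<Sigma>"
  shows "\<exists>e \<kappa>. principal_frame x e \<kappa>"
proof -
  let ?ks = "principal_curvatures \<Sigma> \<nu> x"
  obtain es where es: "length es = length ?ks" "span (set es) = tangent_space \<Sigma> x"
    "\<And>i j. i < length es \<Longrightarrow> j < length es \<Longrightarrow> lorentz (es ! i) (es ! j) = (if i = j then 1 else 0)"
    "\<And>i. i < length es \<Longrightarrow> shape_operator \<Sigma> \<nu> x (es ! i) = (?ks ! i) *\<^sub>R (es ! i)"
    using principal_curvatures_exist[OF x] by blast
  obtain U \<phi> u where c: "local_param \<Sigma> U \<phi>" "u \<in> U" "\<phi> u = x" using chart_exists[OF x] by auto
  have dist: "distinct es"
    unfolding distinct_conv_nth
  proof (intro allI impI)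
    fix i j assume "i < length es" "j < length es" "i \<noteq> j"
    then have "lorentz (es ! i) (es ! j) = 0" "lorentz (es ! i) (es ! i) = 1" using es(3) by auto
    then show "es ! i \<noteq> es ! j" by force
  qed
  have exp: "y = (\<Sum>i<length es. lorentz y (es ! i) *\<^sub>R es ! i)" if "y \<in> span (set es)" for y
  proof -
    let ?Q = "\<lambda>y. y = (\<Sum>i<length es. lorentz y (es ! i) *\<^sub>R es ! i)"
    have "?Q (c *\<^sub>R a + b)" if a: "a \<in> set es" and b: "?Q b" for a b and c :: real
    proof -
      obtain k where k: "k < length es" "a = es ! k" using a by (metis in_set_conv_nth)
      have "(\<Sum>i<length es. lorentz a (es ! i) *\<^sub>R es ! i) = (\<Sum>i<length es. if i = k then es ! i else 0)"
        by (rule sum.cong) (use k es(3) in auto)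
      then have "(\<Sum>i<length es. lorentz a (es ! i) *\<^sub>R es ! i) = a" using k by simp
      moreover have "(\<Sum>i<length es. lorentz (c *\<^sub>R a + b) (es ! i) *\<^sub>R es ! i)
          = c *\<^sub>R (\<Sum>i<length es. lorentz a (es ! i) *\<^sub>R es ! i) + (\<Sum>i<length es. lorentz b (es ! i) *\<^sub>R es ! i)"
        by (simp add: lorentz.add_left lorentz.scaleR_left scaleR_sum_right sum.distrib algebra_simps)
      ultimately show ?thesis using b by simp
    qed
    moreover have "?Q 0"
    proof -
      have "lorentz 0 (es ! i) = 0" for i by (rule lorentz.zero_left)
      then show ?thesis by simp
    qed
    ultimately show ?thesis using span_induct_alt[OF that, of ?Q] by blast
  qed
  have ind: "independent (set es)"
  proof (rule independent_if_scalars_zero)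
    fix f a assume s: "(\<Sum>y\<in>set es. f y *\<^sub>R y) = 0" and a: "a \<in> set es"
    obtain k where k: "k < length es" "a = es ! k" using a by (metis in_set_conv_nth)
    have "lorentz y a = (if y = a then 1 else 0)" if "y \<in> set es" for y
    proof -
      obtain i where "i < length es" "y = es ! i" using \<open>y \<in> set es\<close> by (metis in_set_conv_nth)
      then show ?thesis using k es(3) dist by (auto simp: nth_eq_iff_index_eq)
    qed
    then have "(\<Sum>y\<in>set es. f y * lorentz y a) = (\<Sum>y\<in>set es. if y = a then f y else 0)"
      by (intro sum.cong) auto
    also have "\<dots> = f a" using a by simp
    finally have "f a = lorentz (\<Sum>y\<in>set es. f y *\<^sub>R y) a"
      by (simp add: lorentz.sum_left lorentz.scaleR_left)
    then show "f a = 0" using s by (simp add: lorentz.zero_left)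
  qed simp
  have "length es = dim (span (set es))"
    using dim_span_eq_card_independent[OF ind] distinct_card[OF dist] by simp
  also have "\<dots> = dim (range (D \<phi> u))" using es(2) tangent_space_range[OF c(1,2)] c(3) by simp
  also have "\<dots> = CARD('m)"
    using dim_image_eq[OF chart_linear[OF c(1,2)], of UNIV] chart_inj[OF c(1,2)] by simp
  finally have len: "length es = CARD('m)" .
  obtain h where h: "bij_betw h (UNIV :: 'm set) {..<CARD('m)}"
    using ex_bij_betw_finite_nat[of "UNIV :: 'm set"] by (auto simp: atLeast0LessThan)
  have hl: "h i < length es" for i using h len by (auto simp: bij_betw_def)
  have hi: "h i = h j \<longleftrightarrow> i = j" for i j using h by (auto simp: bij_betw_def inj_def)
  define e where "e i = es ! h i" for i
  define \<kappa> where "\<kappa> i = ?ks ! h i" for i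
  have "principal_frame x e \<kappa>"
    unfolding principal_frame_def
  proof (intro conjI allI ballI)
    show "lorentz (e i) (e j) = (if i = j then 1 else 0)" for i j using es(3) hl hi by (simp add: e_def)
    show "shape_operator \<Sigma> \<nu> x (e i) = \<kappa> i *\<^sub>R e i" for i using es(4) hl by (simp add: e_def \<kappa>_def)
    show "e i \<in> tangent_space \<Sigma> x" for i using es(2) hl by (metis e_def nth_mem span_base)
    show "y = (\<Sum>i\<in>UNIV. lorentz y (e i) *\<^sub>R e i)" if "y \<in> tangent_space \<Sigma> x" for y
      using exp[of y] that es(2) sum.reindex_bij_betw[OF h, of "\<lambda>i. lorentz y (es ! i) *\<^sub>R es ! i"]
      by (simp add: e_def len)
    show "elem_sym j ?ks = esym UNIV j \<kappa>" for j
      using esym_reindex[OF h, of j "\<lambda>i. ?ks ! i"] es(1) len by (simp add: elem_sym_esym \<kappa>_def[abs_def])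
    show "range \<kappa> = set ?ks"
    proof -
      have "range \<kappa> = (\<lambda>i. ?ks ! i) ` {..<length ?ks}"
        using h es(1) len by (simp add: \<kappa>_def[abs_def] bij_betw_def image_image[symmetric])
      then show ?thesis by (auto simp: set_conv_nth)
    qed
  qed
  then show ?thesis by blast
qed

definition pe :: "'m minkowski \<Rightarrow> 'm \<Rightarrow> 'm minkowski" where
  "pe x = fst (SOME p. principal_frame x (fst p) (snd p))"

definition pk :: "'m minkowski \<Rightarrow> 'm \<Rightarrow> real" where
  "pk x = snd (SOME p. principal_frame x (fst p) (snd p))"

lemma principal_frame:
  assumes "x \<in> \<Sigma>"
  shows "principal_frame x (pe x) (pk x)"
proof -
  have "\<exists>p. principal_frame x (fst p) (snd p)" using principal_frame_exists[OF assms] by auto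
  from someI_ex[OF this] show ?thesis unfolding pe_def pk_def .
qed

lemma principal_frame_facts:
  assumes x: "x \<in> \<Sigma>"
  shows "lorentz (pe x i) (pe x j) = (if i = j then 1 else 0)"
    and "pe x i \<in> tangent_space \<Sigma> x" and "shape_operator \<Sigma> \<nu> x (pe x i) = pk x i *\<^sub>R pe x i"
    and "y \<in> tangent_space \<Sigma> x \<Longrightarrow> y = (\<Sum>i\<in>UNIV. lorentz y (pe x i) *\<^sub>R pe x i)"
    and "elem_sym k (principal_curvatures \<Sigma> \<nu> x) = esym UNIV k (pk x)"
    and "range (pk x) = set (principal_curvatures \<Sigma> \<nu> x)"
    and "lorentz (\<nu> x) (pe x i) = 0" and "lorentz x (pe x i) = 0"
  using principal_frame[OF x] tangent_space_eq[OF x] unfolding principal_frame_def by blast+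

text \<open>One matrix \<open>C\<close> expresses the derivatives of both \<open>\<phi>\<close> and
  the normal in a principal frame. The last clause asks for linearity after composition with the
  chart derivative only, because functionals \<open>L\<close> will be meaningful on tangent vectors
  alone.\<close>

lemma frame_transition:
  assumes c: "local_param \<Sigma> U \<phi>" "u \<in> U"
  obtains C where "\<And>i. pd \<phi> u i = (\<Sum>j\<in>UNIV. C i j *\<^sub>R pe (\<phi> u) j)"
    and "\<And>i. Dn \<phi> u (axis i 1) = (\<Sum>j\<in>UNIV. C i j *\<^sub>R (pk (\<phi> u) j *\<^sub>R pe (\<phi> u) j))"
    and "\<And>L i. linear (\<lambda>v. L (D \<phi> u v)) \<Longrightarrow> L (pd \<phi> u i) = (\<Sum>j\<in>UNIV. C i j * (L (pe (\<phi> u) j) :: real))"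
proof -
  have x: "\<phi> u \<in> \<Sigma>" using chart_mem[OF c] .
  have "\<exists>w. D \<phi> u w = pe (\<phi> u) i" for i
    using principal_frame_facts(2)[OF x] tangent_space_range[OF c] by (metis rangeE)
  then obtain w where w: "\<And>i. D \<phi> u (w i) = pe (\<phi> u) i" by metis
  define C where "C i j = lorentz (pd \<phi> u i) (pe (\<phi> u) j)" for i j
  have P: "pd \<phi> u i = (\<Sum>j\<in>UNIV. C i j *\<^sub>R pe (\<phi> u) j)" for i
    unfolding C_def by (rule principal_frame_facts(4)[OF x deriv_tangent[OF c]])
  have "D \<phi> u (\<Sum>j\<in>UNIV. C i j *\<^sub>R w j) = D \<phi> u (axis i 1)" for i
    unfolding P by (simp add: linear_sum[OF chart_linear[OF c]] linear_scale[OF chart_linear[OF c]] w)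
  then have ax: "axis i 1 = (\<Sum>j\<in>UNIV. C i j *\<^sub>R w j)" for i
    using chart_inj[OF c] by (simp add: inj_eq)
  have Dw: "Dn \<phi> u (w i) = pk (\<phi> u) i *\<^sub>R pe (\<phi> u) i" for i
    using shape_operator_chart[OF c, of "w i"] principal_frame_facts(3)[OF x] w by simp
  show ?thesis
  proof (rule that[of C])
    show "pd \<phi> u i = (\<Sum>j\<in>UNIV. C i j *\<^sub>R pe (\<phi> u) j)" for i by (rule P)
    show "Dn \<phi> u (axis i 1) = (\<Sum>j\<in>UNIV. C i j *\<^sub>R (pk (\<phi> u) j *\<^sub>R pe (\<phi> u) j))" for i
      unfolding ax by (simp add: linear_sum[OF normal_deriv_linear[OF c]] linear_scale[OF normal_deriv_linear[OF c]] Dw)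
    show "L (pd \<phi> u i) = (\<Sum>j\<in>UNIV. C i j * L (pe (\<phi> u) j))" if L: "linear (\<lambda>v. L (D \<phi> u v))" for L :: "'m minkowski \<Rightarrow> real" and i
      using linear_sum[OF L, of "\<lambda>j. C i j *\<^sub>R w j" UNIV] by (simp add: ax linear_scale[OF L] w)
  qed
qed

definition E :: "real \<Rightarrow> 'm minkowski \<Rightarrow> real" where
  "E t x = (\<Prod>i\<in>UNIV. 1 + t * pk x i)"

text \<open>The eigenvalue of the cofactor operator of \<open>id + t A\<close> on the
  \<open>i\<close>-th principal direction; \<open>E\<close> is the determinant of
  \<open>id + t A\<close>.\<close>

definition Ed :: "real \<Rightarrow> 'm minkowski \<Rightarrow> 'm \<Rightarrow> real" where
  "Ed t x i = (\<Prod>l\<in>UNIV - {i}. 1 + t * pk x l)"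

abbreviation Y :: "real \<Rightarrow> (real^'m \<Rightarrow> 'm minkowski) \<Rightarrow> real^'m \<Rightarrow> 'm \<Rightarrow> 'm minkowski" where
  "Y t \<phi> u i \<equiv> pd \<phi> u i + t *\<^sub>R Dn \<phi> u (axis i 1)"

definition v0 :: "'m minkowski \<Rightarrow> real" where
  "v0 x = vdet (frame (\<nu> x) x (pe x))"

text \<open>The other components of \<open>b\<close> are parallel to a row that is already present,
  so only the component along the \<open>j\<close>-th principal direction contributes.\<close>

lemma vdet_principal_replace:
  assumes x: "x \<in> \<Sigma>"
  shows "vdet (frame (\<nu> x) x ((\<lambda>l. (1 + t * pk x l) *\<^sub>R pe x l)(j := b))) = lorentz b (pe x j) * Ed t x j * v0 x"
proof -
  let ?d = "\<lambda>l. (1 + t * pk x l) *\<^sub>R pe x l"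
  let ?F = "frame (\<nu> x) x ?d" and ?j = "Some (Some j)"
  define g where "g b = vdet (?F(?j := b))" for b
  have lin: "linear g" unfolding g_def[abs_def] by (rule linear_vdet_upd)
  have g\<nu>: "g (\<nu> x) = 0" unfolding g_def by (rule vdet_equal_rows[of None ?j]) auto
  have gx: "g x = 0" unfolding g_def by (rule vdet_equal_rows[of "Some None" ?j]) auto
  have gl: "g (pe x l) = 0" if "l \<noteq> j" for l
  proof -
    have upd: "?F(?j := pe x l) = (?F(?j := pe x l))(Some (Some l) := (1 + t * pk x l) *\<^sub>R pe x l)"
      using that by (auto simp: fun_eq_iff)
    then have "g (pe x l) = (1 + t * pk x l) * vdet ((?F(?j := pe x l))(Some (Some l) := pe x l))"
      unfolding g_def by (subst upd) (rule vdet_upd_scaleR)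
    also have "vdet ((?F(?j := pe x l))(Some (Some l) := pe x l)) = 0"
      by (rule vdet_equal_rows[of "Some (Some l)" ?j]) (use that in auto)
    finally show ?thesis by simp
  qed
  have gj: "g (pe x j) = Ed t x j * v0 x"
  proof -
    have "?d(j := pe x j) = (\<lambda>l. (if l = j then 1 else 1 + t * pk x l) *\<^sub>R pe x l)" by auto
    then have "g (pe x j) = (\<Prod>l\<in>UNIV. if l = j then 1 else 1 + t * pk x l) * v0 x"
      unfolding g_def frame_upd v0_def by (simp only: vdet_frame_scale)
    also have "(\<Prod>l\<in>UNIV. if l = j then 1 else 1 + t * pk x l) = Ed t x j"
      unfolding Ed_def by (subst prod.remove[of UNIV j]) (auto intro!: prod.cong)
    finally show ?thesis .
  qed
  obtain U \<phi> u where c: "local_param \<Sigma> U \<phi>" "u \<in> U" "\<phi> u = x" using chart_exists[OF x] by auto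
  obtain v where b: "b = lorentz (\<nu> x) b *\<^sub>R \<nu> x - lorentz x b *\<^sub>R x + D \<phi> u v"
    using chart_decompose[OF c(1,2), of b] c(3) by auto
  have "lorentz b (pe x l) = lorentz (D \<phi> u v) (pe x l)" for l
    by (subst b) (simp add: lorentz.add_left lorentz.diff_left lorentz.scaleR_left principal_frame_facts(7,8)[OF x])
  then have Dv: "D \<phi> u v = (\<Sum>l\<in>UNIV. lorentz b (pe x l) *\<^sub>R pe x l)"
    using principal_frame_facts(4)[OF x, of "D \<phi> u v"] deriv_tangent[OF c(1,2)] c(3) by simp
  have "g b = g (D \<phi> u v)"
    by (subst b) (simp add: linear_add[OF lin] linear_diff[OF lin] linear_scale[OF lin] g\<nu> gx)
  also have "\<dots> = (\<Sum>l\<in>UNIV. lorentz b (pe x l) * g (pe x l))"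
    unfolding Dv by (simp add: linear_sum[OF lin] linear_scale[OF lin])
  also have "\<dots> = (\<Sum>l\<in>UNIV. if l = j then lorentz b (pe x j) * (Ed t x j * v0 x) else 0)"
    by (rule sum.cong) (auto simp: gl gj)
  finally show ?thesis by (simp add: g_def frame_upd)
qed

lemma jac_E:
  assumes c: "local_param \<Sigma> U \<phi>" "u \<in> U"
  shows "vdet (frame (\<nu> (\<phi> u)) (\<phi> u) (Y t \<phi> u)) = jac \<phi> u * E t (\<phi> u)"
proof -
  obtain C where C: "\<And>i. pd \<phi> u i = (\<Sum>j\<in>UNIV. C i j *\<^sub>R pe (\<phi> u) j)"
    "\<And>i. Dn \<phi> u (axis i 1) = (\<Sum>j\<in>UNIV. C i j *\<^sub>R (pk (\<phi> u) j *\<^sub>R pe (\<phi> u) j))"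
    by (rule frame_transition[OF c]) blast
  have Y: "Y t \<phi> u = (\<lambda>i. \<Sum>j\<in>UNIV. C i j *\<^sub>R ((1 + t * pk (\<phi> u) j) *\<^sub>R pe (\<phi> u) j))"
    by (simp add: C scaleR_sum_right sum.distrib[symmetric] algebra_simps)
  have "jac \<phi> u = det (\<chi> i j. C i j) * v0 (\<phi> u)"
    unfolding jac_def C vdet_frame_expand v0_def ..
  then show ?thesis
    unfolding Y vdet_frame_expand vdet_frame_scale E_def v0_def by simp
qed

text \<open>The three sums arise when the product rule hits the scalar factor, the row of the normal
  and the row of the position. \<open>vdet_frame_derivation\<close> passes from coordinate vectors
  to a principal frame, where they become diagonal sums.\<close>

lemma divergence_parts:
  assumes c: "local_param \<Sigma> U \<phi>" "u \<in> U" and x: "x = \<phi> u"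
  shows "linear (\<lambda>v. L (D \<phi> u v)) \<Longrightarrow>
     (\<Sum>i\<in>UNIV. L (pd \<phi> u i) * vdet (frame (\<nu> x) x ((Y t \<phi> u)(i := a))))
       = jac \<phi> u * (\<Sum>j\<in>UNIV. L (pe x j) * lorentz a (pe x j) * Ed t x j)" (is "_ \<Longrightarrow> ?A")
    and "(\<Sum>i\<in>UNIV. vdet (frame (Dn \<phi> u (axis i 1)) x ((Y t \<phi> u)(i := a))))
       = jac \<phi> u * (- lorentz (\<nu> x) a * (\<Sum>j\<in>UNIV. pk x j * Ed t x j))" (is ?B)
    and "(\<Sum>i\<in>UNIV. vdet (frame (\<nu> x) (pd \<phi> u i) ((Y t \<phi> u)(i := a))))
       = jac \<phi> u * (lorentz x a * (\<Sum>j\<in>UNIV. Ed t x j))" (is ?C)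
proof -
  have xS: "x \<in> \<Sigma>" using chart_mem[OF c] x by simp
  obtain C where C: "\<And>i. pd \<phi> u i = (\<Sum>j\<in>UNIV. C i j *\<^sub>R pe x j)"
    "\<And>i. Dn \<phi> u (axis i 1) = (\<Sum>j\<in>UNIV. C i j *\<^sub>R (pk x j *\<^sub>R pe x j))"
    "\<And>L i. linear (\<lambda>v. L (D \<phi> u v)) \<Longrightarrow> L (pd \<phi> u i) = (\<Sum>j\<in>UNIV. C i j * (L (pe x j) :: real))"
    unfolding x by (rule frame_transition[OF c]) blast
  let ?d = "\<lambda>l. (1 + t * pk x l) *\<^sub>R pe x l"
  have Y: "Y t \<phi> u = (\<lambda>i. \<Sum>j\<in>UNIV. C i j *\<^sub>R ?d j)"
    by (simp add: C scaleR_sum_right sum.distrib[symmetric] algebra_simps)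
  have jac: "jac \<phi> u = det (\<chi> i j. C i j) * v0 x"
    unfolding jac_def x[symmetric] C vdet_frame_expand v0_def ..
  have main: "(\<Sum>i\<in>UNIV. vdet (frame (\<nu> x) x ((Y t \<phi> u)(i := \<Sum>j\<in>UNIV. C i j *\<^sub>R b j))))
      = jac \<phi> u * (\<Sum>j\<in>UNIV. lorentz (b j) (pe x j) * Ed t x j)" for b
    unfolding Y vdet_frame_derivation vdet_principal_replace[OF xS] jac
    by (simp add: sum_distrib_left mult_ac)
  show ?A if L: "linear (\<lambda>v. L (D \<phi> u v))"
  proof -
    have "L (pd \<phi> u i) * vdet (frame (\<nu> x) x ((Y t \<phi> u)(i := a)))
        = vdet (frame (\<nu> x) x ((Y t \<phi> u)(i := \<Sum>j\<in>UNIV. C i j *\<^sub>R (L (pe x j) *\<^sub>R a))))" for i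
      using C(3)[OF L, of i] by (simp add: vdet_frame_scaleR[symmetric] scaleR_sum_left)
    then show ?thesis by (simp only: main lorentz.scaleR_left real_scaleR_def)
  qed
  obtain v where a: "a = lorentz (\<nu> x) a *\<^sub>R \<nu> x - lorentz x a *\<^sub>R x + D \<phi> u v"
    using chart_decompose[OF c, of a] x by auto
  let ?w = "D \<phi> u v"
  have ort: "lorentz (\<nu> x) (D \<phi> u y) = 0" "lorentz x (D \<phi> u y) = 0"
    "lorentz (\<nu> x) (Dn \<phi> u y) = 0" "lorentz x (Dn \<phi> u y) = 0" for y
    using normal_orthogonal[OF c] tangent_orthogonal[OF c] normal_deriv_orthogonal[OF c] x by auto
  note nx = normal_facts(1,2)[OF xS] on_hyperboloid(2)[OF xS]
  have ortY: "lorentz (\<nu> x) (Y t \<phi> u i) = 0" "lorentz x (Y t \<phi> u i) = 0" for i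
    by (simp_all add: lorentz.add_right lorentz.scaleR_right ort)
  have split: "vdet (frame n y (w(i := a))) = lorentz (\<nu> x) a * vdet (frame n y (w(i := \<nu> x)))
      - lorentz x a * vdet (frame n y (w(i := x))) + vdet (frame n y (w(i := ?w)))" for n y w i
  proof -
    have lin: "linear (\<lambda>b. vdet (frame n y (w(i := b))))" unfolding frame_upd[symmetric] by (rule linear_vdet_upd)
    show ?thesis
      using arg_cong[OF a, of "\<lambda>b. vdet (frame n y (w(i := b)))"]
      by (simp add: linear_add[OF lin] linear_diff[OF lin] linear_scale[OF lin])
  qed
  show ?B
  proof -
    \<comment> \<open>Of \<open>a\<close> only the normal component matters: the position component
      repeats a row, and with the tangential one all rows are orthogonal to the normal. Exchanging
      two rows brings the normal back to its place and produces the sign.\<close>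
    have "vdet (frame (Dn \<phi> u (axis i 1)) x ((Y t \<phi> u)(i := a)))
        = - lorentz (\<nu> x) a * vdet (frame (\<nu> x) x ((Y t \<phi> u)(i := Dn \<phi> u (axis i 1))))" for i
    proof -
      let ?n = "Dn \<phi> u (axis i 1)"
      have "vdet (frame ?n x ((Y t \<phi> u)(i := x))) = 0"
        by (rule vdet_equal_rows[of "Some None" "Some (Some i)"]) auto
      moreover have "vdet (frame ?n x ((Y t \<phi> u)(i := ?w))) = 0"
        by (rule vdet_orthogonal_rows[of "\<nu> x"])
           (auto simp: frame_def ort ortY nx split: option.split)
      moreover have "vdet (frame ?n x ((Y t \<phi> u)(i := \<nu> x))) = - vdet (frame (\<nu> x) x ((Y t \<phi> u)(i := ?n)))"
        using vdet_swap[of None "Some (Some i)" "frame (\<nu> x) x (Y t \<phi> u)" ?n "\<nu> x"]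
        by (simp add: frame_upd frame_None_upd)
      ultimately show ?thesis unfolding split by simp
    qed
    then have "(\<Sum>i\<in>UNIV. vdet (frame (Dn \<phi> u (axis i 1)) x ((Y t \<phi> u)(i := a))))
        = - lorentz (\<nu> x) a * (\<Sum>i\<in>UNIV. vdet (frame (\<nu> x) x ((Y t \<phi> u)(i := Dn \<phi> u (axis i 1)))))"
      by (simp add: sum_distrib_left)
    also have "(\<Sum>i\<in>UNIV. vdet (frame (\<nu> x) x ((Y t \<phi> u)(i := Dn \<phi> u (axis i 1)))))
        = jac \<phi> u * (\<Sum>j\<in>UNIV. pk x j * Ed t x j)"
      using main[of "\<lambda>j. pk x j *\<^sub>R pe x j"] unfolding C(2)[symmetric]
      by (simp add: lorentz.scaleR_left principal_frame_facts(1)[OF xS])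
    finally show ?thesis by (simp only: mult_ac)
  qed
  show ?C
  proof -
    \<comment> \<open>The same argument with normal and position interchanged. Here the minus sign
      of the position component cancels the sign of the exchange.\<close>
    have "vdet (frame (\<nu> x) (pd \<phi> u i) ((Y t \<phi> u)(i := a)))
        = lorentz x a * vdet (frame (\<nu> x) x ((Y t \<phi> u)(i := pd \<phi> u i)))" for i
    proof -
      let ?n = "pd \<phi> u i"
      have "vdet (frame (\<nu> x) ?n ((Y t \<phi> u)(i := \<nu> x))) = 0"
        by (rule vdet_equal_rows[of None "Some (Some i)"]) auto
      moreover have "vdet (frame (\<nu> x) ?n ((Y t \<phi> u)(i := ?w))) = 0"
        by (rule vdet_orthogonal_rows[of x])
           (auto simp: frame_def ort ortY nx lorentz_commute[of x "\<nu> x"] split: option.split)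
      moreover have "vdet (frame (\<nu> x) ?n ((Y t \<phi> u)(i := x))) = - vdet (frame (\<nu> x) x ((Y t \<phi> u)(i := ?n)))"
        using vdet_swap[of "Some None" "Some (Some i)" "frame (\<nu> x) x (Y t \<phi> u)" ?n x]
        by (simp add: frame_upd frame_Some_None_upd)
      ultimately show ?thesis unfolding split by simp
    qed
    then have "(\<Sum>i\<in>UNIV. vdet (frame (\<nu> x) (pd \<phi> u i) ((Y t \<phi> u)(i := a))))
        = lorentz x a * (\<Sum>i\<in>UNIV. vdet (frame (\<nu> x) x ((Y t \<phi> u)(i := pd \<phi> u i))))"
      by (simp add: sum_distrib_left)
    also have "(\<Sum>i\<in>UNIV. vdet (frame (\<nu> x) x ((Y t \<phi> u)(i := pd \<phi> u i)))) = jac \<phi> u * (\<Sum>j\<in>UNIV. Ed t x j)"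
      using main[of "pe x"] unfolding C(1)[symmetric]
      by (simp add: principal_frame_facts(1)[OF xS])
    finally show ?thesis by (simp only: mult_ac)
  qed
qed

subsection \<open>The divergence theorem for Newton fields\<close>

text \<open>\<open>L\<close> is the differential of \<open>\<sigma>\<close>, tested in every chart.
  Its values off the tangent spaces are arbitrary, so explicit ambient formulas can serve as
  \<open>L\<close>.\<close>

definition tang_C1 :: "('m minkowski \<Rightarrow> real) \<Rightarrow> ('m minkowski \<Rightarrow> 'm minkowski \<Rightarrow> real) \<Rightarrow> bool" where
  "tang_C1 \<sigma> L \<longleftrightarrow> (\<forall>U \<phi>. local_param \<Sigma> U \<phi> \<longrightarrow>
     (\<forall>u\<in>U. ((\<lambda>u. \<sigma> (\<phi> u)) has_derivative (\<lambda>v. L (\<phi> u) (D \<phi> u v))) (at u)) \<and>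
     (\<forall>v. continuous_on U (\<lambda>u. L (\<phi> u) (D \<phi> u v))))"

lemma tang_C1_deriv:
  "tang_C1 \<sigma> L \<Longrightarrow> local_param \<Sigma> U \<phi> \<Longrightarrow> u \<in> U \<Longrightarrow>
     ((\<lambda>u. \<sigma> (\<phi> u)) has_derivative (\<lambda>v. L (\<phi> u) (D \<phi> u v))) (at u)"
  and tang_C1_cont: "tang_C1 \<sigma> L \<Longrightarrow> local_param \<Sigma> U \<phi> \<Longrightarrow> continuous_on U (\<lambda>u. L (\<phi> u) (D \<phi> u v))"
  by (auto simp: tang_C1_def)

lemma tang_C1_cont_base: "tang_C1 \<sigma> L \<Longrightarrow> local_param \<Sigma> U \<phi> \<Longrightarrow> continuous_on U (\<lambda>u. \<sigma> (\<phi> u))"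
  using tang_C1_deriv by (meson continuous_at_imp_continuous_on has_derivative_continuous)

text \<open>
  The divergence of \<open>\<sigma>\<close> times the image of \<open>a\<close> under the cofactor operator of \<open>id + t A\<close>, where \<open>A\<close> is
  the shape operator; the coefficients in \<open>t\<close> of these operators are the Newton tensors.
\<close>

definition divg :: "real \<Rightarrow> 'm minkowski \<Rightarrow> ('m minkowski \<Rightarrow> real) \<Rightarrow> ('m minkowski \<Rightarrow> 'm minkowski \<Rightarrow> real) \<Rightarrow>
    'm minkowski \<Rightarrow> real" where
  "divg t a \<sigma> L x =
     \<sigma> x * (- lorentz (\<nu> x) a * (\<Sum>j\<in>UNIV. pk x j * Ed t x j) + lorentz x a * (\<Sum>j\<in>UNIV. Ed t x j)) +
     (\<Sum>j\<in>UNIV. L x (pe x j) * lorentz a (pe x j) * Ed t x j)"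

text \<open>The \<open>i\<close>-th component of the Newton field of \<open>a\<close> in a chart,
  already multiplied by the signed area density, so that its coordinate divergence needs no metric
  correction.\<close>

definition flux :: "real \<Rightarrow> 'm minkowski \<Rightarrow> (real^'m \<Rightarrow> 'm minkowski) \<Rightarrow> 'm \<Rightarrow> real^'m \<Rightarrow> real" where
  "flux t a \<phi> i u = vdet (frame (\<nu> (\<phi> u)) (\<phi> u) ((Y t \<phi> u)(i := a)))"

lemma Y_Ck:
  assumes c: "local_param \<Sigma> U \<phi>"
  shows "Ck_on k U (\<lambda>u. Y t \<phi> u j)"
  by (intro Ck_on_add chart_open[OF c] Ck_on_bounded_linear[OF bounded_linear_scaleR_right]
      Ck_on_deriv chart_Ck[OF c, of "Suc k"] chart_normal_Ck[OF c, of "Suc k"])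

lemma flux_rows_Ck:
  assumes c: "local_param \<Sigma> U \<phi>"
  shows "Ck_on k U (\<lambda>u. frame (\<nu> (\<phi> u)) (\<phi> u) ((Y t \<phi> u)(i := a)) l)"
proof -
  have n: "Ck_on k U (\<lambda>u. \<nu> (\<phi> u))" using chart_normal_Ck[OF c, of k] by (simp add: o_def)
  consider "l = None" | "l = Some None" | j where "l = Some (Some j)" by (metis option.exhaust)
  then show ?thesis
  proof cases
    case 3
    then show ?thesis using Y_Ck[OF c, where k = k and t = t and j = j] Ck_on_const[of k U a] by (cases "j = i") simp_all
  qed (use n chart_Ck[OF c, of k] in simp_all)
qed

lemma flux_Ck: "local_param \<Sigma> U \<phi> \<Longrightarrow> Ck_on k U (flux t a \<phi> i)"
  using Ck_on_vdet[OF chart_open flux_rows_Ck] by (simp add: flux_def[abs_def])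

text \<open>Second derivatives of the map \<open>\<phi> + t \<nu>\<close>.\<close>

definition H :: "real \<Rightarrow> (real^'m \<Rightarrow> 'm minkowski) \<Rightarrow> real^'m \<Rightarrow> 'm \<Rightarrow> real^'m \<Rightarrow> 'm minkowski" where
  "H t \<phi> u j v = frechet_derivative (\<lambda>y. Y t \<phi> y j) (at u) v"

lemma H_symmetric:
  assumes c: "local_param \<Sigma> U \<phi>" "u \<in> U"
  shows "H t \<phi> u j (axis i 1) = H t \<phi> u i (axis j 1)"
proof -
  have 1: "((\<lambda>y. pd \<phi> y j) has_derivative frechet_derivative (\<lambda>y. pd \<phi> y j) (at u)) (at u)" for j
    by (rule Ck_on_has_derivative[OF Ck_on_deriv[OF chart_Ck[OF c(1), of "Suc (Suc 0)"]] c(2)])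
  have 2: "((\<lambda>y. Dn \<phi> y (axis j 1)) has_derivative frechet_derivative (\<lambda>y. Dn \<phi> y (axis j 1)) (at u)) (at u)" for j
    by (rule Ck_on_has_derivative[OF Ck_on_deriv[OF chart_normal_Ck[OF c(1), of "Suc (Suc 0)"]] c(2)])
  have H: "H t \<phi> u j v = frechet_derivative (\<lambda>y. pd \<phi> y j) (at u) v
      + t *\<^sub>R frechet_derivative (\<lambda>y. Dn \<phi> y (axis j 1)) (at u) v" for j v
  proof -
    have "((\<lambda>y. Y t \<phi> y j) has_derivative (\<lambda>v. frechet_derivative (\<lambda>y. pd \<phi> y j) (at u) v
      + t *\<^sub>R frechet_derivative (\<lambda>y. Dn \<phi> y (axis j 1)) (at u) v)) (at u)"
      by (intro has_derivative_add has_derivative_scaleR_right 1 2)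
    from fun_cong[OF frechet_derivative_at[OF this], of v, symmetric] show ?thesis unfolding H_def .
  qed
  show ?thesis
    unfolding H
    using symmetric_second_derivative[OF chart_open[OF c(1)] c(2) chart_Ck[OF c(1)], of "axis j 1" "axis i 1"]
      symmetric_second_derivative[OF chart_open[OF c(1)] c(2) chart_normal_Ck[OF c(1)], of "axis j 1" "axis i 1"]
    by simp
qed

text \<open>The row \<open>i\<close> holds the constant vector \<open>a\<close>, whose derivative is
  zero; this is the case \<open>j = i\<close> in the last sum.\<close>

lemma flux_deriv:
  assumes c: "local_param \<Sigma> U \<phi>" "u \<in> U"
  shows "frechet_derivative (flux t a \<phi> i) (at u) v =
     vdet (frame (Dn \<phi> u v) (\<phi> u) ((Y t \<phi> u)(i := a))) +
     vdet (frame (\<nu> (\<phi> u)) (D \<phi> u v) ((Y t \<phi> u)(i := a))) +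
     (\<Sum>j\<in>UNIV. vdet (frame (\<nu> (\<phi> u)) (\<phi> u) ((Y t \<phi> u)(i := a, j := if j = i then 0 else H t \<phi> u j v))))"
proof -
  let ?f = "\<lambda>l u. frame (\<nu> (\<phi> u)) (\<phi> u) ((Y t \<phi> u)(i := a)) l"
  let ?f' = "\<lambda>l v. frame (Dn \<phi> u v) (D \<phi> u v) (\<lambda>j. if j = i then 0 else H t \<phi> u j v) l"
  have d: "(?f l has_derivative ?f' l) (at u)" for l
  proof -
    have n: "((\<lambda>u. \<nu> (\<phi> u)) has_derivative Dn \<phi> u) (at u)" using normal_deriv[OF c] by (simp add: o_def)
    have y: "((\<lambda>u. Y t \<phi> u j) has_derivative H t \<phi> u j) (at u)" for j
      unfolding H_def[abs_def] by (rule Ck_on_has_derivative[OF Y_Ck[OF c(1)] c(2)])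
    consider "l = None" | "l = Some None" | j where "l = Some (Some j)" by (metis option.exhaust)
    then show ?thesis
    proof cases
      case 3
      then show ?thesis using y[of j] by (cases "j = i") simp_all
    qed (use n chart_deriv[OF c] in simp_all)
  qed
  have "(flux t a \<phi> i has_derivative (\<lambda>v. \<Sum>k\<in>UNIV. vdet ((\<lambda>l. ?f l u)(k := ?f' k v)))) (at u)"
    using has_derivative_vdet[OF d] by (simp add: flux_def[abs_def])
  from fun_cong[OF frechet_derivative_at[OF this], of v, symmetric]
  have "frechet_derivative (flux t a \<phi> i) (at u) v = (\<Sum>k\<in>UNIV. vdet ((\<lambda>l. ?f l u)(k := ?f' k v)))" .
  then show ?thesis
    by (simp only: sum_option frame_simps frame_upd frame_None_upd frame_Some_None_upd add.assoc)
qed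

text \<open>In \<open>M i j\<close> the vector \<open>a\<close> stands in row \<open>i\<close> and a
  second derivative with indices \<open>i\<close>, \<open>j\<close> in row \<open>j\<close>.
  Interchanging \<open>i\<close> and \<open>j\<close> keeps the second derivative and swaps the two
  rows, so the double sum cancels and only the terms of \<open>divergence_parts\<close>
  remain.\<close>

lemma flux_divergence:
  assumes c: "local_param \<Sigma> U \<phi>" "u \<in> U" and \<sigma>: "tang_C1 \<sigma> L"
  shows "(\<Sum>i\<in>UNIV. L (\<phi> u) (pd \<phi> u i) * flux t a \<phi> i u +
       \<sigma> (\<phi> u) * frechet_derivative (flux t a \<phi> i) (at u) (axis i 1)) = jac \<phi> u * divg t a \<sigma> L (\<phi> u)"
proof -
  let ?F = "frame (\<nu> (\<phi> u)) (\<phi> u)"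
  define M where "M i j = vdet (?F ((Y t \<phi> u)(i := a, j := if j = i then 0 else H t \<phi> u j (axis i 1))))" for i j
  have anti: "M i j = - M j i" for i j
  proof (cases "i = j")
    case True
    have "M j j = 0"
      using linear_0[OF linear_vdet_upd[of "?F ((Y t \<phi> u)(j := a))" "Some (Some j)"]]
      by (simp add: M_def frame_upd)
    then show ?thesis using True by simp
  next
    case False
    let ?h = "H t \<phi> u j (axis i 1)"
    have "M i j = vdet ((?F (Y t \<phi> u))(Some (Some i) := a, Some (Some j) := ?h))"
      using False by (simp add: M_def frame_upd)
    also have "\<dots> = - vdet ((?F (Y t \<phi> u))(Some (Some i) := ?h, Some (Some j) := a))"
      by (rule vdet_swap) (use False in simp)
    also have "(?F (Y t \<phi> u))(Some (Some i) := ?h, Some (Some j) := a) = (?F (Y t \<phi> u))(Some (Some j) := a, Some (Some i) := ?h)"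
      by (rule fun_upd_twist) (use False in simp)
    also have "vdet \<dots> = M j i"
      using False H_symmetric[OF c, of t j i] by (simp add: M_def frame_upd)
    finally show ?thesis .
  qed
  have "(\<Sum>i\<in>UNIV. \<Sum>j\<in>UNIV. M i j) = (\<Sum>i\<in>UNIV. \<Sum>j\<in>UNIV. - M j i)"
    by (intro sum.cong refl anti)
  also have "\<dots> = - (\<Sum>i\<in>UNIV. \<Sum>j\<in>UNIV. M i j)" unfolding sum_negf by (subst sum.swap) (rule refl)
  finally have M: "(\<Sum>i\<in>UNIV. \<Sum>j\<in>UNIV. M i j) = 0" by simp
  have lin: "linear (\<lambda>v. L (\<phi> u) (D \<phi> u v))" using tang_C1_deriv[OF \<sigma> c] has_derivative_linear by blast
  note parts = divergence_parts[OF c refl]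
  have "(\<Sum>i\<in>UNIV. frechet_derivative (flux t a \<phi> i) (at u) (axis i 1))
      = (\<Sum>i\<in>UNIV. vdet (frame (Dn \<phi> u (axis i 1)) (\<phi> u) ((Y t \<phi> u)(i := a))))
        + (\<Sum>i\<in>UNIV. vdet (frame (\<nu> (\<phi> u)) (pd \<phi> u i) ((Y t \<phi> u)(i := a))))
        + (\<Sum>i\<in>UNIV. \<Sum>j\<in>UNIV. M i j)"
    unfolding flux_deriv[OF c] M_def by (simp only: sum.distrib)
  then have "(\<Sum>i\<in>UNIV. frechet_derivative (flux t a \<phi> i) (at u) (axis i 1))
      = jac \<phi> u * (- lorentz (\<nu> (\<phi> u)) a * (\<Sum>j\<in>UNIV. pk (\<phi> u) j * Ed t (\<phi> u) j)
        + lorentz (\<phi> u) a * (\<Sum>j\<in>UNIV. Ed t (\<phi> u) j))"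
    unfolding M parts(2,3) by (simp only: distrib_left add_0_right)
  moreover have "(\<Sum>i\<in>UNIV. L (\<phi> u) (pd \<phi> u i) * flux t a \<phi> i u)
      = jac \<phi> u * (\<Sum>j\<in>UNIV. L (\<phi> u) (pe (\<phi> u) j) * lorentz a (pe (\<phi> u) j) * Ed t (\<phi> u) j)"
    unfolding flux_def by (rule parts(1)[OF lin])
  ultimately show ?thesis
    unfolding sum.distrib sum_distrib_left[symmetric] divg_def by (simp only: algebra_simps)
qed

lemma surface_continuousI:
  assumes "\<And>U \<phi>. local_param \<Sigma> U \<phi> \<Longrightarrow> continuous_on U (\<lambda>u. f (\<phi> u))"
  shows "continuous_on \<Sigma> f"
  unfolding continuous_on_eq_continuous_within
proof
  fix x assume "x \<in> \<Sigma>"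
  then obtain U \<phi> where c: "local_param \<Sigma> U \<phi>" and x: "x \<in> \<phi> ` U" using chart_exists by blast
  obtain \<psi> where h: "homeomorphism U (\<phi> ` U) \<phi> \<psi>" using chart_homeomorphism[OF c] by blast
  obtain Q where Q: "open Q" "\<phi> ` U = \<Sigma> \<inter> Q" using chart_openin[OF c] unfolding openin_open by blast
  have "continuous_on (\<phi> ` U) (\<lambda>y. f (\<phi> (\<psi> y)))"
    by (rule continuous_on_compose2[OF assms[OF c] homeomorphism_cont2[OF h]])
       (use homeomorphism_image2[OF h] in auto)
  then have "continuous_on (\<phi> ` U) f"
    by (rule continuous_on_eq) (simp add: homeomorphism_apply2[OF h])
  then have "continuous (at x within \<Sigma> \<inter> Q) f" using x Q(2) by (simp add: continuous_on_eq_continuous_within)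
  moreover have "at x within \<Sigma> \<inter> Q = at x within \<Sigma>"
    by (rule at_within_nhd[of x Q]) (use x Q in auto)
  ultimately show "continuous (at x within \<Sigma>) f" by simp
qed

text \<open>The definition of \<open>divg\<close> uses principal frames without known regularity.
  Continuity comes from the chart expression of \<open>flux_divergence\<close> divided by
  \<open>jac\<close>.\<close>

lemma divg_continuous:
  assumes \<sigma>: "tang_C1 \<sigma> L"
  shows "continuous_on \<Sigma> (divg t a \<sigma> L)"
proof (rule surface_continuousI)
  fix U \<phi> assume c: "local_param \<Sigma> U \<phi>"
  let ?S = "\<lambda>u. \<Sum>i\<in>UNIV. L (\<phi> u) (pd \<phi> u i) * flux t a \<phi> i u +
       \<sigma> (\<phi> u) * frechet_derivative (flux t a \<phi> i) (at u) (axis i 1)"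
  have "continuous_on U (\<lambda>u. ?S u / jac \<phi> u)"
    using tang_C1_cont[OF \<sigma> c] tang_C1_cont_base[OF \<sigma> c] jac_cont[OF c] jac_nonzero[OF c]
      Ck_on_continuous[OF flux_Ck[OF c]] Ck_on_continuous[OF Ck_on_deriv[OF flux_Ck[OF c, of "Suc 0"]]]
    by (intro continuous_on_divide continuous_on_sum continuous_on_add continuous_on_mult) auto
  then show "continuous_on U (\<lambda>u. divg t a \<sigma> L (\<phi> u))"
    by (rule continuous_on_eq) (simp add: flux_divergence[OF c _ \<sigma>] jac_nonzero[OF c])
qed

text \<open>The divergence formula contains the signed density, the area measure its absolute value.
  On a connected chart domain they differ by a constant factor.\<close>

lemma jac_sign:
  assumes c: "local_param \<Sigma> U \<phi>" "connected U"
  obtains s where "\<And>u. u \<in> U \<Longrightarrow> area_density \<phi> u = s * jac \<phi> u"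
proof (cases "\<exists>u\<in>U. jac \<phi> u > 0")
  case True
  then obtain p where p: "p \<in> U" "jac \<phi> p > 0" by blast
  have "jac \<phi> u > 0" if u: "u \<in> U" for u
  proof (rule ccontr)
    assume "\<not> jac \<phi> u > 0"
    then have "jac \<phi> u \<le> 0" by simp
    moreover have "connected (jac \<phi> ` U)" using connected_continuous_image[OF jac_cont[OF c(1)] c(2)] .
    ultimately have "0 \<in> jac \<phi> ` U"
      using p u connectedD_interval[of "jac \<phi> ` U" "jac \<phi> u" "jac \<phi> p" 0] by auto
    then show False using jac_nonzero[OF c(1)] by auto
  qed
  then have "area_density \<phi> u = 1 * jac \<phi> u" if "u \<in> U" for u
    using area_density_jac[OF c(1)] that by (simp add: abs_of_pos)
  then show ?thesis by (rule that)
next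
  case False
  then have "area_density \<phi> u = -1 * jac \<phi> u" if "u \<in> U" for u
    using area_density_jac[OF c(1)] that by (simp add: not_less abs_of_nonpos)
  then show ?thesis by (rule that)
qed

lemma local_divergence_zero:
  assumes c: "local_param \<Sigma> U \<phi>" "connected U" and K: "compact K" "K \<subseteq> U" and \<sigma>: "tang_C1 \<sigma> L"
    and supp: "\<And>x. x \<in> \<Sigma> \<Longrightarrow> x \<notin> \<phi> ` K \<Longrightarrow> \<sigma> x = 0"
  shows "(\<integral>x. divg t a \<sigma> L x \<partial>area_measure \<Sigma>) = 0"
proof -
  let ?F = "\<lambda>i u. \<sigma> (\<phi> u) * flux t a \<phi> i u"
  let ?F' = "\<lambda>i u v. \<sigma> (\<phi> u) * frechet_derivative (flux t a \<phi> i) (at u) v + L (\<phi> u) (D \<phi> u v) * flux t a \<phi> i u"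
  define g where "g i u = (if u \<in> U then ?F i u else 0)" for i u
  have U: "open U" using chart_open[OF c(1)] .
  have der: "(g i has_derivative ?F' i u) (at u)" if u: "u \<in> U" for i u
  proof -
    have "(?F i has_derivative ?F' i u) (at u)"
      by (rule has_derivative_mult[OF tang_C1_deriv[OF \<sigma> c(1) u] Ck_on_has_derivative[OF flux_Ck[OF c(1)] u]])
    then show ?thesis by (rule has_derivative_transform_within_open[OF _ U u]) (simp add: g_def)
  qed
  have cont: "continuous_on U (\<lambda>u. ?F' i u v)" for i v
    by (intro continuous_on_add continuous_on_mult tang_C1_cont[OF \<sigma> c(1)] tang_C1_cont_base[OF \<sigma> c(1)]
        Ck_on_continuous[OF flux_Ck[OF c(1)]] Ck_on_continuous[OF Ck_on_deriv[OF flux_Ck[OF c(1)]]])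
  have g0: "g i u = 0" if "u \<notin> K" for i u
  proof (cases "u \<in> U")
    case True
    then have "\<phi> u \<notin> \<phi> ` K" using inj_onD[OF chart_inj_on[OF c(1)]] K(2) that by blast
    then show ?thesis using supp[OF chart_mem[OF c(1) True]] by (simp add: g_def)
  qed (simp add: g_def)
  have int: "integrable lborel (\<lambda>u. if u \<in> U then ?F' i u (axis i 1) else 0)"
    "(\<integral>u. (if u \<in> U then ?F' i u (axis i 1) else 0) \<partial>lborel) = 0" for i
    using integral_derivative_on_eq_0[OF U der cont K g0] by blast+
  have z: "(\<integral>u. (if u \<in> U then jac \<phi> u * divg t a \<sigma> L (\<phi> u) else 0) \<partial>lborel) = 0"
  proof -
    have "(\<integral>u. (\<Sum>i\<in>UNIV. if u \<in> U then ?F' i u (axis i 1) else 0) \<partial>lborel) = 0"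
      using int by (simp add: Bochner_Integration.integral_sum)
    moreover have "(\<Sum>i\<in>UNIV. if u \<in> U then ?F' i u (axis i 1) else 0)
        = (if u \<in> U then jac \<phi> u * divg t a \<sigma> L (\<phi> u) else 0)" for u
      using flux_divergence[OF c(1) _ \<sigma>, of u t a] by (cases "u \<in> U") (simp_all add: add.commute)
    ultimately show ?thesis by simp
  qed
  obtain s where s: "\<And>u. u \<in> U \<Longrightarrow> area_density \<phi> u = s * jac \<phi> u" by (rule jac_sign[OF c]) blast
  \<comment> \<open>Off the chart image, \<open>\<sigma>\<close> vanishes near \<open>x\<close>
    because the image of \<open>K\<close> is compact, hence closed. So its differential is zero on
    tangent vectors, and principal directions are tangent.\<close>
  have out: "divg t a \<sigma> L x = 0" if x: "x \<in> \<Sigma>" "x \<notin> \<phi> ` U" for x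
  proof -
    have sx: "\<sigma> x = 0" using supp x K(2) by blast
    obtain U' \<phi>' u where c': "local_param \<Sigma> U' \<phi>'" "u \<in> U'" "\<phi>' u = x" using chart_exists[OF x(1)] by auto
    have cK: "closed (\<phi> ` K)"
      using compact_continuous_image[OF continuous_on_subset[OF chart_cont[OF c(1)] K(2)] K(1)] compact_imp_closed by blast
    let ?V = "{y \<in> U'. \<phi>' y \<notin> \<phi> ` K}"
    have "open ?V"
    proof -
      have "?V = U' \<inter> \<phi>' -` (- (\<phi> ` K))" by blast
      then show ?thesis
        using continuous_open_preimage[OF chart_cont[OF c'(1)] chart_open[OF c'(1)], of "- (\<phi> ` K)"] cK
        by (simp add: open_Compl)
    qed
    moreover have "u \<in> ?V" using c' x K(2) by auto
    moreover have "0 = \<sigma> (\<phi>' y)" if "y \<in> ?V" for y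
      using supp[of "\<phi>' y"] chart_mem[OF c'(1), of y] that by simp
    ultimately have "((\<lambda>u. \<sigma> (\<phi>' u)) has_derivative (\<lambda>_. 0)) (at u)"
      by (rule has_derivative_transform_within_open[OF has_derivative_const])
    then have "(\<lambda>v. L (\<phi>' u) (D \<phi>' u v)) = (\<lambda>_. 0)"
      using has_derivative_unique[OF tang_C1_deriv[OF \<sigma> c'(1,2)]] by blast
    then have "L x (D \<phi>' u v) = 0" for v using c'(3) by (metis)
    then have "L x (pe x j) = 0" for j
      using principal_frame_facts(2)[OF x(1), of j] tangent_space_range[OF c'(1,2)] c'(3) by auto
    then show ?thesis using sx by (simp add: divg_def)
  qed
  have "(\<integral>x. divg t a \<sigma> L x \<partial>area_measure \<Sigma>)
      = (\<integral>u. (if u \<in> U then area_density \<phi> u * divg t a \<sigma> L (\<phi> u) else 0) \<partial>lborel)"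
    by (rule integral_chart[OF c(1) continuous_measurable[OF divg_continuous[OF \<sigma>]] out])
  also have "\<dots> = (\<integral>u. s * (if u \<in> U then jac \<phi> u * divg t a \<sigma> L (\<phi> u) else 0) \<partial>lborel)"
    by (rule Bochner_Integration.integral_cong) (auto simp: s)
  finally show ?thesis using z by simp
qed

section \<open>Closure properties of tangential C^1 functions\<close>

lemma tang_C1_const: "tang_C1 (\<lambda>_. r) (\<lambda>_ _. 0)"
  by (simp add: tang_C1_def)

lemma tang_C1_mult:
  assumes 1: "tang_C1 \<sigma> L" and 2: "tang_C1 \<tau> M"
  shows "tang_C1 (\<lambda>x. \<sigma> x * \<tau> x) (\<lambda>x v. \<sigma> x * M x v + L x v * \<tau> x)"
  unfolding tang_C1_def
proof (intro allI impI conjI ballI)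
  fix U \<phi> assume c: "local_param \<Sigma> U \<phi>"
  show "((\<lambda>u. \<sigma> (\<phi> u) * \<tau> (\<phi> u)) has_derivative (\<lambda>v. \<sigma> (\<phi> u) * M (\<phi> u) (D \<phi> u v) + L (\<phi> u) (D \<phi> u v) * \<tau> (\<phi> u))) (at u)"
    if u: "u \<in> U" for u
    by (rule has_derivative_mult[OF tang_C1_deriv[OF 1 c u] tang_C1_deriv[OF 2 c u]])
  show "continuous_on U (\<lambda>u. \<sigma> (\<phi> u) * M (\<phi> u) (D \<phi> u v) + L (\<phi> u) (D \<phi> u v) * \<tau> (\<phi> u))" for v
    by (intro continuous_on_add continuous_on_mult tang_C1_cont[OF 1 c] tang_C1_cont[OF 2 c]
        tang_C1_cont_base[OF 1 c] tang_C1_cont_base[OF 2 c])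
qed

lemma tang_C1_inverse:
  assumes 1: "tang_C1 \<sigma> L" and nz: "\<And>x. x \<in> \<Sigma> \<Longrightarrow> \<sigma> x \<noteq> 0"
  shows "tang_C1 (\<lambda>x. inverse (\<sigma> x)) (\<lambda>x v. - (inverse (\<sigma> x) * L x v * inverse (\<sigma> x)))"
  unfolding tang_C1_def
proof (intro allI impI conjI ballI)
  fix U \<phi> assume c: "local_param \<Sigma> U \<phi>"
  show "((\<lambda>u. inverse (\<sigma> (\<phi> u))) has_derivative
      (\<lambda>v. - (inverse (\<sigma> (\<phi> u)) * L (\<phi> u) (D \<phi> u v) * inverse (\<sigma> (\<phi> u))))) (at u)"
    if u: "u \<in> U" for u
    by (rule Deriv.has_derivative_inverse[OF nz[OF chart_mem[OF c u]] tang_C1_deriv[OF 1 c u]])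
  show "continuous_on U (\<lambda>u. - (inverse (\<sigma> (\<phi> u)) * L (\<phi> u) (D \<phi> u v) * inverse (\<sigma> (\<phi> u))))" for v
    by (intro continuous_on_minus continuous_on_mult continuous_on_inverse tang_C1_cont[OF 1 c] tang_C1_cont_base[OF 1 c])
       (use nz chart_mem[OF c] in auto)
qed

lemma tang_C1_sum:
  assumes "\<And>i. i \<in> I \<Longrightarrow> tang_C1 (\<sigma> i) (L i)"
  shows "tang_C1 (\<lambda>x. \<Sum>i\<in>I. \<sigma> i x) (\<lambda>x v. \<Sum>i\<in>I. L i x v)"
  using assms unfolding tang_C1_def by (auto intro!: has_derivative_sum continuous_on_sum)

section \<open>Partition of unity and the global divergence theorem\<close>

definition bump :: "real \<Rightarrow> 'm minkowski \<Rightarrow> 'm minkowski \<Rightarrow> real" where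
  "bump \<epsilon> p y = (max 0 (\<epsilon>\<^sup>2 - (y - p) \<bullet> (y - p)))\<^sup>2"

text \<open>The squared positive part is differentiable also at zero, where the difference quotient
  is bounded by \<open>\<bar>h\<bar>\<close>. One continuous derivative suffices for the divergence
  theorem.\<close>

lemma tang_C1_bump:
  "tang_C1 (bump \<epsilon> p) (\<lambda>y v. 2 * max 0 (\<epsilon>\<^sup>2 - (y - p) \<bullet> (y - p)) * (- 2 * ((y - p) \<bullet> v)))"
  unfolding tang_C1_def
proof (intro allI impI conjI ballI)
  fix U \<phi> assume c: "local_param \<Sigma> U \<phi>"
  have sq: "((\<lambda>s::real. (max 0 s)\<^sup>2) has_real_derivative 2 * max 0 r) (at r)" for r
  proof -
    consider "r > 0" | "r < 0" | "r = 0" by linarith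
    then show ?thesis
    proof cases
      case 1
      have "((\<lambda>s. s\<^sup>2) has_real_derivative 2 * r) (at r)" by (auto intro!: derivative_eq_intros)
      then have "((\<lambda>s. (max 0 s)\<^sup>2) has_real_derivative 2 * r) (at r)"
        by (rule has_field_derivative_transform_within_open[of _ _ _ "{0<..}"]) (use 1 in auto)
      then show ?thesis using 1 by simp
    next
      case 2
      have "((\<lambda>s. 0) has_real_derivative 0) (at r)" by simp
      then have "((\<lambda>s. (max 0 s)\<^sup>2) has_real_derivative 0) (at r)"
        by (rule has_field_derivative_transform_within_open[of _ _ _ "{..<0}"]) (use 2 in auto)
      then show ?thesis using 2 by simp
    next
      case 3
      have "((\<lambda>h. (max 0 h)\<^sup>2 / h) \<longlongrightarrow> 0) (at (0::real))"
      proof (rule Lim_null_comparison)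
        have "norm ((max 0 h)\<^sup>2 / h) \<le> \<bar>h\<bar>" for h :: real
          by (cases "h > 0") (auto simp: power2_eq_square max_def)
        then show "eventually (\<lambda>h. norm ((max 0 h)\<^sup>2 / h) \<le> \<bar>h\<bar>) (at 0)" by simp
        show "((\<lambda>h. \<bar>h\<bar>) \<longlongrightarrow> 0) (at (0::real))" by (intro tendsto_eq_intros) auto
      qed
      then show ?thesis using 3 by (simp add: DERIV_def)
    qed
  qed
  show "((\<lambda>u. bump \<epsilon> p (\<phi> u)) has_derivative
      (\<lambda>v. 2 * max 0 (\<epsilon>\<^sup>2 - (\<phi> u - p) \<bullet> (\<phi> u - p)) * (- 2 * ((\<phi> u - p) \<bullet> D \<phi> u v)))) (at u)" if u: "u \<in> U" for u
  proof -
    have "((\<lambda>u. \<epsilon>\<^sup>2 - (\<phi> u - p) \<bullet> (\<phi> u - p)) has_derivative (\<lambda>v. - 2 * ((\<phi> u - p) \<bullet> D \<phi> u v))) (at u)"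
    proof -
      have d: "((\<lambda>u. \<phi> u - p) has_derivative (\<lambda>v. D \<phi> u v - 0)) (at u)"
        by (intro has_derivative_diff chart_deriv[OF c u] has_derivative_const)
      have "((\<lambda>u. \<epsilon>\<^sup>2 - (\<phi> u - p) \<bullet> (\<phi> u - p)) has_derivative
          (\<lambda>v. 0 - ((\<phi> u - p) \<bullet> (D \<phi> u v - 0) + (D \<phi> u v - 0) \<bullet> (\<phi> u - p)))) (at u)"
        by (intro has_derivative_diff has_derivative_const has_derivative_inner d)
      then show ?thesis by (rule has_derivative_eq_rhs) (simp add: fun_eq_iff inner_commute)
    qed
    from has_derivative_compose[OF this sq[unfolded has_field_derivative_def]] show ?thesis
      by (simp add: bump_def)
  qed
  have "continuous_on U (\<lambda>u. D \<phi> u v)" for v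
    using Ck_on_continuous[OF Ck_on_deriv[OF chart_Ck[OF c, of "Suc 0"]]] .
  then show "continuous_on U (\<lambda>u. 2 * max 0 (\<epsilon>\<^sup>2 - (\<phi> u - p) \<bullet> (\<phi> u - p)) * (- 2 * ((\<phi> u - p) \<bullet> D \<phi> u v)))" for v
    using chart_cont[OF c] by (intro continuous_intros) auto
qed

lemma bump_nonneg: "bump \<epsilon> p y \<ge> 0"
  by (simp add: bump_def)

lemma bump_pos_iff: "\<epsilon> > 0 \<Longrightarrow> bump \<epsilon> p y > 0 \<longleftrightarrow> y \<in> ball p \<epsilon>"
proof -
  assume e: "\<epsilon> > 0"
  have "bump \<epsilon> p y > 0 \<longleftrightarrow> (norm (y - p))\<^sup>2 < \<epsilon>\<^sup>2"
    by (auto simp: bump_def dot_square_norm max_def)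
  also have "\<dots> \<longleftrightarrow> norm (y - p) < \<epsilon>" using e power2_less_imp_less[of "norm (y - p)" \<epsilon>] power_strict_mono[of "norm (y - p)" \<epsilon> 2] by auto
  finally show ?thesis by (simp add: dist_norm norm_minus_commute)
qed

text \<open>The support is confined to the closed ball of half the radius, which is a compact subset
  of a connected chart domain as \<open>local_divergence_zero\<close> demands.\<close>

lemma small_ball:
  assumes "p \<in> \<Sigma>"
  obtains \<epsilon> U \<phi> K where "\<epsilon> > 0" "local_param \<Sigma> U \<phi>" "connected U" "compact K" "K \<subseteq> U"
    "\<And>x. x \<in> \<Sigma> \<Longrightarrow> x \<notin> \<phi> ` K \<Longrightarrow> bump \<epsilon> p x = 0"
proof -
  obtain U0 c r \<phi> where b: "local_param \<Sigma> U0 \<phi>" "r > 0" "cball c r \<subseteq> U0" "\<phi> c = p"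
    by (rule ball_chart[OF assms])
  have sub: "ball c r \<subseteq> U0" using b(3) ball_subset_cball by blast
  have c1: "local_param \<Sigma> (ball c r) \<phi>" using chart_subset[OF b(1) open_ball sub] .
  let ?K = "cball c (r / 2)"
  have c2: "local_param \<Sigma> (ball c (r/2)) \<phi>"
    by (rule chart_subset[OF c1 open_ball subset_ball]) (use b(2) in simp)
  obtain Q where Q: "open Q" "\<phi> ` ball c (r/2) = \<Sigma> \<inter> Q" using chart_openin[OF c2] unfolding openin_open by blast
  have "p \<in> Q" using Q(2) b by force
  then obtain \<epsilon> where e: "\<epsilon> > 0" "ball p \<epsilon> \<subseteq> Q" using Q(1) open_contains_ball by blast
  show ?thesis
  proof (rule that[OF e(1) c1])
    show "?K \<subseteq> ball c r" using b(2) by auto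
    fix x assume x: "x \<in> \<Sigma>" "x \<notin> \<phi> ` ?K"
    have "x \<notin> ball p \<epsilon>"
    proof
      assume "x \<in> ball p \<epsilon>"
      then have "x \<in> \<phi> ` ball c (r/2)" using e(2) Q(2) x(1) by blast
      then show False using x(2) ball_subset_cball by blast
    qed
    then show "bump \<epsilon> p x = 0" using bump_pos_iff[OF e(1), of p x] bump_nonneg[of \<epsilon> p x] by linarith
  qed simp_all
qed

theorem divergence_zero:
  assumes \<sigma>: "tang_C1 \<sigma> L"
  shows "(\<integral>x. divg t a \<sigma> L x \<partial>area_measure \<Sigma>) = 0"
proof -
  let ?good = "\<lambda>p \<epsilon>. \<epsilon> > 0 \<and> (\<exists>U \<phi> K. local_param \<Sigma> U \<phi> \<and> connected U \<and> compact K \<and> K \<subseteq> U \<and>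
    (\<forall>x\<in>\<Sigma>. x \<notin> \<phi> ` K \<longrightarrow> bump \<epsilon> p x = 0))"
  have "\<exists>\<epsilon>. ?good p \<epsilon>" if p: "p \<in> \<Sigma>" for p
    by (rule small_ball[OF p]) blast
  then obtain \<epsilon> where g: "\<And>p. p \<in> \<Sigma> \<Longrightarrow> ?good p (\<epsilon> p)" by metis
  have "\<Sigma> \<subseteq> (\<Union>p\<in>\<Sigma>. ball p (\<epsilon> p))" using g by force
  then obtain X where X: "X \<subseteq> \<Sigma>" "finite X" "\<Sigma> \<subseteq> (\<Union>p\<in>X. ball p (\<epsilon> p))"
    using compactE_image[OF compact_surface, of \<Sigma> "\<lambda>p. ball p (\<epsilon> p)"] by blast
  define b where "b p = bump (\<epsilon> p) p" for p
  define M where "M p y v = 2 * max 0 ((\<epsilon> p)\<^sup>2 - (y - p) \<bullet> (y - p)) * (- 2 * ((y - p) \<bullet> v))" for p y v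
  have b: "tang_C1 (b p) (M p)" for p unfolding b_def M_def[abs_def] by (rule tang_C1_bump)
  define S where "S y = (\<Sum>p\<in>X. b p y)" for y
  define N where "N y v = (\<Sum>p\<in>X. M p y v)" for y v
  have S: "tang_C1 S N" unfolding S_def[abs_def] N_def[abs_def] by (rule tang_C1_sum) (rule b)
  have Sp: "S y \<noteq> 0" if y: "y \<in> \<Sigma>" for y
  proof -
    obtain p where p: "p \<in> X" "y \<in> ball p (\<epsilon> p)" using X(3) y by blast
    have "\<epsilon> p > 0" using g X(1) p(1) by blast
    then have "b p y > 0" unfolding b_def using bump_pos_iff p(2) by blast
    then have "S y > 0" unfolding S_def
      by (intro sum_pos2[OF X(2) p(1)]) (auto simp: b_def bump_nonneg)
    then show ?thesis by simp
  qed
  \<comment> \<open>Dividing by the sum \<open>S\<close> of the bumps makes the functions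
    \<open>b p * \<tau>\<close> add up to \<open>\<sigma>\<close>, each supported in one
    chart.\<close>
  define \<tau> where "\<tau> y = inverse (S y) * \<sigma> y" for y
  define T where "T y v = inverse (S y) * L y v + - (inverse (S y) * N y v * inverse (S y)) * \<sigma> y" for y v
  have \<tau>: "tang_C1 \<tau> T"
    unfolding \<tau>_def[abs_def] T_def[abs_def] by (rule tang_C1_mult[OF tang_C1_inverse[OF S Sp] \<sigma>])
  have bt: "tang_C1 (\<lambda>y. b p y * \<tau> y) (\<lambda>y v. b p y * T y v + M p y v * \<tau> y)" for p
    by (rule tang_C1_mult[OF b \<tau>])
  let ?d = "\<lambda>p. divg t a (\<lambda>y. b p y * \<tau> y) (\<lambda>y v. b p y * T y v + M p y v * \<tau> y)"
  have zero: "(\<integral>x. ?d p x \<partial>area_measure \<Sigma>) = 0" if p: "p \<in> X" for p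
  proof -
    obtain U \<phi> K where c: "local_param \<Sigma> U \<phi>" "connected U" "compact K" "K \<subseteq> U"
      "\<And>x. x \<in> \<Sigma> \<Longrightarrow> x \<notin> \<phi> ` K \<Longrightarrow> b p x = 0"
      using g[of p] p X(1) unfolding b_def by blast
    show ?thesis by (rule local_divergence_zero[OF c(1-4) bt]) (simp add: c(5))
  qed
  have sum: "divg t a \<sigma> L x = (\<Sum>p\<in>X. ?d p x)" if x: "x \<in> \<Sigma>" for x
  proof -
    have s1: "(\<Sum>p\<in>X. b p x * \<tau> x) = \<sigma> x"
      using Sp[OF x] by (simp add: sum_distrib_right[symmetric] S_def[symmetric] \<tau>_def)
    \<comment> \<open>The differentials add up as well: the product rule terms of
      \<open>S * \<tau>\<close> reduce to \<open>L\<close>. As \<open>divg\<close> is linear in the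
      pair of function and differential, it splits accordingly.\<close>
    have s2: "(\<Sum>p\<in>X. b p x * T x v + M p x v * \<tau> x) = L x v" for v
    proof -
      have "(\<Sum>p\<in>X. b p x * T x v + M p x v * \<tau> x) = S x * T x v + N x v * \<tau> x"
        by (simp add: sum.distrib sum_distrib_right[symmetric] S_def N_def)
      also have "\<dots> = L x v" using Sp[OF x] by (simp add: T_def \<tau>_def field_simps)
      finally show ?thesis .
    qed
    let ?c = "- lorentz (\<nu> x) a * (\<Sum>j\<in>UNIV. pk x j * Ed t x j) + lorentz x a * (\<Sum>j\<in>UNIV. Ed t x j)"
    let ?f = "\<lambda>p j. b p x * T x (pe x j) + M p x (pe x j) * \<tau> x"
    have "(\<Sum>p\<in>X. \<Sum>j\<in>UNIV. ?f p j * lorentz a (pe x j) * Ed t x j)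
        = (\<Sum>j\<in>UNIV. (\<Sum>p\<in>X. ?f p j) * lorentz a (pe x j) * Ed t x j)"
      unfolding sum_distrib_right by (rule sum.swap)
    moreover have "(\<Sum>p\<in>X. ?d p x) = (\<Sum>p\<in>X. b p x * \<tau> x * ?c)
        + (\<Sum>p\<in>X. \<Sum>j\<in>UNIV. ?f p j * lorentz a (pe x j) * Ed t x j)"
      unfolding divg_def by (rule sum.distrib)
    ultimately have "(\<Sum>p\<in>X. ?d p x) = (\<Sum>p\<in>X. b p x * \<tau> x) * ?c
       + (\<Sum>j\<in>UNIV. (\<Sum>p\<in>X. ?f p j) * lorentz a (pe x j) * Ed t x j)"
      by (simp only: sum_distrib_right)
    then show ?thesis unfolding s1 s2 by (simp add: divg_def)
  qed
  have "(\<integral>x. divg t a \<sigma> L x \<partial>area_measure \<Sigma>) = (\<integral>x. (\<Sum>p\<in>X. ?d p x) \<partial>area_measure \<Sigma>)"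
    by (rule Bochner_Integration.integral_cong) (simp_all add: space_area_measure sum)
  also have "\<dots> = (\<Sum>p\<in>X. \<integral>x. ?d p x \<partial>area_measure \<Sigma>)"
    by (rule Bochner_Integration.integral_sum) (rule continuous_integrable[OF divg_continuous[OF bt]])
  finally show ?thesis using zero by simp
qed

end

subsection \<open>The integral formulas and the inequality\<close>

text \<open>Lagrange interpolation at the nodes \<open>0, ..., m\<close>: a coefficient of a
  polynomial of degree at most \<open>m\<close> is a fixed linear combination of its values there.
  Statements for all \<open>t\<close> are thereby passed on to each coefficient.\<close>

lemma coefficient_functional:
  assumes k: "k \<le> m"
  shows "\<exists>c :: nat \<Rightarrow> real. \<forall>a. (\<Sum>l\<le>m. c l * (\<Sum>i\<le>m. a i * real l ^ i)) = a k"
proof -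
  define L where "L l = (\<Prod>j\<in>{..m} - {l}. smult (1 / (real l - real j)) [:- real j, 1:])" for l
  have Lp: "poly (L l) (real i) = (if i = l then 1 else 0)" if "l \<le> m" "i \<le> m" for l i
  proof -
    have "poly (L l) (real i) = (\<Prod>j\<in>{..m} - {l}. (real i - real j) / (real l - real j))"
      unfolding L_def poly_prod by (rule prod.cong) (auto simp: diff_divide_distrib)
    also have "\<dots> = (if i = l then 1 else 0)"
    proof (cases "i = l")
      case True
      have "(\<Prod>j\<in>{..m} - {l}. (real i - real j) / (real l - real j)) = 1"
        by (rule prod.neutral) (use True in auto)
      then show ?thesis using True by simp
    next
      case False
      then have "(\<Prod>j\<in>{..m} - {l}. (real i - real j) / (real l - real j)) = 0"
        using that by (intro prod_zero) auto
      then show ?thesis using False by simp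
    qed
    finally show ?thesis .
  qed
  have Ld: "degree (L l) \<le> m" if "l \<le> m" for l
  proof -
    have "degree (L l) \<le> (\<Sum>j\<in>{..m} - {l}. degree (smult (1 / (real l - real j)) [:- real j, 1:]))"
      unfolding L_def by (rule degree_prod_sum_le[unfolded o_def]) simp
    also have "\<dots> \<le> (\<Sum>j\<in>{..m} - {l}. 1)" by (intro sum_mono) simp
    also have "\<dots> = m" using that by simp
    finally show ?thesis .
  qed
  have "(\<Sum>l\<le>m. coeff (L l) k * (\<Sum>i\<le>m. a i * real l ^ i)) = a k" for a
  proof -
    define p where "p = (\<Sum>i\<le>m. monom (a i) i)"
    define q where "q = (\<Sum>l\<le>m. smult (poly p (real l)) (L l))"
    have pv: "poly p x = (\<Sum>i\<le>m. a i * x ^ i)" for x by (simp add: p_def poly_sum poly_monom)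
    have "p = q"
    proof (rule poly_eqI_degree[of "real ` {..m}"])
      show "poly p x = poly q x" if x: "x \<in> real ` {..m}" for x
      proof -
        obtain i where i: "i \<le> m" "x = real i" using x by auto
        have "poly q (real i) = (\<Sum>l\<le>m. if l = i then poly p (real l) else 0)"
          unfolding q_def poly_sum poly_smult by (rule sum.cong) (use i Lp in auto)
        then show ?thesis using i by simp
      qed
      have "degree p \<le> m" unfolding p_def
        by (intro degree_sum_le) (auto intro: order.trans[OF degree_monom_le])
      moreover have "degree q \<le> m" unfolding q_def
        by (intro degree_sum_le) (auto intro: order.trans[OF degree_smult_le] Ld)
      moreover have "card (real ` {..m}) = Suc m" by (subst card_image) (auto simp: inj_on_def)
      ultimately show "degree p < card (real ` {..m})" "degree q < card (real ` {..m})" by simp_all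
    qed
    then have "coeff p k = coeff q k" by simp
    moreover have "coeff p k = a k" using k by (simp add: p_def coeff_sum)
    moreover have "coeff q k = (\<Sum>l\<le>m. coeff (L l) k * (\<Sum>i\<le>m. a i * real l ^ i))"
      by (simp add: q_def coeff_sum pv mult.commute)
    ultimately show ?thesis by simp
  qed
  then show ?thesis by (intro exI[of _ "\<lambda>l. coeff (L l) k"]) simp
qed

text \<open>Because of this identity both traces of a Newton tensor carry the same factor after
  normalization, so the Minkowski formulas contain no binomial coefficients.\<close>

lemma binomial_step:
  assumes "k \<le> m"
  shows "(real m - real k) * real (m choose k) = real (Suc k) * real (m choose Suc k)"
proof -
  have "Suc k * (m choose Suc k) = (m - k) * (m choose k)"
    using binomial_absorption[of k m] binomial_absorb_comp[of m k] by simp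
  then have "real (Suc k * (m choose Suc k)) = real ((m - k) * (m choose k))" by simp
  then show ?thesis using assms by (simp add: of_nat_diff algebra_simps)
qed

context oriented_hypersurface
begin

lemma mean_curv_esym:
  "x \<in> \<Sigma> \<Longrightarrow> mean_curv \<Sigma> \<nu> j x = esym UNIV j (pk x) / real (CARD('m) choose j)"
  by (simp add: mean_curv_def principal_frame_facts(5))

lemma E_continuous: "continuous_on \<Sigma> (E t)"
proof (rule surface_continuousI)
  fix U \<phi> assume c: "local_param \<Sigma> U \<phi>"
  let ?f = "\<lambda>u. vdet (frame (\<nu> (\<phi> u)) (\<phi> u) (Y t \<phi> u))"
  have "continuous_on U ?f"
  proof (rule continuous_on_vdet)
    fix l :: "'m option option"
    consider "l = None" | "l = Some None" | j where "l = Some (Some j)" by (metis option.exhaust)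
    then show "continuous_on U (\<lambda>u. frame (\<nu> (\<phi> u)) (\<phi> u) (Y t \<phi> u) l)"
      by cases (use chart_normal_cont[OF c] chart_cont[OF c] Ck_on_continuous[OF Y_Ck[OF c]] in simp_all)
  qed
  then have "continuous_on U (\<lambda>u. ?f u / jac \<phi> u)"
    using jac_cont[OF c] jac_nonzero[OF c] by (intro continuous_on_divide) auto
  then show "continuous_on U (\<lambda>u. E t (\<phi> u))"
    by (rule continuous_on_eq) (simp add: jac_E[OF c] jac_nonzero[OF c])
qed

lemma esym_continuous: "continuous_on \<Sigma> (\<lambda>x. esym UNIV j (pk x))"
proof (cases "j \<le> CARD('m)")
  case True
  obtain c :: "nat \<Rightarrow> real"
    where c: "\<And>a. (\<Sum>l\<le>CARD('m). c l * (\<Sum>i\<le>CARD('m). a i * real l ^ i)) = a j"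
    using coefficient_functional[OF True] by blast
  have "esym UNIV j (pk x) = (\<Sum>l\<le>CARD('m). c l * E (real l) x)" for x
    using c[of "\<lambda>i. esym UNIV i (pk x)"] by (simp add: E_def prod_one_plus_esym)
  then show ?thesis by (simp only:) (intro continuous_on_sum continuous_on_mult continuous_on_const E_continuous)
next
  case False
  then show ?thesis by (simp add: esym_eq_0)
qed

lemma mean_curv_continuous: "continuous_on \<Sigma> (mean_curv \<Sigma> \<nu> j)"
proof -
  have "continuous_on \<Sigma> (\<lambda>x. esym UNIV j (pk x) * inverse (real (CARD('m) choose j)))"
    by (intro continuous_on_mult continuous_on_const esym_continuous)
  then show ?thesis by (rule continuous_on_eq) (simp add: mean_curv_esym divide_inverse)
qed

text \<open>The divergence of \<open>\<sigma>\<close> times the \<open>k\<close>-th Newton tensor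
  applied to the tangential part of \<open>a\<close>. For \<open>a = x0\<close> this tangential part
  is minus the gradient of the weight.\<close>

definition divg_coeff :: "nat \<Rightarrow> 'm minkowski \<Rightarrow> ('m minkowski \<Rightarrow> real) \<Rightarrow> ('m minkowski \<Rightarrow> 'm minkowski \<Rightarrow> real) \<Rightarrow>
    'm minkowski \<Rightarrow> real" where
  "divg_coeff k a \<sigma> L x =
     real (Suc k) * real (CARD('m) choose Suc k) *
       (\<sigma> x * (- lorentz a (\<nu> x) * mean_curv \<Sigma> \<nu> (Suc k) x + lorentz a x * mean_curv \<Sigma> \<nu> k x)) +
     (\<Sum>j\<in>UNIV. L x (pe x j) * lorentz a (pe x j) * esym (UNIV - {j}) k (pk x))"

lemma divg_expand:
  assumes x: "x \<in> \<Sigma>"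
  shows "divg t a \<sigma> L x = (\<Sum>k\<le>CARD('m). divg_coeff k a \<sigma> L x * t ^ k)"
proof -
  let ?m = "CARD('m)"
  let ?e = "\<lambda>j. esym UNIV j (pk x)"
  let ?p = "\<lambda>j. mean_curv \<Sigma> \<nu> j x"
  have e: "?e j = real (?m choose j) * ?p j" for j
    by (cases "j \<le> ?m") (simp_all add: mean_curv_esym[OF x] esym_eq_0)
  \<comment> \<open>The product has degree \<open>CARD('m) - 1\<close>; a zero top term is added to
    match the other sums.\<close>
  have Ed: "Ed t x j = (\<Sum>k\<le>?m. esym (UNIV - {j}) k (pk x) * t ^ k)" for j
  proof -
    have "Ed t x j = (\<Sum>k\<le>card (UNIV - {j}). esym (UNIV - {j}) k (pk x) * t ^ k)"
      unfolding Ed_def by (rule prod_one_plus_esym) simp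
    also have "\<dots> = (\<Sum>k\<le>?m. esym (UNIV - {j}) k (pk x) * t ^ k)"
      by (rule sum.mono_neutral_left) (auto simp: esym_eq_0)
    finally show ?thesis .
  qed
  have 1: "(\<Sum>j\<in>UNIV. pk x j * Ed t x j) = (\<Sum>k\<le>?m. real (Suc k) * real (?m choose Suc k) * ?p (Suc k) * t ^ k)"
    unfolding Ed_def esym_derivative e by (simp add: mult.assoc)
  have 2: "(\<Sum>j\<in>UNIV. Ed t x j) = (\<Sum>k\<le>?m. real (Suc k) * real (?m choose Suc k) * ?p k * t ^ k)"
    unfolding Ed_def esym_deleted_sum e
    by (intro sum.cong refl) (simp only: mult.assoc[symmetric] binomial_step atMost_iff)
  have 3: "(\<Sum>j\<in>UNIV. L x (pe x j) * lorentz a (pe x j) * Ed t x j)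
      = (\<Sum>k\<le>?m. (\<Sum>j\<in>UNIV. L x (pe x j) * lorentz a (pe x j) * esym (UNIV - {j}) k (pk x)) * t ^ k)"
    unfolding Ed sum_distrib_left sum_distrib_right by (subst sum.swap) (simp add: mult.assoc)
  have "divg t a \<sigma> L x = \<sigma> x * (- lorentz a (\<nu> x) * (\<Sum>k\<le>?m. real (Suc k) * real (?m choose Suc k) * ?p (Suc k) * t ^ k)
       + lorentz a x * (\<Sum>k\<le>?m. real (Suc k) * real (?m choose Suc k) * ?p k * t ^ k))
       + (\<Sum>k\<le>?m. (\<Sum>j\<in>UNIV. L x (pe x j) * lorentz a (pe x j) * esym (UNIV - {j}) k (pk x)) * t ^ k)"
    unfolding divg_def 1 2 3 lorentz_commute[of "\<nu> x" a] lorentz_commute[of x a] ..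
  also have "\<dots> = (\<Sum>k\<le>?m. divg_coeff k a \<sigma> L x * t ^ k)"
    unfolding divg_coeff_def distrib_right sum.distrib distrib_left sum_distrib_left
    by (simp add: algebra_simps)
  finally show ?thesis .
qed

lemma divg_coeff_integral:
  assumes \<sigma>: "tang_C1 \<sigma> L" and k: "k \<le> CARD('m)"
  shows "continuous_on \<Sigma> (divg_coeff k a \<sigma> L)"
    and "(\<integral>x. divg_coeff k a \<sigma> L x \<partial>area_measure \<Sigma>) = 0"
proof -
  obtain c :: "nat \<Rightarrow> real"
    where c: "\<And>a. (\<Sum>l\<le>CARD('m). c l * (\<Sum>i\<le>CARD('m). a i * real l ^ i)) = a k"
    using coefficient_functional[OF k] by blast
  have eq: "(\<Sum>l\<le>CARD('m). c l * divg (real l) a \<sigma> L x) = divg_coeff k a \<sigma> L x" if "x \<in> \<Sigma>" for x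
    unfolding divg_expand[OF that] by (rule c)
  have "continuous_on \<Sigma> (\<lambda>x. \<Sum>l\<le>CARD('m). c l * divg (real l) a \<sigma> L x)"
    by (intro continuous_on_sum continuous_on_mult continuous_on_const divg_continuous[OF \<sigma>])
  then show "continuous_on \<Sigma> (divg_coeff k a \<sigma> L)"
    by (rule continuous_on_eq) (rule eq)
  have "(\<integral>x. divg_coeff k a \<sigma> L x \<partial>area_measure \<Sigma>)
      = (\<integral>x. (\<Sum>l\<le>CARD('m). c l * divg (real l) a \<sigma> L x) \<partial>area_measure \<Sigma>)"
    by (rule Bochner_Integration.integral_cong) (simp_all add: space_area_measure eq)
  also have "\<dots> = (\<Sum>l\<le>CARD('m). \<integral>x. c l * divg (real l) a \<sigma> L x \<partial>area_measure \<Sigma>)"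
    by (intro Bochner_Integration.integral_sum integrable_mult_right continuous_integrable[OF divg_continuous[OF \<sigma>]])
  also have "\<dots> = 0" by (simp add: divergence_zero[OF \<sigma>])
  finally show "(\<integral>x. divg_coeff k a \<sigma> L x \<partial>area_measure \<Sigma>) = 0" .
qed

section \<open>Height and support functions, and the inequality\<close>

lemma tang_C1_height: "tang_C1 (\<lambda>x. - lorentz a x) (\<lambda>x v. - lorentz a v)"
  unfolding tang_C1_def
proof (intro allI impI conjI ballI)
  fix U \<phi> assume c: "local_param \<Sigma> U \<phi>"
  show "((\<lambda>u. - lorentz a (\<phi> u)) has_derivative (\<lambda>v. - lorentz a (D \<phi> u v))) (at u)" if "u \<in> U" for u
    by (intro has_derivative_minus bounded_linear.has_derivative[OF lorentz.bounded_linear_right] chart_deriv[OF c that])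
  show "continuous_on U (\<lambda>u. - lorentz a (D \<phi> u v))" for v
    by (intro continuous_on_minus lorentz.continuous_on continuous_on_const
        Ck_on_continuous[OF Ck_on_deriv[OF chart_Ck[OF c, of "Suc 0"]]])
qed

lemma tang_C1_support:
  "tang_C1 (\<lambda>x. - lorentz a (\<nu> x)) (\<lambda>x v. - lorentz a (shape_operator \<Sigma> \<nu> x v))"
  unfolding tang_C1_def
proof (intro allI impI conjI ballI)
  fix U \<phi> assume c: "local_param \<Sigma> U \<phi>"
  show "((\<lambda>u. - lorentz a (\<nu> (\<phi> u))) has_derivative (\<lambda>v. - lorentz a (shape_operator \<Sigma> \<nu> (\<phi> u) (D \<phi> u v)))) (at u)"
    if u: "u \<in> U" for u
  proof -
    have n: "((\<lambda>u. \<nu> (\<phi> u)) has_derivative Dn \<phi> u) (at u)" using normal_deriv[OF c u] by (simp add: o_def)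
    show ?thesis unfolding shape_operator_chart[OF c u]
      by (intro has_derivative_minus bounded_linear.has_derivative[OF lorentz.bounded_linear_right] n)
  qed
  have "continuous_on U (\<lambda>u. - lorentz a (Dn \<phi> u v))" for v
    by (intro continuous_on_minus lorentz.continuous_on continuous_on_const
        Ck_on_continuous[OF Ck_on_deriv[OF chart_normal_Ck[OF c, of "Suc 0"]]])
  then show "continuous_on U (\<lambda>u. - lorentz a (shape_operator \<Sigma> \<nu> (\<phi> u) (D \<phi> u v)))" for v
    by (rule continuous_on_eq) (simp add: shape_operator_chart[OF c])
qed

text \<open>The vector \<open>?w\<close> is the tangential part of \<open>a\<close>. Its Lorentz
  square is \<open>-1 - (lorentz a (\<nu> x))^2 + (lorentz a x)^2\<close>, the squared length of the
  gradient of the height function, and is nonnegative.\<close>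

lemma support_bound:
  assumes x: "x \<in> \<Sigma>" and a: "lorentz a a = -1"
  shows "(lorentz a (\<nu> x))\<^sup>2 + 1 \<le> (lorentz a x)\<^sup>2"
proof -
  let ?w = "a - lorentz a (\<nu> x) *\<^sub>R \<nu> x + lorentz a x *\<^sub>R x"
  note f = normal_facts(1,2)[OF x] on_hyperboloid(2)[OF x] a
  have c: "lorentz x (\<nu> x) = 0" "lorentz x a = lorentz a x" "lorentz (\<nu> x) a = lorentz a (\<nu> x)"
    using f(1) by (simp_all add: lorentz_commute)
  have "lorentz x ?w = 0"
    by (simp add: lorentz.add_right lorentz.diff_right lorentz.scaleR_right f c)
  then have "lorentz ?w ?w \<ge> 0" by (rule lorentz_tangent_pos(1)[OF f(3)])
  then show ?thesis
    by (simp add: lorentz.add_right lorentz.diff_right lorentz.scaleR_right lorentz.add_left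
        lorentz.diff_left lorentz.scaleR_left f c power2_eq_square algebra_simps)
qed

lemma weighted_curvature_inequality:
  assumes k: "1 \<le> k" "k < CARD('m)" and x0: "x0 \<in> hyperbolic_space"
    and hc: "horospherically_convex \<Sigma> \<nu>"
  shows "(\<integral>x. weight x0 x * mean_curv \<Sigma> \<nu> (k - 1) x + mean_curv \<Sigma> \<nu> (k + 1) x / weight x0 x \<partial>area_measure \<Sigma>)
     \<le> (\<integral>x. weight x0 x * mean_curv \<Sigma> \<nu> (k + 1) x \<partial>area_measure \<Sigma>)"
proof -
  define V where "V x = - lorentz x0 x" for x
  define u where "u x = - lorentz x0 (\<nu> x)" for x
  define p where "p j x = mean_curv \<Sigma> \<nu> j x" for j x
  let ?I = "\<lambda>f. \<integral>x. f x \<partial>area_measure \<Sigma>"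
  have V1: "V x \<ge> 1" if "x \<in> \<Sigma>" for x
    using lorentz_hyperbolic_le[OF x0 on_hyperboloid(1)[OF that]] by (simp add: V_def)
  have aa: "lorentz x0 x0 = -1" using x0 by (simp add: hyperbolic_space_def)
  have uV: "(u x)\<^sup>2 + 1 \<le> (V x)\<^sup>2" if "x \<in> \<Sigma>" for x
    using support_bound[OF that aa] by (simp add: u_def V_def)
  have kap: "pk x j \<ge> 1" if "x \<in> \<Sigma>" for x j
    using hc principal_frame_facts(6)[OF that] that unfolding horospherically_convex_def by (metis rangeI)
  have pj: "p j x \<ge> 0" if "x \<in> \<Sigma>" for j x
  proof -
    have "esym UNIV j (pk x) \<ge> 0" by (rule esym_nonneg) (use kap[OF that] in \<open>auto intro: order.trans[OF zero_le_one]\<close>)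
    then show ?thesis by (simp add: p_def mean_curv_esym[OF that])
  qed
  have cV: "continuous_on \<Sigma> V" unfolding V_def[abs_def]
    by (intro continuous_on_minus lorentz.continuous_on continuous_on_const continuous_on_id)
  have cu: "continuous_on \<Sigma> u" unfolding u_def[abs_def]
    by (intro continuous_on_minus lorentz.continuous_on continuous_on_const normal_cont)
  have cp: "continuous_on \<Sigma> (p j)" for j unfolding p_def[abs_def] using mean_curv_continuous by simp
  have V0: "\<forall>x\<in>\<Sigma>. V x \<noteq> 0" using V1 by force
  have ic: "integrable (area_measure \<Sigma>) f" if "continuous_on \<Sigma> f" for f :: "_ \<Rightarrow> real"
    using continuous_integrable[OF that] .
  note cont = continuous_on_mult continuous_on_diff continuous_on_add continuous_on_divide cV cu cp

  have minkowski: "?I (\<lambda>x. u x * p k x - V x * p (k - 1) x) = 0"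
  proof -
    \<comment> \<open>The coefficient of index \<open>k - 1\<close> with constant multiplier 1
      involves \<open>p k\<close> and \<open>p (k - 1)\<close>. The factor is nonzero because
      \<open>1 \<le> k \<le> CARD('m)\<close>.\<close>
    let ?c = "real (Suc (k - 1)) * real (CARD('m) choose Suc (k - 1))"
    have sk: "Suc (k - 1) = k" using k by simp
    have c: "?c \<noteq> 0" using k by (simp add: sk)
    have "divg_coeff (k - 1) x0 (\<lambda>_. 1) (\<lambda>_ _. 0) x = ?c * (u x * p k x - V x * p (k - 1) x)" for x
      unfolding divg_coeff_def sk u_def V_def p_def by simp
    then have "?c * ?I (\<lambda>x. u x * p k x - V x * p (k - 1) x) = 0"
      using divg_coeff_integral(2)[OF tang_C1_const, of "k - 1" x0 1] k by simp
    then show ?thesis using c by simp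
  qed

  have second: "?I (\<lambda>x. (u x)\<^sup>2 * p (k + 1) x / V x - u x * p k x) \<ge> 0"
  proof -
    \<comment> \<open>The differential of \<open>u / V\<close> in the shape in which the product and
      inverse rules produce it. On a principal direction it is
      \<open>(pk x j - u x / V x) / V x\<close> times the differential of \<open>V\<close>.\<close>
    let ?L = "\<lambda>x v. u x * - (inverse (V x) * - lorentz x0 v * inverse (V x))
        + - lorentz x0 (shape_operator \<Sigma> \<nu> x v) * inverse (V x)"
    let ?\<sigma> = "\<lambda>x. u x * inverse (V x)"
    have t: "tang_C1 ?\<sigma> ?L"
      unfolding u_def[abs_def] V_def[abs_def]
      by (rule tang_C1_mult[OF tang_C1_support tang_C1_inverse[OF tang_C1_height]])
         (use V0 in \<open>auto simp: V_def\<close>)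
    let ?c = "real (Suc k) * real (CARD('m) choose Suc k)"
    \<comment> \<open>The differential of \<open>u / V\<close> paired with the Newton field. Every
      summand is nonnegative: the curvatures are at least 1, \<open>u / V\<close> is at most 1, and
      symmetric functions of positive numbers are nonnegative.\<close>
    let ?R = "\<lambda>x. \<Sum>j\<in>UNIV. (pk x j - u x / V x) * (lorentz x0 (pe x j))\<^sup>2 * esym (UNIV - {j}) k (pk x) / V x"
    let ?f = "\<lambda>x. (u x)\<^sup>2 * p (k + 1) x / V x - u x * p k x"
    have c: "?c > 0" using k by simp
    have eq: "divg_coeff k x0 ?\<sigma> ?L x = ?c * ?f x - ?R x" if x: "x \<in> \<Sigma>" for x
    proof -
      have Vx: "V x \<noteq> 0" using V0 x by blast
      have "?L x (pe x j) * lorentz x0 (pe x j) * esym (UNIV - {j}) k (pk x)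
          = - ((pk x j - u x / V x) * (lorentz x0 (pe x j))\<^sup>2 * esym (UNIV - {j}) k (pk x) / V x)" for j
        using Vx by (simp add: principal_frame_facts(3)[OF x] lorentz.scaleR_right field_simps power2_eq_square)
      moreover have "?\<sigma> x * (- lorentz x0 (\<nu> x) * mean_curv \<Sigma> \<nu> (Suc k) x + lorentz x0 x * mean_curv \<Sigma> \<nu> k x) = ?f x"
      proof -
        have "lorentz x0 x = - V x" "- lorentz x0 (\<nu> x) = u x" by (simp_all add: V_def u_def)
        then show ?thesis using Vx by (simp only: p_def[symmetric]) (simp add: field_simps power2_eq_square)
      qed
      ultimately show ?thesis unfolding divg_coeff_def by (simp add: sum_negf)
    qed
    have Rp: "?R x \<ge> 0" if x: "x \<in> \<Sigma>" for x
    proof -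
      have Vp: "V x > 0" using V1[OF x] by simp
      have "(u x)\<^sup>2 \<le> (V x)\<^sup>2" using uV[OF x] by linarith
      then have "u x \<le> V x" by (rule power2_le_imp_le) (use Vp in simp)
      then have "u x / V x \<le> 1" using Vp by simp
      then have "pk x j - u x / V x \<ge> 0" for j using kap[OF x, of j] by linarith
      moreover have "esym (UNIV - {j}) k (pk x) \<ge> 0" for j
        by (rule esym_nonneg) (use kap[OF x] in \<open>auto intro: order.trans[OF zero_le_one]\<close>)
      ultimately show ?thesis using Vp
        by (intro sum_nonneg divide_nonneg_pos mult_nonneg_nonneg) auto
    qed
    have cf: "continuous_on \<Sigma> ?f" unfolding power2_eq_square
      by (intro cont V0)
    have "0 \<le> ?I (\<lambda>x. ?c * ?f x - divg_coeff k x0 ?\<sigma> ?L x)"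
      by (rule integral_nonneg_AE) (use eq Rp in \<open>auto intro!: AE_I2 simp: space_area_measure\<close>)
    also have "\<dots> = ?I (\<lambda>x. ?c * ?f x) - ?I (divg_coeff k x0 ?\<sigma> ?L)"
      using k by (intro Bochner_Integration.integral_diff integrable_mult_right ic cf divg_coeff_integral(1)[OF t]) simp
    also have "\<dots> = ?c * ?I ?f" using divg_coeff_integral(2)[OF t] k by simp
    finally show ?thesis using c by (simp add: zero_le_mult_iff)
  qed

  \<comment> \<open>The two integral facts are added to the left-hand side; in the joint integrand
    the terms with \<open>p (k - 1)\<close> and \<open>p k\<close> cancel, and
    \<open>p (k + 1) x * ((u x)\<^sup>2 + 1) / V x\<close> remains.\<close>
  have "?I (\<lambda>x. V x * p (k - 1) x + p (k + 1) x / V x)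
      \<le> ?I (\<lambda>x. V x * p (k - 1) x + p (k + 1) x / V x) + ?I (\<lambda>x. (u x)\<^sup>2 * p (k + 1) x / V x - u x * p k x)
        + ?I (\<lambda>x. u x * p k x - V x * p (k - 1) x)"
    using second minkowski by simp
  also have "\<dots> = ?I (\<lambda>x. (V x * p (k - 1) x + p (k + 1) x / V x) + ((u x)\<^sup>2 * p (k + 1) x / V x - u x * p k x)
        + (u x * p k x - V x * p (k - 1) x))"
  proof -
    have i: "integrable (area_measure \<Sigma>) (\<lambda>x. V x * p (k - 1) x + p (k + 1) x / V x)"
      "integrable (area_measure \<Sigma>) (\<lambda>x. (u x)\<^sup>2 * p (k + 1) x / V x - u x * p k x)"
      "integrable (area_measure \<Sigma>) (\<lambda>x. u x * p k x - V x * p (k - 1) x)"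
      unfolding power2_eq_square by (intro ic cont V0)+
    show ?thesis
      by (simp only: Bochner_Integration.integral_add[OF Bochner_Integration.integrable_add[OF i(1,2)] i(3)]
          Bochner_Integration.integral_add[OF i(1,2)])
  qed
  also have "\<dots> \<le> ?I (\<lambda>x. V x * p (k + 1) x)"
  proof (rule integral_mono)
    show "integrable (area_measure \<Sigma>) (\<lambda>x. (V x * p (k - 1) x + p (k + 1) x / V x)
        + ((u x)\<^sup>2 * p (k + 1) x / V x - u x * p k x) + (u x * p k x - V x * p (k - 1) x))"
      unfolding power2_eq_square by (intro ic cont V0)
    show "integrable (area_measure \<Sigma>) (\<lambda>x. V x * p (k + 1) x)" by (intro ic cont)
    fix x assume "x \<in> space (area_measure \<Sigma>)"
    then have x: "x \<in> \<Sigma>" by (simp add: space_area_measure)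
    have "(V x * p (k - 1) x + p (k + 1) x / V x) + ((u x)\<^sup>2 * p (k + 1) x / V x - u x * p k x)
        + (u x * p k x - V x * p (k - 1) x) = p (k + 1) x * ((u x)\<^sup>2 + 1) / V x"
      by (simp add: field_simps add_divide_distrib)
    also have "\<dots> \<le> p (k + 1) x * (V x)\<^sup>2 / V x"
      using uV[OF x] pj[OF x] V1[OF x] by (intro divide_right_mono mult_left_mono) auto
    also have "\<dots> = V x * p (k + 1) x" using V1[OF x] by (simp add: power2_eq_square)
    finally show "(V x * p (k - 1) x + p (k + 1) x / V x) + ((u x)\<^sup>2 * p (k + 1) x / V x - u x * p k x)
        + (u x * p k x - V x * p (k - 1) x) \<le> V x * p (k + 1) x" .
  qed
  finally have main: "?I (\<lambda>x. V x * p (k - 1) x + p (k + 1) x / V x) \<le> ?I (\<lambda>x. V x * p (k + 1) x)" .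
  have w: "weight x0 x = V x" if "x \<in> \<Sigma>" for x
    using weight_eq[OF x0 on_hyperboloid(1)[OF that]] by (simp add: V_def)
  have "(\<integral>x. weight x0 x * mean_curv \<Sigma> \<nu> (k - 1) x + mean_curv \<Sigma> \<nu> (k + 1) x / weight x0 x \<partial>area_measure \<Sigma>)
      = ?I (\<lambda>x. V x * p (k - 1) x + p (k + 1) x / V x)"
    by (rule Bochner_Integration.integral_cong) (simp_all add: space_area_measure w p_def)
  moreover have "(\<integral>x. weight x0 x * mean_curv \<Sigma> \<nu> (k + 1) x \<partial>area_measure \<Sigma>) = ?I (\<lambda>x. V x * p (k + 1) x)"
    by (rule Bochner_Integration.integral_cong) (simp_all add: space_area_measure w p_def)
  ultimately show ?thesis using main by simp
qed

end

theorem theorem8p2: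
  fixes \<Sigma> :: "'m::finite minkowski set"
    and \<nu> :: "'m minkowski \<Rightarrow> 'm minkowski"
    and x0 :: "'m minkowski"
    and n k :: nat
  assumes "n = CARD('m) + 1"
    and "1 \<le> k" and "k < n - 1"
    and "x0 \<in> hyperbolic_space"
    and "closed_hypersurface \<Sigma>"
    and "outward_unit_normal \<Sigma> \<nu>"
    and "horospherically_convex \<Sigma> \<nu>"
  shows "(\<integral>x. weight x0 x * mean_curv \<Sigma> \<nu> (k + 1) x \<partial>area_measure \<Sigma>) \<ge>
         (\<integral>x. weight x0 x * mean_curv \<Sigma> \<nu> (k - 1) x
              + mean_curv \<Sigma> \<nu> (k + 1) x / weight x0 x \<partial>area_measure \<Sigma>)"
proof -
  interpret oriented_hypersurface \<Sigma> \<nu>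
    using assms(5,6) by unfold_locales (simp_all add: outward_unit_normal_def)
  show ?thesis by (rule weighted_curvature_inequality) (use assms in simp_all)
qed

end
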